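(* Assume: (a) the marginal CDF $F$ of the nonconformity scores $V_t$ is continuous and $\Theta=\sum_{k\ge0}\theta_k<\infty$; (b) there are $e>0$ and $0<c_f\le C_f<\infty$ such that $F$ has a density $f$ with $c_f\le f(v)\le C_f$ for $|v-q|\le e$, and this density is continuous at $q$; and $\mathbb P(V_s=V_t)=0$ for all distinct integer times $s,t$; (c) $\sum_{k\ge1}\left(\sum_{j\ge k}\theta_j\right)^{1/2}<\infty$; (d) the deterministic block length $\ell=\ell_n$ satisfies $\ell\to\infty$ and $\ell/n\to0$ as $n\to\infty$. Then, as $n\to\infty$, $\widehat\sigma_{\rm cov}^{\,2}\xrightarrow{\mathbb P}\sigma_{\rm cov}^2$, and $\sigma_{\rm cov}^2>0$, where $$\sigma_{\rm cov}^2=\sum_{h\in\mathbb Z}\operatorname{Cov}\{\mathbf 1(V_0\le q),\mathbf 1(V_h\le q)\}$$ and $\widehat\sigma_{\rm cov}^{\,2}$ is the nonoverlapping-block variance estimator defined in the context.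
   Context: Setup. $(\varepsilon_t)_{t\in\mathbb Z}$ are iid random innovations (possibly vector-valued). $Z_t=(X_t,Y_t)$, with $X_t\in\mathbb R^d$, $Y_t\in\mathbb R$, is a stationary process of the form $Z_t=G(\ldots,\varepsilon_{t-1},\varepsilon_t)$ with a measurable function $G$. The predictor $\widehat\mu:\mathbb R^d\to\mathbb R$ is a fixed (nonrandom) measurable function. The nonconformity scores are $V_t=|Y_t-\widehat\mu(X_t)|=H(\ldots,\varepsilon_{t-1},\varepsilon_t)$, with a measurable function $H$. $F(v)=\mathbb P(V_t\le v)$. Split conformal cutoff. For fixed $0<\alpha<1$, $k_n=\lceil(n+1)(1-\alpha)\rceil$, and $\widehat q_n=V_{(k_n)}$ is the $k_n$-th order statistic of $V_1,\ldots,V_n$ (with $\widehat q_n=\infty$ if $k_n>n$). $q=F^{-1}(1-\alpha)=\inf\{v:F(v)\ge1-\alpha\}$. Functional dependence of threshold indicators. Let $\varepsilon_0'$ be an independent copy of $\varepsilon_0$, independent of all the innovations, and let $V_k^*$ be $V_k$ with $\varepsilon_0$ replaced by $\varepsilon_0'$, all other innovations unchanged. With $\|U\|_2=(\mathbb E|U|^2)^{1/2}$, $\theta_k=\sup_{v\in\mathbb R}\|\mathbf 1\{V_k\le v\}-\mathbf 1\{V_k^*\le v\}\|_2$ for $k\ge0$, and $\Theta=\sum_{k=0}^\infty\theta_k$. Variance estimator. With block length $\ell=\ell_n$ and $B=\lfloor n/\ell\rfloor$ blocks, $$\overline I_j=\frac1\ell\sum_{t=(j-1)\ell+1}^{j\ell}\mathbf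 1(V_t\le\widehat q_n),\qquad \overline I=\frac1B\sum_{j=1}^B\overline I_j,\qquad \widehat\sigma_{\rm cov}^{\,2}=\frac{\ell}{B}\sum_{j=1}^B(\overline I_j-\overline I)^2.$$ *)

theory Defs
  imports "HOL-Probability.Probability"
begin

definition innov_past :: "(int \<Rightarrow> 'w \<Rightarrow> 'e) \<Rightarrow> int \<Rightarrow> 'w \<Rightarrow> nat \<Rightarrow> 'e" where
  \<comment> \<open>the history up to time t, listed backwards: entry i is the innovation at time t - i\<close>
  "innov_past \<epsilon> t \<omega> = (\<lambda>i. \<epsilon> (t - int i) \<omega>)"

definition quantile :: "(real \<Rightarrow> real) \<Rightarrow> real \<Rightarrow> real" where
  "quantile F p = Inf {v. F v \<ge> p}"

definition has_density_between :: "(real \<Rightarrow> real) \<Rightarrow> (real \<Rightarrow> real) \<Rightarrow> real \<Rightarrow> real \<Rightarrow> bool" where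
  \<comment> \<open>density of a distribution function on a compact interval only; outside of it nothing
    is required apart from measurability, which costs no generality (extend by 0)\<close>
  "has_density_between F f l u \<longleftrightarrow>
     f \<in> borel_measurable borel \<and>
     (\<forall>a b. l \<le> a \<and> a \<le> b \<and> b \<le> u \<longrightarrow>
        set_integrable lborel {a..b} f \<and> F b - F a = (LBINT x:{a..b}. f x))"

definition L2norm :: "'w measure \<Rightarrow> ('w \<Rightarrow> real) \<Rightarrow> real" where
  "L2norm M U = sqrt (LINT \<omega>|M. \<bar>U \<omega>\<bar>\<^sup>2)"

definition indicator_dependence ::
    "'w measure \<Rightarrow> (int \<Rightarrow> 'w \<Rightarrow> real) \<Rightarrow> (int \<Rightarrow> 'w \<Rightarrow> real) \<Rightarrow> nat \<Rightarrow> real" where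
  \<comment> \<open>the family under the supremum lies in [0, 1] when M is a probability measure\<close>
  "indicator_dependence M V V' k =
     (SUP v::real. L2norm M (\<lambda>\<omega>. of_bool (V (int k) \<omega> \<le> v) - of_bool (V' (int k) \<omega> \<le> v)))"

definition order_stat :: "nat \<Rightarrow> real list \<Rightarrow> real" where
  \<comment> \<open>1-based: the k-th smallest entry, for k between 1 and the length\<close>
  "order_stat k xs = sort xs ! (k - 1)"

definition cutoff_rank :: "real \<Rightarrow> nat \<Rightarrow> nat" where
  "cutoff_rank \<alpha> n = nat \<lceil>(real n + 1) * (1 - \<alpha>)\<rceil>"

definition conformal_cutoff :: "(int \<Rightarrow> 'w \<Rightarrow> real) \<Rightarrow> real \<Rightarrow> nat \<Rightarrow> 'w \<Rightarrow> ereal" where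
  "conformal_cutoff V \<alpha> n \<omega> =
     (if cutoff_rank \<alpha> n \<le> n
      then ereal (order_stat (cutoff_rank \<alpha> n) (map (\<lambda>t. V (int t) \<omega>) [1..<n + 1]))
      else \<infinity>)"

definition block_mean ::
    "(int \<Rightarrow> 'w \<Rightarrow> real) \<Rightarrow> real \<Rightarrow> nat \<Rightarrow> nat \<Rightarrow> nat \<Rightarrow> 'w \<Rightarrow> real" where
  "block_mean V \<alpha> n l j \<omega> =
     (1 / real l) *
     (\<Sum>t = (j - 1) * l + 1..j * l. of_bool (ereal (V (int t) \<omega>) \<le> conformal_cutoff V \<alpha> n \<omega>))"

definition overall_block_mean ::
    "(int \<Rightarrow> 'w \<Rightarrow> real) \<Rightarrow> real \<Rightarrow> nat \<Rightarrow> nat \<Rightarrow> 'w \<Rightarrow> real" where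
  "overall_block_mean V \<alpha> n l \<omega> =
     (1 / real (n div l)) * (\<Sum>j = 1..n div l. block_mean V \<alpha> n l j \<omega>)"

definition block_variance_estimator ::
    "(int \<Rightarrow> 'w \<Rightarrow> real) \<Rightarrow> real \<Rightarrow> nat \<Rightarrow> nat \<Rightarrow> 'w \<Rightarrow> real" where
  "block_variance_estimator V \<alpha> n l \<omega> =
     (real l / real (n div l)) *
     (\<Sum>j = 1..n div l. (block_mean V \<alpha> n l j \<omega> - overall_block_mean V \<alpha> n l \<omega>)\<^sup>2)"

definition covariance :: "'w measure \<Rightarrow> ('w \<Rightarrow> real) \<Rightarrow> ('w \<Rightarrow> real) \<Rightarrow> real" where
  "covariance M A B =
     (LINT \<omega>|M. (A \<omega> - (LINT \<omega>'|M. A \<omega>')) * (B \<omega> - (LINT \<omega>'|M. B \<omega>')))"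

definition long_run_variance :: "'w measure \<Rightarrow> (int \<Rightarrow> 'w \<Rightarrow> real) \<Rightarrow> real \<Rightarrow> real" where
  \<comment> \<open>infsum is 0 for a family that is not (unconditionally) summable, so a positive value
    entails convergence of the series\<close>
  "long_run_variance M V q =
     (\<Sum>\<^sub>\<infinity>h\<in>UNIV. covariance M (\<lambda>\<omega>. of_bool (V 0 \<omega> \<le> q)) (\<lambda>\<omega>. of_bool (V h \<omega> \<le> q)))"

definition tendsto_in_prob :: "'w measure \<Rightarrow> (nat \<Rightarrow> 'w \<Rightarrow> real) \<Rightarrow> real \<Rightarrow> bool" where
  "tendsto_in_prob M U c \<longleftrightarrow>
     (\<forall>d>0. (\<lambda>n. measure M {\<omega> \<in> space M. \<bar>U n \<omega> - c\<bar> > d}) \<longlonglongrightarrow> 0)"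

end

theory Submission
  imports Defs
begin

text \<open>
The proof replaces martingale approximation by a coupling. Resample all innovations up to time \<open>s\<close>.
Innovations can be exchanged one at a time, and exchanging the one at lag \<open>j\<close> changes
the indicator of \<open>V t \<le> v\<close> with probability at most \<open>(\<theta> j)\<^sup>2\<close>, because the difference of two
indicators has modulus 0 or 1. So the whole resampling changes that indicator with
probability at most \<open>\<Sum>j\<ge>t-s. (\<theta> j)\<^sup>2\<close>. The tail condition says that the decreasing sequence
\<open>sqrt (\<Sum>j\<ge>h. \<theta> j)\<close> is summable, hence it is \<open>O(1/h)\<close>, and the probability is \<open>O(h^-4)\<close>
(\<open>resample_past\<close>, \<open>quartic_tail\<close>). After the resampling the indicators are independent of
the history up to \<open>s\<close>. This bounds the covariance of a bounded functional of the history
with a bounded functional of finitely many later indicators (\<open>decoupling\<close>). The locale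
\<open>weakly_dependent\<close> keeps only this inequality and stationarity; all limit theory is derived in it.

Consistency. Let \<open>l\<close> be the block length, \<open>B\<close> the number of blocks, and consider first the
indicators at the fixed level \<open>q\<close>. Fourth moments of sums of \<open>l\<close> centred indicators are \<open>O(l\<^sup>2)\<close>
(\<open>psum_fourth_moment\<close>), so the squared block sums divided by \<open>l\<close> have bounded variances. Their
covariances are summable over the distance of the blocks, so their average has variance \<open>O(1/B)\<close>
(\<open>mean_square_block_sums\<close>), and its mean \<open>Var S\<^sub>l / l\<close> tends to the long-run variance.
To pass to the random cutoff take \<open>r = (n l) powr (-1/4)\<close>. Since \<open>n r\<^sup>2\<close> tends to infinity,
Chebyshev's inequality puts the cutoff within \<open>r\<close> of \<open>q\<close> with high probability. Every indicator
that changes between \<open>q\<close> and the cutoff is counted in the window from \<open>q - r\<close> to \<open>q + r\<close>.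
Since \<open>l r\<^sup>2\<close> tends to 0, the counts of scores in this window are negligible in all blocks together
(\<open>increment_second_moment\<close>, \<open>estimator_deviation\<close>).

Positivity. Let \<open>p = F q\<close> and let \<open>S\<^sub>n\<close> be the sum of the first \<open>n\<close> centred indicators at level \<open>q\<close>.
If the long-run variance were 0, the variances of \<open>S\<^sub>n\<close> would be bounded, as for a coboundary.
Averaging the cut points over \<open>m\<close> positions at either end writes \<open>S\<^sub>n = L + Z + R\<close>, where \<open>L\<close>
depends on the first \<open>m\<close> indicators, \<open>R\<close> on the last \<open>m\<close>, and \<open>Z\<close> is small in mean square for
large \<open>m\<close>, uniformly in \<open>n\<close> (\<open>smoothed_middle_small\<close>). But \<open>S\<^sub>n + n p\<close> is an integer, so the phase
\<open>exp (2 \<pi> \<i> S\<^sub>n)\<close> is the constant \<open>exp (- 2 \<pi> \<i> n p)\<close>, whereas by decoupling and stationarity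
it is close to a product of expectations that does not involve \<open>n\<close>. Comparing \<open>n\<close> and \<open>n + 1\<close>
gives \<open>exp (2 \<pi> \<i> p) = 1\<close>, which is impossible for \<open>0 < p < 1\<close> (\<open>lrv_pos\<close>).
\<close>

section \<open>Inverse square series and double sums\<close>

text \<open>Telescoping, from \<open>1 / (1 + b)\<^sup>2 \<le> 1 / b - 1 / (1 + b)\<close>.\<close>

lemma inverse_square_tail:
  assumes "a < b"
  shows "(\<Sum>k=a..<b. 1 / (1 + real k)\<^sup>2) \<le> 2 / (1 + real a) - 1 / real b"
  using assms
proof (induction b)
  case (Suc b)
  show ?case
  proof (cases "a = b")
    case True
    have "1 / (1 + real b)\<^sup>2 \<le> 1 / (1 + real b)"
      by (rule divide_left_mono) (auto simp: self_le_power)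
    then show ?thesis using True by (simp add: algebra_simps)
  next
    case False
    with Suc have ab: "a < b" by simp
    have "1 / (1 + real b)\<^sup>2 \<le> 1 / (real b * (1 + real b))"
      using ab by (intro divide_left_mono mult_pos_pos)
        (auto simp: power2_eq_square algebra_simps intro!: add_pos_nonneg)
    also have "\<dots> = 1 / real b - 1 / (1 + real b)"
      using ab by (simp add: field_simps)
    finally have "1 / (1 + real b)\<^sup>2 \<le> 1 / real b - 1 / (1 + real b)" .
    then show ?thesis using Suc.IH[OF ab] ab by (simp add: algebra_simps)
  qed
qed simp

lemma inverse_square_tail_le: "(\<Sum>k=a..<b. 1 / (1 + real k)\<^sup>2) \<le> 2 / (1 + real a)"
proof (cases "a < b")
  case True
  have "0 \<le> 1 / real b" by simp
  then show ?thesis using inverse_square_tail[OF True] by linarith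
qed simp

lemma inverse_square_sum: "(\<Sum>k<n. 1 / (1 + real k)\<^sup>2) \<le> 2"
  using inverse_square_tail_le[of 0 n] by (simp add: atLeast0LessThan)

lemma inverse_square_summable: "summable (\<lambda>k. 1 / (1 + real k)\<^sup>2)"
  by (rule summableI_nonneg_bounded[where x = 2]) (auto intro: inverse_square_sum)

lemma inverse_square_suminf: "(\<Sum>k. 1 / (1 + real k)\<^sup>2) \<le> 2"
  by (rule suminf_le_const[OF inverse_square_summable inverse_square_sum])

text \<open>The harmonic sum is only needed up to \<open>o(n)\<close>; the square root is convenient because it avoids
logarithms in later constants.\<close>

lemma inverse_sum_sqrt: "(\<Sum>k<n. 1 / (1 + real k)) \<le> 2 * sqrt (real n)"
proof (induction n)
  case (Suc n)
  have le: "sqrt (1 + real n) \<le> 1 + real n"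
    by (rule real_le_lsqrt[of "1 + real n" "1 + real n", simplified power2_eq_square]) auto
  have "sqrt (real n) + sqrt (1 + real n) \<le> (1 + real n) + (1 + real n)"
    by (intro add_mono le order_trans[OF _ le]) simp
  then have le2: "sqrt (real n) + sqrt (1 + real n) \<le> 2 * (1 + real n)" by simp
  have pos: "0 < sqrt (real n) + sqrt (1 + real n)" by (simp add: add_nonneg_pos)
  moreover have "(sqrt (1 + real n) - sqrt (real n)) * (sqrt (real n) + sqrt (1 + real n)) = 1"
    by (simp add: algebra_simps)
  ultimately have "sqrt (1 + real n) - sqrt (real n) = 1 / (sqrt (real n) + sqrt (1 + real n))"
    by (simp add: nonzero_eq_divide_eq)
  also have "\<dots> \<ge> 1 / (2 * (1 + real n))"
    using le2 pos by (intro divide_left_mono) auto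
  finally have "2 * (1 / (2 * (1 + real n))) \<le> 2 * (sqrt (1 + real n) - sqrt (real n))"
    by (rule mult_left_mono) simp
  moreover have "2 * (1 / (2 * (1 + real n))) = 1 / (1 + real n)" by (simp add: field_simps)
  ultimately have "1 / (1 + real n) \<le> 2 * (sqrt (1 + real n) - sqrt (real n))" by (rule ord_eq_le_trans[OF sym, rotated])
  then show ?case using Suc by simp
qed simp

text \<open>Every row of the matrix meets each distance from the diagonal at most twice.\<close>

lemma double_sum_bound:
  fixes r :: "nat \<Rightarrow> nat \<Rightarrow> real" and \<rho> :: "nat \<Rightarrow> real"
  assumes r: "\<And>i j. i \<le> j \<Longrightarrow> j < n \<Longrightarrow> r i j \<le> \<rho> (j - i)"
    and sym: "\<And>i j. r i j = r j i" and \<rho>: "\<And>h. 0 \<le> \<rho> h"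
  shows "(\<Sum>i<n. \<Sum>j<n. r i j) \<le> 2 * real n * (\<Sum>h<n. \<rho> h)"
proof -
  have row: "(\<Sum>j<n. r i j) \<le> 2 * (\<Sum>h<n. \<rho> h)" if i: "i < n" for i
  proof -
    have "(\<Sum>j<n. r i j) = (\<Sum>j<i. r i j) + (\<Sum>j=i..<n. r i j)"
      using i sum.atLeastLessThan_concat[of 0 i n "r i"] by (simp add: atLeast0LessThan)
    also have "(\<Sum>j<i. r i j) \<le> (\<Sum>j<i. \<rho> (i - j))"
      using r i by (intro sum_mono) (subst sym, auto)
    also have "(\<Sum>j<i. \<rho> (i - j)) = (\<Sum>h\<in>(\<lambda>j. i - j) ` {..<i}. \<rho> h)"
      by (subst sum.reindex) (auto simp: inj_on_def)
    also have "\<dots> \<le> (\<Sum>h<n. \<rho> h)" using i \<rho> by (intro sum_mono2) auto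
    also have "(\<Sum>j=i..<n. r i j) \<le> (\<Sum>j=i..<n. \<rho> (j - i))" using r by (intro sum_mono) auto
    also have "(\<Sum>j=i..<n. \<rho> (j - i)) = (\<Sum>h\<in>(\<lambda>j. j - i) ` {i..<n}. \<rho> h)"
      by (subst sum.reindex) (auto simp: inj_on_def)
    also have "\<dots> \<le> (\<Sum>h<n. \<rho> h)" using i \<rho> by (intro sum_mono2) auto
    finally show ?thesis by simp
  qed
  have "(\<Sum>i<n. \<Sum>j<n. r i j) \<le> (\<Sum>i<n. 2 * (\<Sum>h<n. \<rho> h))" by (intro sum_mono row) auto
  then show ?thesis by (simp add: algebra_simps)
qed

section \<open>Bounded random variables\<close>

text \<open>The bound holds at every point and not just almost surely. Integrability of every polynomial in
such variables then follows from closure rules, without discussing null sets.\<close>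

definition bounded_rv :: "'a measure \<Rightarrow> ('a \<Rightarrow> real) \<Rightarrow> bool" where
  "bounded_rv M A \<longleftrightarrow> A \<in> borel_measurable M \<and> (\<exists>a. \<forall>x. \<bar>A x\<bar> \<le> a)"

lemma bounded_rvI: "A \<in> borel_measurable M \<Longrightarrow> (\<And>x. \<bar>A x\<bar> \<le> a) \<Longrightarrow> bounded_rv M A"
  by (auto simp: bounded_rv_def)

lemma bounded_rv_measurable: "bounded_rv M A \<Longrightarrow> A \<in> borel_measurable M"
  by (simp add: bounded_rv_def)

lemma bounded_rv_add: "bounded_rv M A \<Longrightarrow> bounded_rv M B \<Longrightarrow> bounded_rv M (\<lambda>x. A x + B x)"
  unfolding bounded_rv_def
proof (safe, simp)
  fix a b assume "\<forall>x. \<bar>A x\<bar> \<le> a" "\<forall>x. \<bar>B x\<bar> \<le> b"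
  then have "\<forall>x. \<bar>A x + B x\<bar> \<le> a + b" by (meson abs_triangle_ineq add_mono order_trans)
  then show "\<exists>a. \<forall>x. \<bar>A x + B x\<bar> \<le> a" ..
qed

lemma bounded_rv_mult: "bounded_rv M A \<Longrightarrow> bounded_rv M B \<Longrightarrow> bounded_rv M (\<lambda>x. A x * B x)"
  unfolding bounded_rv_def
proof (safe, simp)
  fix a b assume *: "\<forall>x. \<bar>A x\<bar> \<le> a" "\<forall>x. \<bar>B x\<bar> \<le> b"
  have "\<bar>A x * B x\<bar> \<le> a * b" for x
    unfolding abs_mult using * by (intro mult_mono) (auto intro: order_trans[OF abs_ge_zero])
  then show "\<exists>a. \<forall>x. \<bar>A x * B x\<bar> \<le> a" by blast
qed

lemma bounded_rv_const: "bounded_rv M (\<lambda>x. c)"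
  by (rule bounded_rvI[where a = "\<bar>c\<bar>"]) auto

lemma bounded_rv_uminus: "bounded_rv M A \<Longrightarrow> bounded_rv M (\<lambda>x. - A x)"
  by (auto simp: bounded_rv_def)

lemma bounded_rv_diff: "bounded_rv M A \<Longrightarrow> bounded_rv M B \<Longrightarrow> bounded_rv M (\<lambda>x. A x - B x)"
  using bounded_rv_add[OF _ bounded_rv_uminus, of M A B] by simp

lemma bounded_rv_divide: "bounded_rv M A \<Longrightarrow> bounded_rv M (\<lambda>x. A x / c)"
  using bounded_rv_mult[OF _ bounded_rv_const[of M "1 / c"], of A] by simp

lemma bounded_rv_power: "bounded_rv M A \<Longrightarrow> bounded_rv M (\<lambda>x. A x ^ k)"
  by (induction k) (auto intro: bounded_rv_const bounded_rv_mult)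

lemma bounded_rv_abs: "bounded_rv M A \<Longrightarrow> bounded_rv M (\<lambda>x. \<bar>A x\<bar>)"
  by (auto simp: bounded_rv_def)

lemma bounded_rv_sum:
  "(\<And>i. i \<in> I \<Longrightarrow> bounded_rv M (A i)) \<Longrightarrow> bounded_rv M (\<lambda>x. \<Sum>i\<in>I. A i x)"
  by (induction I rule: infinite_finite_induct)
     (auto intro: bounded_rv_const bounded_rv_add)

lemmas bounded_rv_intros = bounded_rv_add bounded_rv_mult bounded_rv_const bounded_rv_uminus
  bounded_rv_diff bounded_rv_divide bounded_rv_power bounded_rv_abs bounded_rv_sum

lemma (in prob_space) bounded_rv_integrable: "bounded_rv M A \<Longrightarrow> integrable M A"
  unfolding bounded_rv_def by (metis (no_types, lifting) AE_I2 integrable_const_bound real_norm_def)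

lemma (in prob_space) abs_expectation_le:
  fixes A :: "'a \<Rightarrow> real"
  assumes "A \<in> borel_measurable M" "\<And>x. \<bar>A x\<bar> \<le> a"
  shows "\<bar>expectation A\<bar> \<le> a"
proof -
  have "bounded_rv M A" using assms by (rule bounded_rvI)
  then have "\<bar>expectation A\<bar> \<le> expectation (\<lambda>x. a)"
    using assms by (intro order_trans[OF integral_abs_bound integral_mono]
        bounded_rv_integrable bounded_rv_intros) auto
  then show ?thesis by (simp add: prob_space)
qed

lemma (in prob_space) second_moment_sum:
  fixes X :: "nat \<Rightarrow> 'a \<Rightarrow> real"
  assumes X: "\<And>i. i < n \<Longrightarrow> bounded_rv M (X i)"
    and cov: "\<And>i j. i \<le> j \<Longrightarrow> j < n \<Longrightarrow> expectation (\<lambda>x. X i x * X j x) \<le> \<rho> (j - i)"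
    and \<rho>: "\<And>h. 0 \<le> \<rho> h"
  shows "expectation (\<lambda>x. (\<Sum>i<n. X i x)\<^sup>2) \<le> 2 * real n * (\<Sum>h<n. \<rho> h)"
proof -
  have "expectation (\<lambda>x. (\<Sum>i<n. X i x)\<^sup>2) = expectation (\<lambda>x. \<Sum>i<n. \<Sum>j<n. X i x * X j x)"
    by (simp add: power2_eq_square sum_product)
  also have "\<dots> = (\<Sum>i<n. expectation (\<lambda>x. \<Sum>j<n. X i x * X j x))"
    by (rule Bochner_Integration.integral_sum) (auto intro!: bounded_rv_integrable bounded_rv_intros X)
  also have "\<dots> = (\<Sum>i<n. \<Sum>j<n. expectation (\<lambda>x. X i x * X j x))"
    by (intro sum.cong refl Bochner_Integration.integral_sum)
      (auto intro!: bounded_rv_integrable bounded_rv_intros X)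
  also have "\<dots> \<le> 2 * real n * (\<Sum>h<n. \<rho> h)"
    using cov \<rho> by (intro double_sum_bound) (auto simp: mult.commute)
  finally show ?thesis .
qed

lemma (in prob_space) markov_bounded:
  assumes "bounded_rv M X" "\<And>x. 0 \<le> X x" "0 < t"
  shows "measure M {x \<in> space M. t \<le> X x} \<le> expectation X / t"
  using integral_Markov_inequality_measure[of M X "{}" t] assms
  by (auto simp: bounded_rv_integrable)

section \<open>Order statistics and empirical variances\<close>

lemma sorted_nth_le_iff:
  fixes ys :: "real list"
  assumes "sorted ys" "i < length ys"
  shows "ys ! i \<le> v \<longleftrightarrow> i < length (filter (\<lambda>y. y \<le> v) ys)"
  using assms
proof (induction ys arbitrary: i)
  case (Cons y ys)
  show ?case
  proof (cases "y \<le> v")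
    case True
    then show ?thesis using Cons by (cases i) auto
  next
    case False
    then have "\<not> z \<le> v" if "z \<in> set (y # ys)" for z using Cons.prems(1) that by auto
    then have "filter (\<lambda>y. y \<le> v) (y # ys) = []" and "\<not> (y # ys) ! i \<le> v"
      using Cons.prems(2) nth_mem by (auto simp only: filter_empty_conv)
    then show ?thesis by simp
  qed
qed simp

lemma order_stat_le_iff:
  assumes "1 \<le> k" "k \<le> length xs"
  shows "order_stat k xs \<le> v \<longleftrightarrow> k \<le> length (filter (\<lambda>x. x \<le> v) xs)"
proof -
  have "length (filter (\<lambda>x. x \<le> v) (sort xs)) = length (filter (\<lambda>x. x \<le> v) xs)"
    by (metis mset_filter mset_sort size_mset)
  then show ?thesis
    unfolding order_stat_def using sorted_nth_le_iff[of "sort xs" "k - 1" v] assms by auto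
qed

lemma length_filter_upt:
  "real (length (filter P (map f [1..<n + 1]))) = (\<Sum>i<n. of_bool (P (f (Suc i))))"
  by (induction n) simp_all

text \<open>The variance of \<open>a 0, \<dots>, a (B - 1)\<close> under the uniform distribution on the \<open>B\<close> indices.\<close>

definition emp_var :: "nat \<Rightarrow> (nat \<Rightarrow> real) \<Rightarrow> real" where
  "emp_var B a = (\<Sum>j<B. (a j - (\<Sum>i<B. a i) / real B)\<^sup>2) / real B"

lemma emp_var_nonneg: "0 \<le> emp_var B a"
  by (simp add: emp_var_def sum_nonneg)

lemma emp_var_shift: "emp_var B (\<lambda>j. a j + c) = emp_var B a"
  by (cases "B = 0") (simp_all add: emp_var_def sum.distrib add_divide_distrib)

lemma emp_var_alt:
  "emp_var B a = (\<Sum>j<B. (a j)\<^sup>2) / real B - ((\<Sum>j<B. a j) / real B)\<^sup>2"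
proof (cases "B = 0")
  case False
  define m where "m = (\<Sum>j<B. a j) / real B"
  have s: "(\<Sum>j<B. a j) = real B * m" using False by (simp add: m_def)
  have "(\<Sum>j<B. (a j - m)\<^sup>2) = (\<Sum>j<B. (a j)\<^sup>2 - 2 * m * a j + m\<^sup>2)"
    by (simp add: power2_eq_square algebra_simps)
  also have "\<dots> = (\<Sum>j<B. (a j)\<^sup>2) - 2 * m * (real B * m) + real B * m\<^sup>2"
    by (simp add: sum.distrib sum_subtractf sum_distrib_left[symmetric] s)
  finally have "(\<Sum>j<B. (a j - m)\<^sup>2) = (\<Sum>j<B. (a j)\<^sup>2) - real B * m\<^sup>2"
    by (simp add: power2_eq_square algebra_simps)
  then show ?thesis using False by (simp add: emp_var_def m_def[symmetric] diff_divide_distrib)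
qed (simp add: emp_var_def)

text \<open>The square root of the empirical variance is a seminorm; this is its triangle inequality, squared.\<close>

lemma emp_var_add_le:
  "\<bar>emp_var B (\<lambda>j. a j + d j) - emp_var B a\<bar> \<le> 2 * sqrt (emp_var B a * emp_var B d) + emp_var B d"
proof -
  define ma md where "ma = (\<Sum>i<B. a i) / real B" and "md = (\<Sum>i<B. d i) / real B"
  define x y where "x j = a j - ma" and "y j = d j - md" for j
  have "emp_var B (\<lambda>j. a j + d j) = (\<Sum>j<B. (x j + y j)\<^sup>2) / real B"
    unfolding emp_var_def x_def y_def ma_def md_def
    by (simp add: sum.distrib add_divide_distrib algebra_simps)
  also have "(\<Sum>j<B. (x j + y j)\<^sup>2) = (\<Sum>j<B. (x j)\<^sup>2) + 2 * (\<Sum>j<B. x j * y j) + (\<Sum>j<B. (y j)\<^sup>2)"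
    by (simp add: power2_sum sum.distrib sum_distrib_left mult.assoc)
  finally have e: "emp_var B (\<lambda>j. a j + d j) - emp_var B a = 2 * ((\<Sum>j<B. x j * y j) / real B) + emp_var B d"
    by (simp add: emp_var_def x_def y_def ma_def md_def add_divide_distrib)
  have "(\<Sum>j<B. x j * y j)\<^sup>2 \<le> (\<Sum>j<B. (x j)\<^sup>2) * (\<Sum>j<B. (y j)\<^sup>2)"
    by (rule Cauchy_Schwarz_ineq_sum)
  then have "((\<Sum>j<B. x j * y j) / real B)\<^sup>2 \<le> emp_var B a * emp_var B d"
    by (simp add: emp_var_def x_def y_def ma_def md_def power_divide power2_eq_square[of "real B"] divide_right_mono)
  then have "\<bar>(\<Sum>j<B. x j * y j) / real B\<bar> \<le> sqrt (emp_var B a * emp_var B d)"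
    by (rule real_le_rsqrt[of "\<bar>_\<bar>", unfolded power2_abs])
  then show ?thesis unfolding e using emp_var_nonneg[of B d] by linarith
qed

text \<open>As an empirical variance of block counts the estimator does not change when a constant is added to
all counts. This allows the counts at a random cutoff to be compared with sums that are centred at
the fixed level.\<close>

lemma block_variance_estimator_emp_var:
  "block_variance_estimator V \<alpha> n l \<omega> =
    emp_var (n div l) (\<lambda>j. \<Sum>i<l. of_bool (ereal (V (1 + int (j * l) + int i) \<omega>) \<le> conformal_cutoff V \<alpha> n \<omega>)) / real l"
proof -
  define a where "a j = (\<Sum>i<l. of_bool (ereal (V (1 + int (j * l) + int i) \<omega>) \<le> conformal_cutoff V \<alpha> n \<omega>) :: real)" for j
  define B where "B = n div l"
  have bm: "block_mean V \<alpha> n l (Suc j) \<omega> = a j / real l" for j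
  proof -
    have "(\<Sum>t = (Suc j - 1) * l + 1..Suc j * l. of_bool (ereal (V (int t) \<omega>) \<le> conformal_cutoff V \<alpha> n \<omega>) :: real) = a j"
      unfolding a_def
      by (rule sum.reindex_bij_witness[of _ "\<lambda>i. j * l + 1 + i" "\<lambda>t. t - (j * l + 1)"])
        (auto simp: algebra_simps of_nat_diff)
    then show ?thesis by (simp add: block_mean_def)
  qed
  have r [unfolded One_nat_def, simp]: "(\<Sum>j=1..B. f j) = (\<Sum>j<B. f (Suc j))" for f :: "nat \<Rightarrow> real"
    using sum.shift_bounds_Suc_ivl[of f 0 B] by (simp add: atLeastLessThanSuc_atLeastAtMost atLeast0LessThan)
  have om: "overall_block_mean V \<alpha> n l \<omega> = (\<Sum>j<B. a j) / real B / real l"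
    by (simp add: overall_block_mean_def bm B_def[symmetric] sum_divide_distrib[symmetric] mult.commute)
  have "block_variance_estimator V \<alpha> n l \<omega> = real l / real B * (\<Sum>j<B. ((a j - (\<Sum>j<B. a j) / real B) / real l)\<^sup>2)"
    by (simp add: block_variance_estimator_def bm om B_def[symmetric] diff_divide_distrib)
  also have "\<dots> = emp_var B a / real l"
    by (cases "l = 0") (simp_all add: emp_var_def power_divide sum_divide_distrib[symmetric] power2_eq_square)
  finally show ?thesis by (simp add: a_def[abs_def] B_def)
qed

section \<open>Resampling the past of an iid sequence\<close>

text \<open>The full space of the law makes the product space the type of all families, so that events
and functions on it need no domain restriction.\<close>

locale innovation_law = prob_space \<nu> for \<nu> :: "'e measure" +
  assumes space_law: "space \<nu> = UNIV"
begin

abbreviation iid :: "('i \<Rightarrow> 'e) measure" where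
  "iid \<equiv> Pi\<^sub>M UNIV (\<lambda>_. \<nu>)"

lemma space_iid [simp]: "space iid = UNIV"
  by (simp add: space_PiM space_law)

lemma prob_space_iid: "prob_space (iid :: ('i \<Rightarrow> 'e) measure)"
  by (intro prob_space_PiM prob_space_axioms)

lemma measurable_reindex: "(\<lambda>\<omega> i. \<omega> (f i)) \<in> measurable iid iid"
  by (rule measurable_PiM_single') (auto simp: space_law)

text \<open>Every distributional identity of this section is an instance: all couplings are injective renamings
of the coordinates of one product space.\<close>

lemma distr_reindex:
  assumes "inj f"
  shows "distr iid iid (\<lambda>\<omega> i. \<omega> (f i)) = iid"
  using distr_PiM_reindex[of UNIV "\<lambda>_. \<nu>" f UNIV] assms prob_space_axioms by (simp add: restrict_UNIV)

text \<open>Two independent copies of the innovations are kept, indexed by a truth value and a time. The mixed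
path follows the second copy at the times in \<open>J\<close> and the first copy elsewhere.\<close>

definition mix :: "int set \<Rightarrow> (bool \<times> int \<Rightarrow> 'e) \<Rightarrow> int \<Rightarrow> 'e" where
  "mix J z = (\<lambda>i. z (i \<in> J, i))"

lemma measurable_mix [measurable]: "mix J \<in> measurable iid iid"
  unfolding mix_def by (rule measurable_reindex)

lemma distr_mix: "distr iid iid (mix J) = iid"
  unfolding mix_def by (rule distr_reindex) (auto simp: inj_on_def)

lemma prob_mix:
  assumes "S \<in> sets iid"
  shows "measure iid {z. mix J z \<in> S} = measure iid S"
proof -
  have "measure iid S = measure (distr iid iid (mix J)) S"
    by (simp only: distr_mix)
  also have "\<dots> = measure iid (mix J -` S \<inter> space iid)"
    using assms by (intro measure_distr) measurable
  finally show ?thesis by (simp add: vimage_def)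
qed

lemma mix_event [measurable]:
  assumes [measurable]: "S \<in> sets iid"
  shows "{z. mix J z \<in> S} \<in> sets iid"
proof -
  have "mix J -` S \<inter> space iid \<in> sets iid" by measurable
  then show ?thesis by (simp add: vimage_def)
qed

lemma mix_differ_event [measurable]:
  assumes [measurable]: "S \<in> sets iid"
  shows "{z. (mix J z \<in> S) \<noteq> (mix K z \<in> S)} \<in> sets iid"
proof -
  have "{z. (mix J z \<in> S) \<noteq> (mix K z \<in> S)} =
      ({z. mix J z \<in> S} - {z. mix K z \<in> S}) \<union> ({z. mix K z \<in> S} - {z. mix J z \<in> S})"
    by auto
  then show ?thesis by simp
qed

text \<open>A measurable set may depend on infinitely many coordinates, so that paths which eventually agree in
every coordinate need not eventually agree about membership. The statement is proved along the
generation of the \<open>\<sigma>\<close>-algebra. For a countable union the finite unions are handled by the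
induction hypothesis, and the remainder is small uniformly in the mixed path, because
every mixed path has the same law.\<close>

lemma mix_differ_tendsto_0:
  fixes J :: "nat \<Rightarrow> int set"
  assumes ev: "\<And>i. \<forall>\<^sub>F k in sequentially. (i \<in> J k \<longleftrightarrow> i \<in> K)"
  assumes S: "S \<in> sets iid"
  shows "(\<lambda>k. measure iid {z. (mix (J k) z \<in> S) \<noteq> (mix K z \<in> S)}) \<longlonglongrightarrow> 0"
proof -
  interpret Q: prob_space "iid :: (bool \<times> int \<Rightarrow> 'e) measure" by (rule prob_space_iid)
  interpret P: prob_space "iid :: (int \<Rightarrow> 'e) measure" by (rule prob_space_iid)
  have sets_eq: "sets (iid :: (int \<Rightarrow> 'e) measure) =
      sigma_sets UNIV {{f. f i \<in> A} | i A. A \<in> sets \<nu>}"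
    by (subst sets_PiM_single) (simp add: space_law)
  have "S \<in> sigma_sets UNIV {{f::int \<Rightarrow> 'e. f i \<in> A} | i A. A \<in> sets \<nu>}"
    using S by (simp add: sets_eq)
  then show ?thesis
  proof induction
    case (Basic a)
    then obtain i A where a: "a = {f. f i \<in> A}" by auto
    have "\<forall>\<^sub>F k in sequentially. measure iid {z. (mix (J k) z \<in> a) \<noteq> (mix K z \<in> a)} = 0"
      using ev[of i]
    proof eventually_elim
      case (elim k)
      then have "{z. (mix (J k) z \<in> a) \<noteq> (mix K z \<in> a)} = {}"
        by (auto simp: a mix_def)
      then show ?case by simp
    qed
    then show ?case by (rule tendsto_eventually)
  next
    case Empty
    then show ?case by simp
  next
    case (Compl a)
    then show ?case by simp
  next
    case (Union a)
    have a_sets [measurable]: "a n \<in> sets iid" for n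
      using Union(1) by (simp add: sets_eq)
    define U where "U n = (\<Union>i<n. a i)" for n
    define W where "W = (\<Union>i. a i)"
    have W_sets [measurable]: "W \<in> sets iid" unfolding W_def by measurable
    have U_sets [measurable]: "U n \<in> sets iid" for n unfolding U_def by measurable
    have "(\<lambda>n. measure iid (U n)) \<longlonglongrightarrow> measure iid (\<Union>n. U n)"
      by (rule P.finite_Lim_measure_incseq) (auto simp: incseq_def U_def, fastforce)
    moreover have "(\<Union>n. U n) = W" by (auto simp: U_def W_def)
    ultimately have lim: "(\<lambda>n. measure iid (U n)) \<longlonglongrightarrow> measure iid W" by simp
    have rest: "measure iid {z. mix L z \<in> W - U n} = measure iid W - measure iid (U n)" for L n
    proof -
      have "measure iid {z. mix L z \<in> W - U n} = measure iid (W - U n)"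
        by (rule prob_mix) measurable
      also have "\<dots> = measure iid W - measure iid (U n)"
        by (rule P.finite_measure_Diff) (auto simp: U_def W_def)
      finally show ?thesis .
    qed
    have bound: "measure iid {z. (mix (J k) z \<in> W) \<noteq> (mix K z \<in> W)} \<le>
        (\<Sum>i<n. measure iid {z. (mix (J k) z \<in> a i) \<noteq> (mix K z \<in> a i)})
        + 2 * (measure iid W - measure iid (U n))" for k n
    proof -
      have "measure iid {z. (mix (J k) z \<in> W) \<noteq> (mix K z \<in> W)} \<le>
          measure iid ((\<Union>i<n. {z. (mix (J k) z \<in> a i) \<noteq> (mix K z \<in> a i)})
            \<union> ({z. mix (J k) z \<in> W - U n} \<union> {z. mix K z \<in> W - U n}))"
      proof (rule Q.finite_measure_mono)
        show "{z. (mix (J k) z \<in> W) \<noteq> (mix K z \<in> W)}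
            \<subseteq> (\<Union>i<n. {z. (mix (J k) z \<in> a i) \<noteq> (mix K z \<in> a i)})
              \<union> ({z. mix (J k) z \<in> W - U n} \<union> {z. mix K z \<in> W - U n})"
          by (auto simp: W_def U_def)
      qed (intro sets.Un sets.finite_UN mix_event mix_differ_event sets.Diff; simp)
      also have "\<dots> \<le> measure iid (\<Union>i<n. {z. (mix (J k) z \<in> a i) \<noteq> (mix K z \<in> a i)})
          + (measure iid {z. mix (J k) z \<in> W - U n} + measure iid {z. mix K z \<in> W - U n})"
        by (intro order_trans[OF measure_Un_le] add_left_mono measure_Un_le
            sets.Un sets.finite_UN mix_event mix_differ_event sets.Diff; simp)
      also have "\<dots> \<le> (\<Sum>i<n. measure iid {z. (mix (J k) z \<in> a i) \<noteq> (mix K z \<in> a i)})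
          + 2 * (measure iid W - measure iid (U n))"
        unfolding rest by (intro add_mono Q.finite_measure_subadditive_finite image_subsetI mix_differ_event) auto
      finally show ?thesis .
    qed
    show ?case unfolding W_def[symmetric]
    proof (rule LIMSEQ_I)
      fix e :: real assume "e > 0"
      then obtain n where n: "\<bar>measure iid (U n) - measure iid W\<bar> < e / 4"
        using LIMSEQ_D[OF lim, of "e/4"] by auto
      have "(\<lambda>k. (\<Sum>i<n. measure iid {z. (mix (J k) z \<in> a i) \<noteq> (mix K z \<in> a i)})) \<longlonglongrightarrow> (\<Sum>i<n. 0)"
        by (intro tendsto_sum Union(2))
      then obtain N where N: "\<And>k. k \<ge> N \<Longrightarrow>
          \<bar>\<Sum>i<n. measure iid {z. (mix (J k) z \<in> a i) \<noteq> (mix K z \<in> a i)}\<bar> < e / 2"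
        using LIMSEQ_D[of _ _ "e/2"] \<open>e > 0\<close> by fastforce
      show "\<exists>N. \<forall>k\<ge>N. norm (measure iid {z. (mix (J k) z \<in> W) \<noteq> (mix K z \<in> W)} - 0) < e"
      proof (intro exI allI impI)
        fix k assume "k \<ge> N"
        then have "\<bar>\<Sum>i<n. measure iid {z. (mix (J k) z \<in> a i) \<noteq> (mix K z \<in> a i)}\<bar> < e / 2"
          by (rule N)
        with n bound[of k n] have "measure iid {z. (mix (J k) z \<in> W) \<noteq> (mix K z \<in> W)} < e"
          unfolding abs_less_iff by argo
        then show "norm (measure iid {z. (mix (J k) z \<in> W) \<noteq> (mix K z \<in> W)} - 0) < e"
          by simp
      qed
    qed
  qed
qed

text \<open>Events determined by the innovations up to time \<open>s\<close>. Describing them by invariance, and not by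
generators, makes it immediate that functions measurable for the history do not see later innovations.\<close>

definition history :: "int \<Rightarrow> (int \<Rightarrow> 'e) measure" where
  "history s = sigma UNIV {S \<in> sets iid. \<forall>x y. (\<forall>i\<le>s. x i = y i) \<longrightarrow> (x \<in> S \<longleftrightarrow> y \<in> S)}"

lemma sets_history:
  "sets (history s) = {S \<in> sets iid. \<forall>x y. (\<forall>i\<le>s. x i = y i) \<longrightarrow> (x \<in> S \<longleftrightarrow> y \<in> S)}"
  (is "_ = ?A")
proof -
  have "sigma_algebra UNIV ?A"
    unfolding sigma_algebra_iff2
  proof (intro conjI ballI allI impI)
    fix s assume "s \<in> ?A"
    then show "UNIV - s \<in> ?A"
      using sets.compl_sets[of s "iid :: (int \<Rightarrow> 'e) measure"] by auto
  next
    fix A :: "nat \<Rightarrow> (int \<Rightarrow> 'e) set" assume "range A \<subseteq> ?A"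
    then have "A n \<in> sets iid" "(\<forall>i\<le>s. x i = y i) \<longrightarrow> (x \<in> A n \<longleftrightarrow> y \<in> A n)" for n x y
      by (blast, blast)
    then show "\<Union> (range A) \<in> ?A" by blast
  qed auto
  then show ?thesis
    unfolding history_def by (rule sigma_algebra.sets_measure_of_eq)
qed

lemma space_history [simp]: "space (history s) = UNIV"
  by (simp add: history_def space_measure_of_conv)

lemma subalgebra_history: "subalgebra iid (history s)"
  by (auto simp: subalgebra_def sets_history)

lemma history_invariant:
  fixes A :: "(int \<Rightarrow> 'e) \<Rightarrow> real"
  assumes "A \<in> borel_measurable (history s)" and "\<And>i. i \<le> s \<Longrightarrow> x i = y i"
  shows "A x = A y"
proof -
  have "A -` {A x} \<inter> space (history s) \<in> sets (history s)"
    using assms(1) by (rule measurable_sets) simp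
  then have "x \<in> A -` {A x} \<longleftrightarrow> y \<in> A -` {A x}"
    using assms(2) by (auto simp: sets_history)
  then show ?thesis by simp
qed

lemma history_measurable_iid:
  assumes "A \<in> borel_measurable (history s)"
  shows "A \<in> borel_measurable iid"
  using measurable_from_subalg[OF subalgebra_history assms] .

lemma history_measurableI:
  fixes A :: "(int \<Rightarrow> 'e) \<Rightarrow> real"
  assumes "A \<in> borel_measurable iid"
    and "\<And>x y. (\<And>i. i \<le> s \<Longrightarrow> x i = y i) \<Longrightarrow> A x = A y"
  shows "A \<in> borel_measurable (history s)"
proof (rule measurableI)
  fix B :: "real set" assume "B \<in> sets borel"
  then have "A -` B \<inter> space iid \<in> sets iid" by (rule measurable_sets[OF assms(1)])
  moreover have "x \<in> A -` B \<longleftrightarrow> y \<in> A -` B" if "\<forall>i\<le>s. x i = y i" for x y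
    using assms(2)[of x y] that by simp
  ultimately show "A -` B \<inter> space (history s) \<in> sets (history s)"
    by (auto simp: sets_history)
qed auto

text \<open>A functional of the history up to \<open>s\<close> reads, on the unmixed path, only the first copy at times up to
\<open>s\<close>. The path mixed at all times up to \<open>s\<close> reads the second copy there and the first copy
afterwards. These coordinate sets are disjoint.\<close>

lemma indep_mix:
  fixes A B :: "(int \<Rightarrow> 'e) \<Rightarrow> real"
  assumes A: "A \<in> borel_measurable (history s)" and B: "B \<in> borel_measurable iid"
    and iA: "integrable iid A" and iB: "integrable iid B"
  shows "(\<integral>z. A (mix {} z) * B (mix {..s} z) \<partial>iid) = (\<integral>x. A x \<partial>iid) * (\<integral>x. B x \<partial>iid)"
    and "integrable iid (\<lambda>z. A (mix {} z) * B (mix {..s} z))"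
proof -
  let ?Q = "iid :: (bool \<times> int \<Rightarrow> 'e) measure"
  interpret Q: prob_space ?Q by (rule prob_space_iid)
  have Am [measurable]: "A \<in> borel_measurable iid" using A by (rule history_measurable_iid)
  note B [measurable]
  \<comment> \<open>\<open>f True\<close> picks the first copy up to \<open>s\<close>, \<open>f False\<close> the second; after \<open>s\<close> the roles are exchanged\<close>
  define f :: "bool \<Rightarrow> int \<Rightarrow> bool \<times> int" where "f b = (\<lambda>i. (b \<noteq> (i \<le> s), i))" for b
  define R where "R b = range (f b)" for b
  have ind: "Q.indep_vars (\<lambda>_. \<nu>) (\<lambda>i z. z i) UNIV"
  proof (subst Q.indep_vars_iff_distr_eq_PiM')
    show "distr ?Q (Pi\<^sub>M UNIV (\<lambda>i. \<nu>)) (\<lambda>x. \<lambda>i\<in>UNIV. x i) = (\<Pi>\<^sub>M i\<in>UNIV. distr ?Q \<nu> (\<lambda>z. z i))"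
    proof -
      have "distr ?Q \<nu> (\<lambda>z. z i) = \<nu>" for i
        using distr_PiM_component[of UNIV "\<lambda>_. \<nu>" i] prob_space_axioms by simp
      then show ?thesis by (simp add: restrict_UNIV distr_id2)
    qed
  qed auto
  have "R True \<inter> R False = {}" by (auto simp: R_def f_def)
  from Q.indep_var_restrict[OF ind this]
  have ind2: "Q.indep_var (Pi\<^sub>M (R True) (\<lambda>_. \<nu>)) (\<lambda>\<omega>. restrict (\<lambda>i. \<omega> i) (R True))
      (Pi\<^sub>M (R False) (\<lambda>_. \<nu>)) (\<lambda>\<omega>. restrict (\<lambda>i. \<omega> i) (R False))" by simp
  have m: "(\<lambda>r i. r (f b i)) \<in> measurable (Pi\<^sub>M (R b) (\<lambda>_. \<nu>)) iid" for b
    by (rule measurable_PiM_single') (auto simp: space_law R_def intro!: measurable_component_singleton)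
  have ind3: "Q.indep_var borel ((\<lambda>r. A (\<lambda>i. r (f True i))) \<circ> (\<lambda>\<omega>. restrict (\<lambda>i. \<omega> i) (R True)))
      borel ((\<lambda>r. B (\<lambda>i. r (f False i))) \<circ> (\<lambda>\<omega>. restrict (\<lambda>i. \<omega> i) (R False)))"
    by (rule Q.indep_var_compose[OF ind2])
      (auto intro!: measurable_compose[OF m Am] measurable_compose[OF m B])
  have eA: "((\<lambda>r. A (\<lambda>i. r (f True i))) \<circ> (\<lambda>\<omega>. restrict (\<lambda>i. \<omega> i) (R True))) = (\<lambda>z. A (mix {} z))"
    by (rule ext, simp, rule history_invariant[OF A]) (simp add: R_def f_def mix_def)
  have eB: "((\<lambda>r. B (\<lambda>i. r (f False i))) \<circ> (\<lambda>\<omega>. restrict (\<lambda>i. \<omega> i) (R False))) = (\<lambda>z. B (mix {..s} z))"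
    by (rule ext, simp add: R_def mix_def) (simp add: f_def)
  have ind4: "Q.indep_var borel (\<lambda>z. A (mix {} z)) borel (\<lambda>z. B (mix {..s} z))"
    using ind3 unfolding eA eB .
  have law: "integrable ?Q (\<lambda>z. g (mix J z))" "(\<integral>z. g (mix J z) \<partial>?Q) = (\<integral>x. g x \<partial>iid)"
    if "integrable iid g" for g :: "(int \<Rightarrow> 'e) \<Rightarrow> real" and J
  proof -
    have "integrable (distr ?Q iid (mix J)) g" using that by (simp add: distr_mix)
    then show "integrable ?Q (\<lambda>z. g (mix J z))"
      using that by (subst (asm) integrable_distr_eq) auto
    have "(\<integral>x. g x \<partial>iid) = (\<integral>x. g x \<partial>(distr ?Q iid (mix J)))" by (simp add: distr_mix)
    also have "\<dots> = (\<integral>z. g (mix J z) \<partial>?Q)"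
      using that by (intro integral_distr) auto
    finally show "(\<integral>z. g (mix J z) \<partial>?Q) = (\<integral>x. g x \<partial>iid)" by simp
  qed
  show "integrable iid (\<lambda>z. A (mix {} z) * B (mix {..s} z))"
    using Q.indep_var_integrable[OF ind4 law(1)[OF iA] law(1)[OF iB]] .
  show "(\<integral>z. A (mix {} z) * B (mix {..s} z) \<partial>iid) = (\<integral>x. A x \<partial>iid) * (\<integral>x. B x \<partial>iid)"
    using Q.indep_var_lebesgue_integral[OF ind4 law(1)[OF iA] law(1)[OF iB]]
    by (simp add: law(2)[OF iA] law(2)[OF iB])
qed

end

text \<open>In \<open>resample_one\<close> the coordinates \<open>Some i\<close> carry the innovations and \<open>None\<close> carries the copy that
replaces the innovation at time 0. So \<open>b k\<close> bounds the probability that an indicator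
changes when the innovation of lag \<open>k\<close> is exchanged.\<close>

locale causal_process = innovation_law \<nu> for \<nu> :: "'e measure" +
  fixes H :: "(nat \<Rightarrow> 'e) \<Rightarrow> real" and b :: "nat \<Rightarrow> real"
  assumes H_measurable [measurable]: "H \<in> borel_measurable iid"
    and b_summable: "summable b"
    and resample_one: "\<And>k v. measure iid {y :: int option \<Rightarrow> 'e.
          (H (\<lambda>i. y (Some (int k - int i))) \<le> v) \<noteq>
          (H (\<lambda>i. y (if int k - int i = 0 then None else Some (int k - int i))) \<le> v)} \<le> b k"
begin

definition V :: "int \<Rightarrow> (int \<Rightarrow> 'e) \<Rightarrow> real" where
  "V t x = H (\<lambda>i. x (t - int i))"

lemma V_history: "t \<le> s \<Longrightarrow> V t \<in> borel_measurable (history s)"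
proof (rule history_measurableI)
  show "V t \<in> borel_measurable iid"
    unfolding V_def by (rule measurable_compose[OF measurable_reindex H_measurable])
qed (simp add: V_def)

lemma V_measurable [measurable]: "V t \<in> borel_measurable iid"
  by (rule history_measurable_iid[OF V_history[OF order_refl]])

lemma V_event: "{x. V t x \<le> v} \<in> sets iid"
proof -
  have "{x \<in> space iid. V t x \<le> v} \<in> sets iid" by measurable
  then show ?thesis by simp
qed

lemma V_differ_event: "{z. (V t (mix J z) \<le> v) \<noteq> (V t (mix K z) \<le> v)} \<in> sets iid"
  using mix_differ_event[OF V_event[of t v], of J K] by simp

lemma b_nonneg: "0 \<le> b k"
  by (rule order_trans[OF measure_nonneg resample_one])

text \<open>Shifting \<open>i0\<close> to time 0 and reading every other coordinate from the copy that the mixed path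
uses turns this into \<open>resample_one\<close>.\<close>

lemma resample_coordinate:
  assumes "i0 \<notin> J" "i0 \<le> t"
  shows "measure iid {z. (V t (mix J z) \<le> v) \<noteq> (V t (mix (insert i0 J) z) \<le> v)} \<le> b (nat (t - i0))"
proof -
  define k where "k = nat (t - i0)"
  have t: "t = i0 + int k" using assms by (simp add: k_def)
  \<comment> \<open>the copy used by the mixed path at each time, shifted so that \<open>i0\<close> becomes time 0\<close>
  define g :: "int option \<Rightarrow> bool \<times> int" where
    "g c = (case c of None \<Rightarrow> (True, i0) | Some i \<Rightarrow> (i + i0 \<in> J, i + i0))" for c
  have "inj g"
    using assms by (auto simp: inj_on_def g_def split: option.splits)
  define D where "D = {y :: int option \<Rightarrow> 'e.
          (H (\<lambda>i. y (Some (int k - int i))) \<le> v) \<noteq>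
          (H (\<lambda>i. y (if int k - int i = 0 then None else Some (int k - int i))) \<le> v)}"
  have m1: "(\<lambda>y. H (\<lambda>i. y (Some (int k - int i)))) \<in> borel_measurable iid"
    and m2: "(\<lambda>y. H (\<lambda>i. y (if int k - int i = 0 then None else Some (int k - int i))))
      \<in> borel_measurable iid"
    by (rule measurable_compose[OF measurable_reindex H_measurable])+
  have "{y \<in> space iid. (H (\<lambda>i. y (Some (int k - int i))) \<le> v) \<noteq>
          (H (\<lambda>i. y (if int k - int i = 0 then None else Some (int k - int i))) \<le> v)} \<in> sets iid"
    using m1 m2 by measurable
  then have D [measurable]: "D \<in> sets iid" by (simp add: D_def)
  have "measure iid D = measure (distr iid iid (\<lambda>z c. z (g c))) D"
    by (simp only: distr_reindex[OF \<open>inj g\<close>])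
  also have "\<dots> = measure iid ((\<lambda>z c. z (g c)) -` D \<inter> space iid)"
    by (rule measure_distr[OF measurable_reindex D])
  also have "(\<lambda>z c. z (g c)) -` D \<inter> space iid =
      {z. (V t (mix J z) \<le> v) \<noteq> (V t (mix (insert i0 J) z) \<le> v)}"
  proof -
    have e1: "V t (mix J z) = H (\<lambda>i. z (g (Some (int k - int i))))" for z
      by (simp add: V_def mix_def g_def t algebra_simps)
    have e2: "V t (mix (insert i0 J) z) =
        H (\<lambda>i. z (g (if int k - int i = 0 then None else Some (int k - int i))))" for z
      unfolding V_def mix_def
      by (rule arg_cong[where f = H], rule ext) (auto simp: g_def t algebra_simps)
    show ?thesis by (simp add: D_def e1 e2 vimage_def)
  qed
  finally have "measure iid {z. (V t (mix J z) \<le> v) \<noteq> (V t (mix (insert i0 J) z) \<le> v)} = measure iid D"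
    by simp
  also have "\<dots> \<le> b k" unfolding D_def by (rule resample_one)
  finally show ?thesis by (simp add: k_def)
qed

text \<open>Resample the coordinates \<open>s, s - 1, s - 2, \<dots>\<close> one after the other. The changes add up to the series,
and resampling the remote rest changes nothing in the limit.\<close>

lemma resample_past:
  assumes "s \<le> t"
  shows "measure iid {z. (V t (mix {} z) \<le> v) \<noteq> (V t (mix {..s} z) \<le> v)}
    \<le> (\<Sum>j. b (j + nat (t - s)))"
proof -
  interpret Q: prob_space "iid :: (bool \<times> int \<Rightarrow> 'e) measure" by (rule prob_space_iid)
  let ?d = "\<lambda>J K. measure iid {z. (V t (mix J z) \<le> v) \<noteq> (V t (mix K z) \<le> v)}"
  define J where "J k = {s - int k<..s}" for k
  define h where "h = nat (t - s)"
  have sum_b: "summable (\<lambda>j. b (j + h))" using b_summable by (rule summable_ignore_initial_segment)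
  have tri: "?d A C \<le> ?d A B + ?d B C" for A B C
  proof -
    have "?d A C \<le> measure iid ({z. (V t (mix A z) \<le> v) \<noteq> (V t (mix B z) \<le> v)} \<union>
        {z. (V t (mix B z) \<le> v) \<noteq> (V t (mix C z) \<le> v)})"
      by (intro Q.finite_measure_mono sets.Un V_differ_event) auto
    also have "\<dots> \<le> ?d A B + ?d B C"
      by (intro measure_Un_le V_differ_event)
    finally show ?thesis .
  qed
  have fin: "?d {} (J k) \<le> (\<Sum>j<k. b (j + h))" for k
  proof (induction k)
    case 0
    then show ?case by (simp add: J_def)
  next
    case (Suc k)
    have ins: "J (Suc k) = insert (s - int k) (J k)" by (auto simp: J_def)
    have "?d (J k) (J (Suc k)) \<le> b (nat (t - (s - int k)))"
      unfolding ins by (rule resample_coordinate) (use assms in \<open>auto simp: J_def\<close>)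
    also have "nat (t - (s - int k)) = k + h" using assms by (simp add: h_def)
    finally show ?case using Suc tri[of "{}" "J (Suc k)" "J k"] by simp
  qed
  have lim: "(\<lambda>k. ?d (J k) {..s}) \<longlonglongrightarrow> 0"
  proof -
    have "\<forall>\<^sub>F k in sequentially. (i \<in> J k \<longleftrightarrow> i \<in> {..s})" for i
      using eventually_ge_at_top[of "nat (s - i + 1)"] by eventually_elim (auto simp: J_def)
    from mix_differ_tendsto_0[OF this V_event[of t v]] show ?thesis by simp
  qed
  have "?d {} {..s} \<le> (\<Sum>j. b (j + h)) + ?d (J k) {..s}" for k
    using tri[of "{}" "{..s}" "J k"] fin[of k] sum_le_suminf[OF sum_b, of "{..<k}"] b_nonneg by fastforce
  then have "?d {} {..s} \<le> (\<Sum>j. b (j + h)) + 0"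
    by (intro LIMSEQ_le_const[OF tendsto_add[OF tendsto_const lim]]) auto
  then show ?thesis by (simp add: h_def)
qed

text \<open>The function \<open>\<Phi>\<close> of the pattern is arbitrary: a finite pattern takes finitely many values.\<close>

lemma finite_pattern_measurable:
  fixes P :: "'i \<Rightarrow> 'w \<Rightarrow> bool" and \<Phi> :: "('i \<Rightarrow> bool) \<Rightarrow> real"
  assumes "finite T" and P: "\<And>t. t \<in> T \<Longrightarrow> Measurable.pred M (P t)"
  shows "(\<lambda>\<omega>. \<Phi> (\<lambda>t. t \<in> T \<and> P t \<omega>)) \<in> borel_measurable M"
  using assms
proof (induction T arbitrary: \<Phi>)
  case (insert a T)
  have [measurable]: "Measurable.pred M (P a)" using insert by auto
  have [measurable]: "(\<lambda>\<omega>. \<Phi> (\<lambda>t. t = a \<or> (t \<in> T \<and> P t \<omega>))) \<in> borel_measurable M"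
    using insert.IH[of "\<lambda>p. \<Phi> (\<lambda>t. t = a \<or> p t)"] insert.prems by auto
  have [measurable]: "(\<lambda>\<omega>. \<Phi> (\<lambda>t. t \<in> T \<and> P t \<omega>)) \<in> borel_measurable M"
    using insert.IH[of \<Phi>] insert.prems by auto
  have "(\<lambda>\<omega>. \<Phi> (\<lambda>t. t \<in> insert a T \<and> P t \<omega>)) =
     (\<lambda>\<omega>. if P a \<omega> then \<Phi> (\<lambda>t. t = a \<or> (t \<in> T \<and> P t \<omega>)) else \<Phi> (\<lambda>t. t \<in> T \<and> P t \<omega>))"
    by (rule ext) (auto intro!: arg_cong[where f = \<Phi>])
  then show ?case by simp
qed simp

text \<open>After the past is resampled the indicators at times in \<open>T\<close> are independent of \<open>A\<close>. So the covariance
is at most \<open>2 a c\<close> times the probability that the resampling changes one of these indicators.\<close>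

lemma decoupling:
  fixes \<Phi> :: "(int \<Rightarrow> bool) \<Rightarrow> real"
  assumes A: "A \<in> borel_measurable (history s)" and A_bound: "\<And>x. \<bar>A x\<bar> \<le> a"
    and T: "finite T" "T \<subseteq> {s<..}" and \<Phi>: "\<And>p. \<bar>\<Phi> p\<bar> \<le> c"
  shows "\<bar>(\<integral>x. A x * \<Phi> (\<lambda>t. t \<in> T \<and> V t x \<le> v) \<partial>iid)
      - (\<integral>x. A x \<partial>iid) * (\<integral>x. \<Phi> (\<lambda>t. t \<in> T \<and> V t x \<le> v) \<partial>iid)\<bar>
    \<le> 2 * a * c * (\<Sum>t\<in>T. \<Sum>j. b (j + nat (t - s)))"
proof -
  interpret Q: prob_space "iid :: (bool \<times> int \<Rightarrow> 'e) measure" by (rule prob_space_iid)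
  interpret P: prob_space "iid :: (int \<Rightarrow> 'e) measure" by (rule prob_space_iid)
  define B where "B x = \<Phi> (\<lambda>t. t \<in> T \<and> V t x \<le> v)" for x
  have B [measurable]: "B \<in> borel_measurable iid"
    unfolding B_def by (rule finite_pattern_measurable[OF T(1)]) measurable
  have Am [measurable]: "A \<in> borel_measurable iid" using A by (rule history_measurable_iid)
  have B_bound: "\<bar>B x\<bar> \<le> c" for x by (simp add: B_def \<Phi>)
  have a0: "0 \<le> a" and c0: "0 \<le> c"
    using A_bound[of undefined] B_bound[of undefined] by linarith+
  have AB_bound: "\<bar>A x * B y\<bar> \<le> a * c" for x y
    unfolding abs_mult by (intro mult_mono A_bound B_bound a0) auto
  have iA: "integrable iid A" and iB: "integrable iid B"
    by (rule P.integrable_const_bound[where B = a] P.integrable_const_bound[where B = c];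
        simp add: A_bound B_bound)+
  have mA: "(\<lambda>z. A (mix J z)) \<in> borel_measurable iid" and mB: "(\<lambda>z. B (mix J z)) \<in> borel_measurable iid" for J
    by measurable
  have law: "(\<integral>x. g x \<partial>iid) = (\<integral>z. g (mix {} z) \<partial>iid)" if "g \<in> borel_measurable iid"
    for g :: "(int \<Rightarrow> 'e) \<Rightarrow> real"
  proof -
    have "(\<integral>x. g x \<partial>iid) = (\<integral>x. g x \<partial>(distr iid iid (mix {})))" by (simp add: distr_mix)
    also have "\<dots> = (\<integral>z. g (mix {} z) \<partial>iid)"
      using that by (intro integral_distr) auto
    finally show ?thesis .
  qed
  let ?E = "\<Union>t\<in>T. {z. (V t (mix {} z) \<le> v) \<noteq> (V t (mix {..s} z) \<le> v)}"
  have E: "?E \<in> sets iid" using T by (intro sets.finite_UN V_differ_event)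
  have i1: "integrable iid (\<lambda>z. A (mix {} z) * B (mix {} z))"
    using mA mB by (intro Q.integrable_const_bound[where B = "a * c"]) (auto simp: AB_bound)
  have i2: "integrable iid (\<lambda>z. A (mix {} z) * B (mix {..s} z))"
    by (rule indep_mix(2)[OF A B iA iB])
  have "(\<integral>x. A x * B x \<partial>iid) - (\<integral>x. A x \<partial>iid) * (\<integral>x. B x \<partial>iid) =
      (\<integral>z. A (mix {} z) * B (mix {} z) - A (mix {} z) * B (mix {..s} z) \<partial>iid)"
    by (simp add: indep_mix(1)[OF A B iA iB, symmetric] law[of "\<lambda>x. A x * B x"] i1 i2)
  also have "\<bar>\<dots>\<bar> \<le> (\<integral>z. 2 * a * c * indicator ?E z \<partial>iid)"
  proof (rule order_trans[OF integral_abs_bound integral_mono])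
    fix z
    show "\<bar>A (mix {} z) * B (mix {} z) - A (mix {} z) * B (mix {..s} z)\<bar> \<le> 2 * a * c * indicator ?E z"
    proof (cases "z \<in> ?E")
      case True
      then show ?thesis
        using AB_bound[of "mix {} z" "mix {} z"] AB_bound[of "mix {} z" "mix {..s} z"] by simp
    next
      case False
      then have "B (mix {} z) = B (mix {..s} z)"
        unfolding B_def by (intro arg_cong[where f = \<Phi>]) auto
      then show ?thesis using False by simp
    qed
  next
    show "integrable iid (\<lambda>z. 2 * a * c * indicator ?E z)"
      using E by (intro integrable_mult_right integrable_real_indicator)
        (simp_all add: Q.emeasure_finite less_top[symmetric])
  qed (use i1 i2 in auto)
  also have "\<dots> = 2 * a * c * measure iid ?E" using E by simp
  also have "\<dots> \<le> 2 * a * c * (\<Sum>t\<in>T. measure iid {z. (V t (mix {} z) \<le> v) \<noteq> (V t (mix {..s} z) \<le> v)})"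
    using T a0 c0
    by (intro mult_left_mono Q.finite_measure_subadditive_finite image_subsetI V_differ_event) auto
  also have "\<dots> \<le> 2 * a * c * (\<Sum>t\<in>T. \<Sum>j. b (j + nat (t - s)))"
    using T a0 c0 by (intro mult_left_mono sum_mono resample_past) auto
  finally show ?thesis unfolding B_def .
qed

lemma shift_invariant:
  assumes g: "g \<in> borel_measurable (Pi\<^sub>M UNIV (\<lambda>_. borel))"
  shows "(\<integral>x. g (\<lambda>t. V (t + s) x) \<partial>iid) = (\<integral>x. (g (\<lambda>t. V t x) :: real) \<partial>iid)"
proof -
  have m: "(\<lambda>x t. V t x) \<in> measurable iid (Pi\<^sub>M UNIV (\<lambda>_. borel))"
    by (rule measurable_PiM_single') auto
  have "(\<integral>x. g (\<lambda>t. V t x) \<partial>iid) = (\<integral>x. g (\<lambda>t. V t x) \<partial>(distr iid iid (\<lambda>x t. x (t + s))))"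
    by (subst distr_reindex) (auto simp: inj_on_def)
  also have "\<dots> = (\<integral>x. g (\<lambda>t. V t (\<lambda>t. x (t + s))) \<partial>iid)"
    by (rule integral_distr[OF measurable_reindex measurable_compose[OF m g]])
  also have "\<dots> = (\<integral>x. g (\<lambda>t. V (t + s) x) \<partial>iid)"
    by (simp add: V_def algebra_simps)
  finally show ?thesis by simp
qed

end

section \<open>Moments of centred indicator sums\<close>

text \<open>The limit theory rests on stationarity and on one decoupling inequality.
The rate \<open>h^-4\<close> is used in two strengths: covariances with bounded functionals decay at this rate,
those with square integrable functionals at its square root \<open>h^-2\<close>, and both are summable.\<close>

locale weakly_dependent = prob_space M for M :: "'a measure" +
  fixes Hist :: "int \<Rightarrow> 'a measure" and V :: "int \<Rightarrow> 'a \<Rightarrow> real" and C :: real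
  assumes C_pos: "0 < C"
    and Hist_sub: "\<And>s. subalgebra M (Hist s)"
    and V_Hist: "\<And>s t. t \<le> s \<Longrightarrow> V t \<in> borel_measurable (Hist s)"
    and shift_invariant: "\<And>g s. g \<in> borel_measurable (Pi\<^sub>M UNIV (\<lambda>_. borel)) \<Longrightarrow>
        (\<integral>x. g (\<lambda>t. V (t + s) x) \<partial>M) = (\<integral>x. (g (\<lambda>t. V t x) :: real) \<partial>M)"
    and decoupling: "\<And>A s a T \<Phi> c v.
        A \<in> borel_measurable (Hist s) \<Longrightarrow> (\<And>x. \<bar>A x\<bar> \<le> a) \<Longrightarrow>
        finite T \<Longrightarrow> T \<subseteq> {s<..} \<Longrightarrow> (\<And>p. \<bar>\<Phi> p\<bar> \<le> c) \<Longrightarrow>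
        \<bar>(\<integral>x. A x * \<Phi> (\<lambda>t. t \<in> T \<and> V t x \<le> v) \<partial>M)
          - (\<integral>x. A x \<partial>M) * (\<integral>x. \<Phi> (\<lambda>t. t \<in> T \<and> V t x \<le> v) \<partial>M)\<bar>
        \<le> 2 * a * c * (\<Sum>t\<in>T. C / (1 + of_int (t - s)) ^ 4)"
begin

definition level :: "real \<Rightarrow> real" where
  "level v = measure M {x \<in> space M. V 0 x \<le> v}"

definition centred_ind :: "real \<Rightarrow> int \<Rightarrow> 'a \<Rightarrow> real" where
  "centred_ind v t x = of_bool (V t x \<le> v) - level v"

definition psum :: "real \<Rightarrow> int \<Rightarrow> nat \<Rightarrow> 'a \<Rightarrow> real" where
  "psum v a n x = (\<Sum>i<n. centred_ind v (a + int i) x)"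

lemma Hist_measurable: "A \<in> borel_measurable (Hist s) \<Longrightarrow> A \<in> borel_measurable M"
  using measurable_from_subalg[OF Hist_sub] .

lemma V_measurable [measurable]: "V t \<in> borel_measurable M"
  by (rule Hist_measurable[OF V_Hist[OF order_refl]])

lemma level_nonneg: "0 \<le> level v" and level_le_1: "level v \<le> 1"
  by (simp_all add: level_def)

lemma centred_ind_Hist: "t \<le> s \<Longrightarrow> centred_ind v t \<in> borel_measurable (Hist s)"
proof -
  assume "t \<le> s"
  then have [measurable]: "V t \<in> borel_measurable (Hist s)" by (rule V_Hist)
  show ?thesis unfolding centred_ind_def by measurable
qed

lemma psum_Hist: "(\<And>i. i < n \<Longrightarrow> a + int i \<le> s) \<Longrightarrow> psum v a n \<in> borel_measurable (Hist s)"
  unfolding psum_def by (intro borel_measurable_sum centred_ind_Hist) auto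

lemma centred_ind_bound: "\<bar>centred_ind v t x\<bar> \<le> 1"
  using level_nonneg[of v] level_le_1[of v] by (auto simp: centred_ind_def)

lemma psum_bound: "\<bar>psum v a n x\<bar> \<le> real n"
proof -
  have "\<bar>psum v a n x\<bar> \<le> (\<Sum>i<n. 1)"
    unfolding psum_def by (rule order_trans[OF sum_abs sum_mono[OF centred_ind_bound]])
  then show ?thesis by simp
qed

lemma bounded_centred_ind: "bounded_rv M (centred_ind v t)"
  by (rule bounded_rvI[OF Hist_measurable[OF centred_ind_Hist[OF order_refl]] centred_ind_bound])

lemma bounded_psum: "bounded_rv M (psum v a n)"
  unfolding psum_def by (intro bounded_rv_intros bounded_centred_ind)

lemma psum_0 [simp]: "psum v a 0 x = 0"
  by (simp add: psum_def)

lemma psum_Suc: "psum v a (Suc n) x = psum v a n x + centred_ind v (a + int n) x"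
  by (simp add: psum_def)

lemma psum_add: "psum v a (m + n) x = psum v a m x + psum v (a + int m) n x"
  by (induction n) (simp_all add: psum_Suc algebra_simps)

lemma expectation_shift:
  assumes "g \<in> borel_measurable (Pi\<^sub>M UNIV (\<lambda>_. borel))"
  shows "expectation (\<lambda>x. g (\<lambda>t. centred_ind v (t + s) x)) = expectation (\<lambda>x. (g (\<lambda>t. centred_ind v t x) :: real))"
proof -
  let ?h = "\<lambda>f t. of_bool (f t \<le> v) - level v"
  have "?h \<in> measurable (Pi\<^sub>M UNIV (\<lambda>_. borel)) (Pi\<^sub>M UNIV (\<lambda>_::int. borel :: real measure))"
    by (rule measurable_PiM_single') auto
  from measurable_compose[OF this assms]
  have "(\<lambda>f. g (?h f)) \<in> borel_measurable (Pi\<^sub>M UNIV (\<lambda>_. borel))" .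
  from shift_invariant[OF this, of s] show ?thesis by (simp add: centred_ind_def)
qed

lemma expectation_psum_shift:
  assumes "h \<in> borel_measurable borel"
  shows "expectation (\<lambda>x. h (psum v a n x)) = expectation (\<lambda>x. (h (psum v 0 n x) :: real))"
  using expectation_shift[of "\<lambda>f. h (\<Sum>i<n. f (int i))" v a] assms
  by (simp add: psum_def add.commute)

lemma expectation_centred_ind_prod_shift:
  "expectation (\<lambda>x. centred_ind v a x * centred_ind v (a + int n) x) = expectation (\<lambda>x. centred_ind v 0 x * centred_ind v (int n) x)"
  using expectation_shift[of "\<lambda>f. f 0 * f (int n)" v a] by (simp add: add.commute)

lemma prob_V_le: "measure M {x \<in> space M. V t x \<le> v} = level v"
proof -
  have m: "(\<lambda>f. of_bool (f 0 \<le> v) :: real) \<in> borel_measurable (Pi\<^sub>M UNIV (\<lambda>_::int. borel :: real measure))"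
    by measurable
  have e: "expectation (\<lambda>x. of_bool (V t x \<le> v) :: real) = measure M {x \<in> space M. V t x \<le> v}" for t
  proof -
    have "expectation (\<lambda>x. of_bool (V t x \<le> v) :: real) =
        expectation (indicator {x \<in> space M. V t x \<le> v})"
      by (rule Bochner_Integration.integral_cong) (auto simp: indicator_def)
    then show ?thesis by simp
  qed
  show ?thesis
    using shift_invariant[OF m, of t] unfolding e level_def by (simp add: e)
qed

lemma expectation_of_bool: "expectation (\<lambda>x. of_bool (V t x \<le> v) :: real) = level v"
proof -
  have "expectation (\<lambda>x. of_bool (V t x \<le> v) :: real) =
      expectation (indicator {x \<in> space M. V t x \<le> v})"
    by (rule Bochner_Integration.integral_cong) (auto simp: indicator_def)
  then show ?thesis by (simp add: prob_V_le)
qed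

lemma expectation_centred_ind [simp]: "expectation (centred_ind v t) = 0"
proof -
  have "bounded_rv M (\<lambda>x. of_bool (V t x \<le> v) :: real)"
    by (rule bounded_rvI[where a = 1]) auto
  then show ?thesis
    unfolding centred_ind_def[abs_def]
    by (subst Bochner_Integration.integral_diff)
      (simp_all add: bounded_rv_integrable expectation_of_bool prob_space)
qed

lemma covariance_bound:
  assumes A: "A \<in> borel_measurable (Hist s)" "\<And>x. \<bar>A x\<bar> \<le> a" and t: "s < t"
  shows "\<bar>expectation (\<lambda>x. A x * centred_ind v t x)\<bar> \<le> 2 * a * (C / (1 + of_int (t - s)) ^ 4)"
proof -
  let ?\<Phi> = "\<lambda>p. of_bool (p t) - level v"
  have b: "\<bar>?\<Phi> p\<bar> \<le> 1" for p using level_nonneg[of v] level_le_1[of v] by auto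
  have e: "?\<Phi> (\<lambda>u. u \<in> {t} \<and> V u x \<le> v) = centred_ind v t x" for x by (simp add: centred_ind_def)
  show ?thesis
    using decoupling[OF A, of "{t}" ?\<Phi> 1 v] b t unfolding e by simp
qed

text \<open>Truncate \<open>A\<close> at height \<open>c\<close>. The bounded part contributes \<open>2 c\<close> times the rate and the rest at most
\<open>\<beta>\<^sup>2 / c\<close>; the choice \<open>c = \<beta> / sqrt rate\<close> balances the two.\<close>

lemma covariance_bound_L2:
  assumes A: "A \<in> borel_measurable (Hist s)" and bdd: "bounded_rv M A"
    and \<beta>: "expectation (\<lambda>x. (A x)\<^sup>2) \<le> \<beta>\<^sup>2" "0 < \<beta>" and t: "s < t"
  shows "\<bar>expectation (\<lambda>x. A x * centred_ind v t x)\<bar> \<le> 3 * \<beta> * sqrt C / (1 + of_int (t - s))\<^sup>2"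
proof -
  define h :: real where "h = 1 + of_int (t - s)"
  have h: "0 < h" using t by (simp add: h_def)
  define r where "r = sqrt C / h\<^sup>2"
  have r: "0 < r" using C_pos h by (simp add: r_def)
  have r2: "C / h ^ 4 = r\<^sup>2"
    using C_pos by (simp add: r_def power_divide flip: power_mult)
  define c where "c = \<beta> / r"
  have c: "0 < c" using \<beta> r by (simp add: c_def)
  note A [measurable]
  define L where "L x = (if \<bar>A x\<bar> \<le> c then A x else 0)" for x
  have L: "L \<in> borel_measurable (Hist s)" unfolding L_def by measurable
  have Lb: "\<bar>L x\<bar> \<le> c" for x using c by (simp add: L_def)
  have bL: "bounded_rv M L" by (rule bounded_rvI[OF Hist_measurable[OF L] Lb])
  have "\<bar>expectation (\<lambda>x. L x * centred_ind v t x)\<bar> \<le> 2 * c * r\<^sup>2"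
    using covariance_bound[OF L Lb t, of v] unfolding h_def[symmetric] r2 .
  also have "2 * c * r\<^sup>2 = 2 * \<beta> * r" using r by (simp add: c_def power2_eq_square)
  finally have 1: "\<bar>expectation (\<lambda>x. L x * centred_ind v t x)\<bar> \<le> 2 * \<beta> * r" .
  have tail: "\<bar>(A x - L x) * centred_ind v t x\<bar> \<le> (A x)\<^sup>2 / c" for x
  proof -
    have "\<bar>(A x - L x) * centred_ind v t x\<bar> \<le> \<bar>A x - L x\<bar> * 1"
      unfolding abs_mult by (intro mult_left_mono centred_ind_bound) auto
    also have "\<dots> \<le> (A x)\<^sup>2 / c"
    proof (cases "\<bar>A x\<bar> \<le> c")
      case False
      then have "\<bar>A x\<bar> * c \<le> \<bar>A x\<bar> * \<bar>A x\<bar>" by (intro mult_left_mono) auto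
      then show ?thesis using False c by (simp add: L_def field_simps power2_eq_square)
    qed (use c in \<open>simp add: L_def\<close>)
    finally show ?thesis .
  qed
  have "\<bar>expectation (\<lambda>x. (A x - L x) * centred_ind v t x)\<bar> \<le> expectation (\<lambda>x. (A x)\<^sup>2 / c)"
    by (intro order_trans[OF integral_abs_bound integral_mono] tail bounded_rv_integrable
        bounded_rv_intros bdd bL bounded_centred_ind)
  also have "\<dots> \<le> \<beta>\<^sup>2 / c" using \<beta> c by (simp add: divide_right_mono)
  also have "\<dots> = \<beta> * r" using \<beta> by (simp add: c_def power2_eq_square)
  finally have 2: "\<bar>expectation (\<lambda>x. (A x - L x) * centred_ind v t x)\<bar> \<le> \<beta> * r" .
  have "expectation (\<lambda>x. A x * centred_ind v t x) =
      expectation (\<lambda>x. L x * centred_ind v t x) + expectation (\<lambda>x. (A x - L x) * centred_ind v t x)"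
    by (subst Bochner_Integration.integral_add[symmetric])
      (auto intro!: bounded_rv_integrable bounded_rv_intros bdd bL bounded_centred_ind simp: algebra_simps)
  then have "\<bar>expectation (\<lambda>x. A x * centred_ind v t x)\<bar> \<le> 3 * \<beta> * r" using 1 2 by linarith
  then show ?thesis by (simp add: r_def h_def)
qed

definition autocov :: "real \<Rightarrow> nat \<Rightarrow> real" where
  "autocov v h = expectation (\<lambda>x. centred_ind v 0 x * centred_ind v (int h) x)"

text \<open>The long-run variance, folded to nonnegative lags by symmetry of the autocovariances.\<close>

definition lrv :: "real \<Rightarrow> real" where
  "lrv v = autocov v 0 + 2 * (\<Sum>h. autocov v (Suc h))"

definition sum_var :: "real \<Rightarrow> nat \<Rightarrow> real" where
  "sum_var v n = expectation (\<lambda>x. (psum v 0 n x)\<^sup>2)"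

lemma rate_le_square: "C / (1 + real h) ^ 4 \<le> C / (1 + real h)\<^sup>2"
proof -
  have "(1 + real h)\<^sup>2 \<le> (1 + real h) ^ 4" by (intro power_increasing) auto
  then show ?thesis using C_pos by (intro divide_left_mono) auto
qed

lemma autocov_bound: "1 \<le> h \<Longrightarrow> \<bar>autocov v h\<bar> \<le> 2 * C / (1 + real h) ^ 4"
  using covariance_bound[of "centred_ind v 0" 0 1 "int h" v] centred_ind_Hist[of 0 0 v] centred_ind_bound[of v 0]
  by (simp add: autocov_def)

lemma autocov_0_le: "autocov v 0 \<le> 1"
proof -
  have "(centred_ind v 0 x)\<^sup>2 \<le> 1" for x using centred_ind_bound[of v 0 x] by (simp add: abs_square_le_1)
  then have "expectation (\<lambda>x. (centred_ind v 0 x)\<^sup>2) \<le> expectation (\<lambda>x. 1)"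
    by (intro integral_mono bounded_rv_integrable bounded_rv_intros bounded_centred_ind)
  then show ?thesis by (simp add: autocov_def power2_eq_square prob_space)
qed

lemma centred_ind_product:
  assumes "i \<le> j"
  shows "expectation (\<lambda>x. centred_ind v (a + int i) x * centred_ind v (a + int j) x) = autocov v (j - i)"
  using expectation_centred_ind_prod_shift[of v "a + int i" "j - i"] assms
  by (simp add: autocov_def of_nat_diff)

lemma psum_second_moment: "expectation (\<lambda>x. (psum v a n x)\<^sup>2) \<le> 4 * (1 + 2 * C) * real n"
proof -
  let ?\<rho> = "\<lambda>h. (1 + 2 * C) * (1 / (1 + real h)\<^sup>2)"
  have "expectation (\<lambda>x. (\<Sum>i<n. centred_ind v (a + int i) x)\<^sup>2) \<le> 2 * real n * (\<Sum>h<n. ?\<rho> h)"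
  proof (rule second_moment_sum)
    fix i j :: nat assume "i \<le> j"
    have "autocov v h \<le> ?\<rho> h" for h
    proof (cases "h = 0")
      case True
      then show ?thesis using autocov_0_le[of v] C_pos by simp
    next
      case False
      then have "autocov v h \<le> 2 * (C / (1 + real h) ^ 4)" using autocov_bound[of h v] by simp
      also have "\<dots> \<le> 2 * (C / (1 + real h)\<^sup>2)" by (intro mult_left_mono rate_le_square) auto
      also have "\<dots> \<le> ?\<rho> h" by (simp add: divide_right_mono)
      finally show ?thesis .
    qed
    then show "expectation (\<lambda>x. centred_ind v (a + int i) x * centred_ind v (a + int j) x) \<le> ?\<rho> (j - i)"
      using centred_ind_product[OF \<open>i \<le> j\<close>] by simp
  qed (use C_pos in \<open>auto intro: bounded_centred_ind\<close>)
  also have "\<dots> \<le> 2 * real n * ((1 + 2 * C) * 2)"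
    unfolding sum_distrib_left[symmetric] using C_pos inverse_square_sum[of n]
    by (intro mult_left_mono) auto
  finally show ?thesis by (simp add: psum_def algebra_simps)
qed

text \<open>Chosen so that \<open>fourth_const\<^sup>2\<close> times 2 dominates the coefficient of \<open>1 + k\<close> in the recursion of
\<open>psum_fourth_moment\<close>.\<close>

definition fourth_const :: real where
  "fourth_const = 108 * sqrt C + 16 * (1 + 2 * C) + 2"

lemma fourth_const_ge_1: "1 \<le> fourth_const"
  using C_pos by (simp add: fourth_const_def)

text \<open>Write the cube as the telescoping sum of the increments \<open>A j = S\<^sub>j\<^sub>+\<^sub>1\<^sup>3 - S\<^sub>j\<^sup>3\<close>. The increment \<open>A j\<close> belongs to
the history at distance \<open>k - j\<close> and its second moment is controlled by the fourth moment
of \<open>S\<^sub>j\<close>. So the covariances are summable over \<open>j\<close>, and the total is linear in \<open>k\<close>.\<close>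

lemma psum_cube_cov:
  assumes IH: "\<And>j. j < k \<Longrightarrow> expectation (\<lambda>x. psum v a j x ^ 4) \<le> (fourth_const * (1 + real k))\<^sup>2"
  shows "\<bar>expectation (\<lambda>x. psum v a k x ^ 3 * centred_ind v (a + int k) x)\<bar> \<le> 54 * fourth_const * (1 + real k) * sqrt C"
proof -
  let ?S = "\<lambda>j x. psum v a j x" and ?y = "centred_ind v (a + int k)"
  define A where "A j x = ?S (Suc j) x ^ 3 - ?S j x ^ 3" for j x
  have bA: "bounded_rv M (A j)" for j
    unfolding A_def by (intro bounded_rv_intros bounded_psum)
  have tel: "?S k x ^ 3 = (\<Sum>j<k. A j x)" for x
    unfolding A_def by (subst sum_lessThan_telescope) simp
  have step: "\<bar>expectation (\<lambda>x. A j x * ?y x)\<bar>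
      \<le> 27 * fourth_const * (1 + real k) * sqrt C * (1 / (1 + real (k - j))\<^sup>2)" if j: "j < k" for j
  proof -
    have mA: "A j \<in> borel_measurable (Hist (a + int j))"
      unfolding A_def by (intro borel_measurable_diff borel_measurable_power psum_Hist) auto
    have "(A j x)\<^sup>2 \<le> 50 * ?S j x ^ 4 + 18" for x
    proof -
      define s y where "s = ?S j x" and "y = centred_ind v (a + int j) x"
      have y: "\<bar>y\<bar> \<le> 1" by (simp add: y_def centred_ind_bound)
      have y3: "\<bar>y ^ 3\<bar> \<le> 1" unfolding power_abs using y by (intro power_le_one) auto
      have "A j x = 3 * s\<^sup>2 * y + 3 * s * y\<^sup>2 + y ^ 3"
        by (simp add: A_def psum_Suc s_def y_def power2_eq_square power3_eq_cube algebra_simps)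
      also have "\<bar>\<dots>\<bar> \<le> \<bar>3 * s\<^sup>2 * y\<bar> + \<bar>3 * s * y\<^sup>2\<bar> + \<bar>y ^ 3\<bar>" by linarith
      also have "\<dots> \<le> 3 * s\<^sup>2 * 1 + 3 * \<bar>s\<bar> * 1 + 1"
        using y y3 by (intro add_mono) (auto simp: abs_mult abs_square_le_1 intro!: mult_left_le)
      also have "\<dots> \<le> 5 * s\<^sup>2 + 3"
      proof -
        have "0 \<le> (\<bar>s\<bar> - 1)\<^sup>2" "0 \<le> s\<^sup>2" by simp_all
        then show ?thesis by (simp add: power2_eq_square algebra_simps)
      qed
      finally have "\<bar>A j x\<bar> \<le> 5 * s\<^sup>2 + 3" .
      then have "(A j x)\<^sup>2 \<le> (5 * s\<^sup>2 + 3)\<^sup>2"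
        by (metis abs_ge_zero power2_abs power_mono)
      also have "\<dots> \<le> 50 * s ^ 4 + 18"
      proof -
        have "0 \<le> (5 * s\<^sup>2 - 3)\<^sup>2" by simp
        moreover have "s ^ 4 = s\<^sup>2 * s\<^sup>2" by (simp flip: power_add)
        ultimately show ?thesis by (simp add: power2_eq_square algebra_simps)
      qed
      finally show ?thesis by (simp add: s_def)
    qed
    then have "expectation (\<lambda>x. (A j x)\<^sup>2) \<le> expectation (\<lambda>x. 50 * ?S j x ^ 4 + 18)"
      by (intro integral_mono bounded_rv_integrable bounded_rv_intros bA bounded_psum)
    also have "\<dots> = 50 * expectation (\<lambda>x. ?S j x ^ 4) + 18"
      by (subst Bochner_Integration.integral_add)
        (auto intro!: bounded_rv_integrable bounded_rv_intros bounded_psum simp: prob_space)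
    also have "\<dots> \<le> 50 * (fourth_const * (1 + real k))\<^sup>2 + 18 * (fourth_const * (1 + real k))\<^sup>2"
    proof -
      have "1 * 1 \<le> fourth_const * (1 + real k)" using fourth_const_ge_1 by (intro mult_mono) auto
      then have "1 \<le> (fourth_const * (1 + real k))\<^sup>2" by simp
      then show ?thesis using IH[OF j] by linarith
    qed
    \<comment> \<open>\<open>50 + 18 \<le> 9\<^sup>2\<close>\<close>
    also have "\<dots> \<le> (9 * (fourth_const * (1 + real k)))\<^sup>2"
      by (simp add: power_mult_distrib)
    finally have "expectation (\<lambda>x. (A j x)\<^sup>2) \<le> (9 * (fourth_const * (1 + real k)))\<^sup>2" .
    then show ?thesis
      using covariance_bound_L2[OF mA bA, of "9 * (fourth_const * (1 + real k))" "a + int k" v]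
        fourth_const_ge_1 j by (simp add: of_nat_diff mult.assoc)
  qed
  have "expectation (\<lambda>x. ?S k x ^ 3 * ?y x) = expectation (\<lambda>x. \<Sum>j<k. A j x * ?y x)"
    by (simp add: tel sum_distrib_right)
  also have "\<dots> = (\<Sum>j<k. expectation (\<lambda>x. A j x * ?y x))"
    by (rule Bochner_Integration.integral_sum)
      (intro bounded_rv_integrable bounded_rv_intros bA bounded_centred_ind)
  also have "\<bar>\<dots>\<bar> \<le> (\<Sum>j<k. 27 * fourth_const * (1 + real k) * sqrt C * (1 / (1 + real (k - j))\<^sup>2))"
    by (rule order_trans[OF sum_abs]) (intro sum_mono step, simp)
  also have "\<dots> = 27 * fourth_const * (1 + real k) * sqrt C * (\<Sum>j<k. 1 / (1 + real (k - j))\<^sup>2)"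
    by (simp add: sum_distrib_left)
  also have "\<dots> \<le> 27 * fourth_const * (1 + real k) * sqrt C * 2"
  proof (rule mult_left_mono)
    have "(\<Sum>j<k. 1 / (1 + real (k - j))\<^sup>2) = (\<Sum>h\<in>(\<lambda>j. k - j) ` {..<k}. 1 / (1 + real h)\<^sup>2)"
      by (subst sum.reindex) (auto simp: inj_on_def)
    also have "\<dots> \<le> (\<Sum>h<Suc k. 1 / (1 + real h)\<^sup>2)" by (intro sum_mono2) auto
    finally show "(\<Sum>j<k. 1 / (1 + real (k - j))\<^sup>2) \<le> 2"
      using inverse_square_sum[of "Suc k"] by linarith
  qed (use fourth_const_ge_1 C_pos in auto)
  finally show ?thesis by simp
qed

text \<open>Expand \<open>(S + y)^4\<close>. The term \<open>4 S\<^sup>3 y\<close> is the only one that is not obviously of order \<open>k\<close>, and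
\<open>psum_cube_cov\<close> shows that it is. Adding increments of order \<open>k\<close> gives quadratic growth.\<close>

lemma psum_fourth_moment: "expectation (\<lambda>x. psum v a n x ^ 4) \<le> (fourth_const * (1 + real n))\<^sup>2"
proof (induction n rule: less_induct)
  case (less n)
  show ?case
  proof (cases n)
    case (Suc k)
    let ?S = "\<lambda>x. psum v a k x" and ?y = "centred_ind v (a + int k)"
    have up: "expectation (\<lambda>x. psum v a j x ^ 4) \<le> (fourth_const * (1 + real k))\<^sup>2" if "j \<le> k" for j
    proof -
      have "expectation (\<lambda>x. psum v a j x ^ 4) \<le> (fourth_const * (1 + real j))\<^sup>2"
        using that Suc by (intro less.IH) auto
      also have "\<dots> \<le> (fourth_const * (1 + real k))\<^sup>2"
        using that fourth_const_ge_1 by (intro power_mono mult_left_mono) auto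
      finally show ?thesis .
    qed
    have "psum v a n x ^ 4 \<le> ?S x ^ 4 + 4 * (?S x ^ 3 * ?y x) + 8 * (?S x)\<^sup>2 + 3" for x
    proof -
      define s y where "s = ?S x" and "y = ?y x"
      have y: "\<bar>y\<bar> \<le> 1" by (simp add: y_def centred_ind_bound)
      have y2: "y\<^sup>2 \<le> 1" using y by (simp add: abs_square_le_1)
      have y4: "y ^ 4 \<le> 1" using power_mono[OF y2, of 2] by simp
      have "psum v a n x ^ 4 = (s + y) ^ 4" by (simp add: Suc psum_Suc s_def y_def)
      also have "\<dots> = s ^ 4 + 4 * (s ^ 3 * y) + 6 * (s\<^sup>2 * y\<^sup>2) + 4 * (s * y ^ 3) + y ^ 4"
        by (simp add: numeral_eq_Suc algebra_simps)
      also have "6 * (s\<^sup>2 * y\<^sup>2) \<le> 6 * s\<^sup>2"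
        using mult_left_mono[OF y2, of "s\<^sup>2"] by simp
      also have "4 * (s * y ^ 3) \<le> 4 * \<bar>s\<bar>"
      proof -
        have "s * y ^ 3 \<le> \<bar>s\<bar> * \<bar>y ^ 3\<bar>" by (metis abs_ge_self abs_mult)
        also have "\<dots> \<le> \<bar>s\<bar> * 1" using y by (intro mult_left_mono) (auto simp: power_abs intro: power_le_one)
        finally show ?thesis by simp
      qed
      also have "4 * \<bar>s\<bar> \<le> 2 * s\<^sup>2 + 2"
      proof -
        have "0 \<le> (\<bar>s\<bar> - 1)\<^sup>2" by simp
        then show ?thesis by (simp add: power2_eq_square algebra_simps)
      qed
      finally show ?thesis using y4 by (simp add: s_def y_def)
    qed
    then have "expectation (\<lambda>x. psum v a n x ^ 4) \<le>
        expectation (\<lambda>x. ?S x ^ 4 + 4 * (?S x ^ 3 * ?y x) + 8 * (?S x)\<^sup>2 + 3)"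
      by (intro integral_mono bounded_rv_integrable bounded_rv_intros bounded_psum bounded_centred_ind)
    also have "\<dots> = expectation (\<lambda>x. ?S x ^ 4) + 4 * expectation (\<lambda>x. ?S x ^ 3 * ?y x)
        + 8 * expectation (\<lambda>x. (?S x)\<^sup>2) + 3"
      using bounded_psum[of v a k] bounded_centred_ind[of v "a + int k"]
      by (simp add: bounded_rv_integrable bounded_rv_add bounded_rv_mult bounded_rv_power
          bounded_rv_const prob_space)
    also have "\<dots> \<le> (fourth_const * (1 + real k))\<^sup>2 + 4 * (54 * fourth_const * (1 + real k) * sqrt C)
        + 8 * (4 * (1 + 2 * C) * real k) + 3"
    proof (intro add_mono mult_left_mono)
      show "expectation (\<lambda>x. ?S x ^ 3 * ?y x) \<le> 54 * fourth_const * (1 + real k) * sqrt C"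
        using psum_cube_cov[of k v a] up by simp
    qed (use up[of k] psum_second_moment[of v a k] in auto)
    also have "\<dots> \<le> (fourth_const * (1 + real k))\<^sup>2 + 2 * fourth_const\<^sup>2 * (1 + real k)"
    proof -
      have "32 * (1 + 2 * C) * real k + 3 \<le> (32 * (1 + 2 * C) + 4) * (1 + real k)"
        using C_pos by (simp add: algebra_simps)
      also have "\<dots> \<le> (32 * (1 + 2 * C) + 4) * (1 + real k) * fourth_const"
        using mult_left_mono[OF fourth_const_ge_1, of "(32 * (1 + 2 * C) + 4) * (1 + real k)"] C_pos by simp
      finally have "32 * (1 + 2 * C) * real k + 3 \<le> (32 * (1 + 2 * C) + 4) * (1 + real k) * fourth_const" .
      moreover have "2 * fourth_const\<^sup>2 * (1 + real k) =
          (216 * sqrt C + 32 * (1 + 2 * C) + 4) * (1 + real k) * fourth_const"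
        by (simp add: fourth_const_def power2_eq_square algebra_simps)
      ultimately show ?thesis by (simp add: algebra_simps)
    qed
    also have "\<dots> \<le> (fourth_const * (1 + real n))\<^sup>2"
      by (simp add: Suc power2_eq_square algebra_simps)
    finally show ?thesis .
  qed simp
qed

lemma autocov_tail:
  "summable (\<lambda>h. autocov v (Suc h))"
  "\<bar>\<Sum>h. autocov v (Suc (h + n))\<bar> \<le> 4 * C / (1 + real n)\<^sup>2"
  "summable (\<lambda>h. \<bar>autocov v (Suc h)\<bar>)"
proof -
  have b: "\<bar>autocov v (Suc (h + n))\<bar> \<le> 2 * C / (1 + real n)\<^sup>2 * (1 / (1 + real h)\<^sup>2)" for h n
  proof -
    have "\<bar>autocov v (Suc (h + n))\<bar> \<le> 2 * C / (1 + real (Suc (h + n))) ^ 4"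
      by (rule autocov_bound) simp
    also have "\<dots> \<le> 2 * C / ((1 + real n)\<^sup>2 * (1 + real h)\<^sup>2)"
    proof (rule divide_left_mono)
      have "(1 + real n)\<^sup>2 * (1 + real h)\<^sup>2 \<le> (1 + real (Suc (h + n)))\<^sup>2 * (1 + real (Suc (h + n)))\<^sup>2"
        by (intro mult_mono power_mono) auto
      then show "(1 + real n)\<^sup>2 * (1 + real h)\<^sup>2 \<le> (1 + real (Suc (h + n))) ^ 4"
        by (simp flip: power_add)
    qed (use C_pos in auto)
    finally show ?thesis by simp
  qed
  have s: "summable (\<lambda>h. 2 * C / (1 + real n)\<^sup>2 * (1 / (1 + real h)\<^sup>2))" for n
    by (intro summable_mult inverse_square_summable)
  have abs: "summable (\<lambda>h. \<bar>autocov v (Suc (h + n))\<bar>)" for n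
    by (rule summable_comparison_test'[OF s[of n], of 0]) (use b in auto)
  show "summable (\<lambda>h. \<bar>autocov v (Suc h)\<bar>)" using abs[of 0] by simp
  show "summable (\<lambda>h. autocov v (Suc h))"
    using summable_rabs_cancel[OF abs[of 0]] by simp
  have "\<bar>\<Sum>h. autocov v (Suc (h + n))\<bar> \<le> (\<Sum>h. \<bar>autocov v (Suc (h + n))\<bar>)"
    by (rule summable_rabs[OF abs])
  also have "\<dots> \<le> (\<Sum>h. 2 * C / (1 + real n)\<^sup>2 * (1 / (1 + real h)\<^sup>2))"
    by (rule suminf_le[OF b abs s])
  also have "\<dots> = 2 * C / (1 + real n)\<^sup>2 * (\<Sum>h. 1 / (1 + real h)\<^sup>2)"
    by (rule suminf_mult[OF inverse_square_summable])
  also have "\<dots> \<le> 2 * C / (1 + real n)\<^sup>2 * 2"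
    using C_pos by (intro mult_left_mono inverse_square_suminf) auto
  finally show "\<bar>\<Sum>h. autocov v (Suc (h + n))\<bar> \<le> 4 * C / (1 + real n)\<^sup>2" by simp
qed

lemma sum_var_Suc: "sum_var v (Suc n) - sum_var v n = autocov v 0 + 2 * (\<Sum>h<n. autocov v (Suc h))"
proof -
  let ?S = "psum v 0 n" and ?y = "centred_ind v (int n)"
  have "expectation (\<lambda>x. ?S x * ?y x) = expectation (\<lambda>x. \<Sum>i<n. centred_ind v (int i) x * ?y x)"
    by (simp add: psum_def sum_distrib_right)
  also have "\<dots> = (\<Sum>i<n. expectation (\<lambda>x. centred_ind v (int i) x * ?y x))"
    by (rule Bochner_Integration.integral_sum)
      (intro bounded_rv_integrable bounded_rv_intros bounded_centred_ind)
  also have "\<dots> = (\<Sum>i<n. autocov v (n - i))"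
    using centred_ind_product[of _ n v 0] by (intro sum.cong) auto
  also have "\<dots> = (\<Sum>h<n. autocov v (Suc h))"
    by (rule sum.reindex_bij_witness[of _ "\<lambda>h. n - Suc h" "\<lambda>i. n - Suc i"])
      (auto simp: Suc_diff_Suc)
  finally have cross: "expectation (\<lambda>x. ?S x * ?y x) = (\<Sum>h<n. autocov v (Suc h))" .
  have sq: "expectation (\<lambda>x. (?y x)\<^sup>2) = autocov v 0"
    using centred_ind_product[of n n v 0] by (simp add: power2_eq_square)
  have "sum_var v (Suc n) = expectation (\<lambda>x. (?S x)\<^sup>2 + 2 * (?S x * ?y x) + (?y x)\<^sup>2)"
    unfolding sum_var_def by (rule Bochner_Integration.integral_cong)
      (auto simp: psum_Suc power2_eq_square algebra_simps)
  also have "\<dots> = sum_var v n + 2 * expectation (\<lambda>x. ?S x * ?y x) + expectation (\<lambda>x. (?y x)\<^sup>2)"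
    using bounded_psum[of v 0 n] bounded_centred_ind[of v "int n"]
    by (simp add: bounded_rv_integrable bounded_rv_add bounded_rv_mult bounded_rv_power
          bounded_rv_const sum_var_def)
  finally show ?thesis by (simp add: cross sq)
qed

lemma sum_var_Suc_lrv: "\<bar>sum_var v (Suc n) - sum_var v n - lrv v\<bar> \<le> 8 * C * (1 / (1 + real n)\<^sup>2)"
proof -
  have "lrv v = autocov v 0 + 2 * ((\<Sum>h. autocov v (Suc (h + n))) + (\<Sum>h<n. autocov v (Suc h)))"
    unfolding lrv_def using suminf_split_initial_segment[OF autocov_tail(1), of v n] by simp
  then show ?thesis
    unfolding sum_var_Suc using autocov_tail(2)[of v n] by simp
qed

text \<open>The increments of the variance are partial sums of the series of autocovariances, and their distance
from its limit is summable. So the variance of a sum of \<open>n\<close> terms differs from \<open>n\<close> times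
the long-run variance by a bounded amount.\<close>

lemma sum_var_increment:
  assumes "a \<le> b"
  shows "\<bar>sum_var v b - sum_var v a - real (b - a) * lrv v\<bar> \<le> 16 * C / (1 + real a)"
proof -
  have "sum_var v b - sum_var v a - real (b - a) * lrv v
      = (\<Sum>n=a..<b. sum_var v (Suc n) - sum_var v n - lrv v)"
    using assms sum_Suc_diff'[OF assms, of "sum_var v"] by (simp add: sum_subtractf)
  also have "\<bar>\<dots>\<bar> \<le> (\<Sum>n=a..<b. 8 * C * (1 / (1 + real n)\<^sup>2))"
    by (rule order_trans[OF sum_abs]) (intro sum_mono sum_var_Suc_lrv)
  also have "\<dots> = 8 * C * (\<Sum>n=a..<b. 1 / (1 + real n)\<^sup>2)" by (simp add: sum_distrib_left)
  also have "\<dots> \<le> 8 * C * (2 / (1 + real a))"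
    using C_pos by (intro mult_left_mono inverse_square_tail_le) auto
  finally show ?thesis by simp
qed

lemma sum_var_lrv: "\<bar>sum_var v n - real n * lrv v\<bar> \<le> 16 * C"
  using sum_var_increment[of 0 n v] by (simp add: sum_var_def)

lemma sum_var_nonneg: "0 \<le> sum_var v n"
  by (simp add: sum_var_def)

lemma psum_var: "expectation (\<lambda>x. (psum v a n x)\<^sup>2) = sum_var v n"
  using expectation_psum_shift[of "\<lambda>y. y\<^sup>2" v a n] by (simp add: sum_var_def)

lemma lrv_nonneg: "0 \<le> lrv v"
proof (rule ccontr)
  assume "\<not> 0 \<le> lrv v"
  then have neg: "lrv v < 0" by simp
  obtain n where "16 * C / (- lrv v) < real n" using reals_Archimedean2 by blast
  then have "16 * C < - (real n * lrv v)" using neg by (subst (asm) pos_divide_less_eq) auto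
  then show False using sum_var_lrv[of v n] sum_var_nonneg[of v n] by linarith
qed

lemma lrv_limit: "filterlim l at_top sequentially \<Longrightarrow> (\<lambda>n. sum_var v (l n) / real (l n)) \<longlonglongrightarrow> lrv v"
proof -
  assume l: "filterlim l at_top sequentially"
  then have lr: "filterlim (\<lambda>n. real (l n)) at_top sequentially"
    by (rule filterlim_compose[OF filterlim_real_sequentially])
  have "(\<lambda>n. sum_var v (l n) / real (l n) - lrv v) \<longlonglongrightarrow> 0"
  proof (rule tendsto_rabs_zero_cancel, rule tendsto_sandwich[where f = "\<lambda>_. 0"])
    show "(\<lambda>n. 16 * C / real (l n)) \<longlonglongrightarrow> 0"
      by (rule tendsto_divide_0[OF tendsto_const filterlim_at_top_imp_at_infinity[OF lr]])
    show "\<forall>\<^sub>F n in sequentially. \<bar>sum_var v (l n) / real (l n) - lrv v\<bar> \<le> 16 * C / real (l n)"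
      using filterlim_at_top_dense[THEN iffD1, OF lr, rule_format, of 0]
    proof eventually_elim
      case (elim n)
      then have "sum_var v (l n) / real (l n) - lrv v = (sum_var v (l n) - real (l n) * lrv v) / real (l n)"
        by (simp add: field_simps)
      then show ?case using sum_var_lrv[of v "l n"] by (simp add: divide_right_mono)
    qed
  qed (auto intro: always_eventually)
  then show ?thesis by (rule LIM_zero_cancel)
qed

end

section \<open>Positivity of the long-run variance\<close>

lemma abs_cos_diff_le: "\<bar>cos x - cos y\<bar> \<le> \<bar>x - y\<bar>" for x y :: real
proof -
  have "\<bar>cos x - cos y\<bar> = 2 * (\<bar>sin ((x + y) / 2)\<bar> * \<bar>sin ((y - x) / 2)\<bar>)"
    by (simp add: cos_diff_cos abs_mult)
  also have "\<dots> \<le> 2 * (1 * \<bar>(y - x) / 2\<bar>)"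
    by (intro mult_left_mono mult_mono abs_sin_le_one abs_sin_x_le_abs_x) auto
  finally show ?thesis by simp
qed

lemma cos_add_2pi_int: "cos (x + 2 * pi * of_int k) = cos x"
  by (simp add: cos_add)

context weakly_dependent
begin

text \<open>Polarisation expresses the covariance by variances of sums over intervals. If the long-run variance
is 0, the variance of a sum converges as its length grows, so the difference of two such variances is
small as soon as both lengths are large.\<close>

lemma overlap_cov:
  assumes r: "2 * r \<le> N" and lrv0: "lrv v = 0"
  shows "expectation (\<lambda>x. psum v a N x * psum v (a + int r) N x) \<le> 16 * C / (1 + real r)"
proof -
  define X Y Z where "X = psum v a r" and "Y = psum v (a + int r) (N - r)" and "Z = psum v (a + int N) r"
  have rN: "r \<le> N" using r by simp
  have 1: "psum v a N x = X x + Y x" for x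
    using psum_add[of v a r "N - r" x] rN by (simp add: X_def Y_def)
  have 2: "psum v (a + int r) N x = Y x + Z x" for x
    using psum_add[of v "a + int r" "N - r" r x] rN by (simp add: Y_def Z_def of_nat_diff)
  have 3: "psum v a (N + r) x = X x + Y x + Z x" for x
    using psum_add[of v a N r x] by (simp add: 1 Z_def)
  have b: "bounded_rv M X" "bounded_rv M Y" "bounded_rv M Z"
    by (simp_all add: X_def Y_def Z_def bounded_psum)
  have "expectation (\<lambda>x. psum v a N x * psum v (a + int r) N x) =
      expectation (\<lambda>x. ((psum v a (N + r) x)\<^sup>2 + (Y x)\<^sup>2 - (X x)\<^sup>2 - (Z x)\<^sup>2) / 2)"
    by (rule Bochner_Integration.integral_cong)
      (auto simp: 1 2 3 power2_eq_square algebra_simps)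
  also have "\<dots> = (expectation (\<lambda>x. (psum v a (N + r) x)\<^sup>2) + expectation (\<lambda>x. (Y x)\<^sup>2)
      - expectation (\<lambda>x. (X x)\<^sup>2) - expectation (\<lambda>x. (Z x)\<^sup>2)) / 2"
    using b bounded_psum[of v a "N + r"]
    by (simp add: bounded_rv_integrable bounded_rv_add bounded_rv_diff bounded_rv_power)
  also have "\<dots> = (sum_var v (N + r) + sum_var v (N - r) - sum_var v r - sum_var v r) / 2"
    by (simp add: X_def Y_def Z_def psum_var)
  also have "\<dots> \<le> (2 * (16 * C / (1 + real r))) / 2"
  proof (rule divide_right_mono)
    have "\<bar>sum_var v (N + r) - sum_var v r\<bar> \<le> 16 * C / (1 + real r)"
      using sum_var_increment[of r "N + r" v] lrv0 by simp
    moreover have "\<bar>sum_var v (N - r) - sum_var v r\<bar> \<le> 16 * C / (1 + real r)"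
      using sum_var_increment[of r "N - r" v] r lrv0 by simp
    ultimately show "sum_var v (N + r) + sum_var v (N - r) - sum_var v r - sum_var v r \<le> 2 * (16 * C / (1 + real r))"
      unfolding abs_le_iff by argo
  qed simp
  finally show ?thesis
    unfolding nonzero_mult_div_cancel_left[OF zero_neq_numeral[symmetric]] .
qed

text \<open>The shifted sums have bounded variances, and the covariance of two of them tends to 0 as the shift
grows. So their average over \<open>m\<close> shifts is small. The parameter \<open>\<eta>\<close> passes from the second to the
first moment by \<open>z \<le> \<eta> + z\<^sup>2 / \<eta>\<close>.\<close>

lemma smoothed_middle_small:
  assumes N: "2 * m \<le> N" and m: "0 < m" and lrv0: "lrv v = 0" and \<eta>: "0 < \<eta>"
  shows "expectation (\<lambda>x. \<bar>(\<Sum>k<m. psum v (int k) N x) / real m\<bar>) \<le> \<eta> + 64 * C / (\<eta> * sqrt (real m))"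
proof -
  define Z where "Z x = (\<Sum>k<m. psum v (int k) N x) / real m" for x
  have bZ: "bounded_rv M Z" unfolding Z_def by (intro bounded_rv_intros bounded_psum)
  have "expectation (\<lambda>x. (\<Sum>k<m. psum v (int k) N x)\<^sup>2) \<le> 2 * real m * (\<Sum>h<m. 16 * C / (1 + real h))"
  proof (rule second_moment_sum)
    fix i j assume "i \<le> j" "j < m"
    then show "expectation (\<lambda>x. psum v (int i) N x * psum v (int j) N x) \<le> 16 * C / (1 + real (j - i))"
      using overlap_cov[of "j - i" N v "int i"] N lrv0 by (simp add: of_nat_diff)
  qed (use C_pos in \<open>auto intro: bounded_psum\<close>)
  also have "\<dots> \<le> 2 * real m * (16 * C * (2 * sqrt (real m)))"
  proof (rule mult_left_mono)
    have "(\<Sum>h<m. 16 * C / (1 + real h)) = 16 * C * (\<Sum>h<m. 1 / (1 + real h))"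
      by (simp add: sum_distrib_left)
    also have "\<dots> \<le> 16 * C * (2 * sqrt (real m))"
      using C_pos by (intro mult_left_mono inverse_sum_sqrt) auto
    finally show "(\<Sum>h<m. 16 * C / (1 + real h)) \<le> 16 * C * (2 * sqrt (real m))" .
  qed simp
  finally have "expectation (\<lambda>x. (\<Sum>k<m. psum v (int k) N x)\<^sup>2) \<le> 64 * C * real m * sqrt (real m)"
    by (simp add: algebra_simps)
  then have "expectation (\<lambda>x. (Z x)\<^sup>2) \<le> 64 * C * real m * sqrt (real m) / (real m)\<^sup>2"
    by (simp add: Z_def power_divide divide_right_mono)
  also have "\<dots> = 64 * C / sqrt (real m)"
    using m real_sqrt_mult_self[of "real m"] by (simp add: power2_eq_square field_simps)
  finally have 2: "expectation (\<lambda>x. (Z x)\<^sup>2) \<le> 64 * C / sqrt (real m)" .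
  have "\<bar>Z x\<bar> \<le> \<eta> + (Z x)\<^sup>2 / \<eta>" for x
  proof -
    have "0 \<le> (\<bar>Z x\<bar> - \<eta>)\<^sup>2" "0 \<le> \<bar>Z x\<bar> * \<eta>" using \<eta> by simp_all
    then have "\<bar>Z x\<bar> * \<eta> \<le> \<eta> * \<eta> + (Z x)\<^sup>2" by (simp add: power2_eq_square algebra_simps)
    then show ?thesis using \<eta> by (simp add: field_simps)
  qed
  then have "expectation (\<lambda>x. \<bar>Z x\<bar>) \<le> expectation (\<lambda>x. \<eta> + (Z x)\<^sup>2 / \<eta>)"
    by (intro integral_mono bounded_rv_integrable bounded_rv_intros bZ)
  also have "\<dots> = \<eta> + expectation (\<lambda>x. (Z x)\<^sup>2) / \<eta>"
    using bZ by (simp add: bounded_rv_integrable bounded_rv_power bounded_rv_const prob_space)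
  also have "\<dots> \<le> \<eta> + 64 * C / sqrt (real m) / \<eta>"
    using 2 \<eta> by (intro add_left_mono divide_right_mono) auto
  finally show ?thesis by (simp add: Z_def mult.commute)
qed

text \<open>For each \<open>k < m\<close> the sum over \<open>N + m\<close> times splits into the first \<open>k\<close>, the middle \<open>N\<close>, and the
last \<open>m - k\<close> terms. Averaging over \<open>k\<close> leaves the negligible middle part and two parts that are
decoupled for large \<open>N\<close>. The bracket does not involve \<open>N\<close>, and the bound does not involve \<open>\<phi>\<close>.\<close>

lemma phase_asymptotically_constant:
  assumes N: "2 * m \<le> N" and m: "0 < m" and lrv0: "lrv v = 0" and \<eta>: "0 < \<eta>"
  defines "L \<equiv> \<lambda>x. (\<Sum>k<m. psum v 0 k x) / real m"
    and "R \<equiv> \<lambda>x. (\<Sum>k<m. psum v (int k) (m - k) x) / real m"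
  shows "\<bar>cos (\<phi> - 2 * pi * real (N + m) * level v)
      - (expectation (\<lambda>x. cos (\<phi> + 2 * pi * L x)) * expectation (\<lambda>x. cos (2 * pi * R x))
         - expectation (\<lambda>x. sin (\<phi> + 2 * pi * L x)) * expectation (\<lambda>x. sin (2 * pi * R x)))\<bar>
    \<le> 2 * pi * (\<eta> + 64 * C / (\<eta> * sqrt (real m))) + 4 * C * real m / (1 + real (N - m))"
proof -
  define R' where "R' x = (\<Sum>k<m. psum v (int k + int N) (m - k) x) / real m" for x
  define Z where "Z x = (\<Sum>k<m. psum v (int k) N x) / real m" for x
  have Lm: "L \<in> borel_measurable (Hist (int m))"
    unfolding L_def by (intro borel_measurable_divide borel_measurable_sum psum_Hist) auto
  have [measurable]: "L \<in> borel_measurable M" using Lm by (rule Hist_measurable)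
  have [measurable]: "psum v a n \<in> borel_measurable M" for a n
    using bounded_psum by (rule bounded_rv_measurable)
  have [measurable]: "R' \<in> borel_measurable M" "R \<in> borel_measurable M"
    unfolding R'_def R_def by measurable
  have trig: "bounded_rv M (\<lambda>x. cos (f x))" "bounded_rv M (\<lambda>x. sin (f x))" if "f \<in> borel_measurable M" for f
    using that by (auto intro!: bounded_rvI[where a = 1])
  have split: "psum v 0 (N + m) x = L x + Z x + R' x" for x
  proof -
    have "psum v 0 (N + m) x = psum v 0 k x + psum v (int k) N x + psum v (int k + int N) (m - k) x"
      if "k < m" for k
      using psum_add[of v 0 k "N + (m - k)" x] psum_add[of v "int k" N "m - k" x] that
      by (simp add: add.commute add.left_commute)
    then have "(\<Sum>k<m. psum v 0 (N + m) x) =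
        (\<Sum>k<m. psum v 0 k x + psum v (int k) N x + psum v (int k + int N) (m - k) x)"
      by (intro sum.cong) auto
    then show ?thesis using m by (simp add: L_def Z_def R'_def sum.distrib field_simps)
  qed
  have phase: "cos (\<phi> + 2 * pi * psum v 0 (N + m) x) = cos (\<phi> - 2 * pi * real (N + m) * level v)" for x
  proof -
    \<comment> \<open>the random part of the sum is an integer\<close>
    define K :: int where "K = (\<Sum>i<N + m. of_bool (V (int i) x \<le> v))"
    have eq: "psum v 0 (N + m) x = of_int K - real (N + m) * level v"
      by (simp add: psum_def centred_ind_def sum_subtractf K_def)
    have "\<phi> + 2 * pi * psum v 0 (N + m) x =
        (\<phi> - 2 * pi * real (N + m) * level v) + 2 * pi * of_int K"
      unfolding eq by (simp add: algebra_simps)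
    then show ?thesis by (simp only: cos_add_2pi_int)
  qed
  have "\<bar>cos (\<phi> - 2 * pi * real (N + m) * level v) - cos (\<phi> + 2 * pi * (L x + R' x))\<bar> \<le> 2 * pi * \<bar>Z x\<bar>" for x
  proof -
    have "\<bar>cos (\<phi> + 2 * pi * psum v 0 (N + m) x) - cos (\<phi> + 2 * pi * (L x + R' x))\<bar> \<le>
        \<bar>(\<phi> + 2 * pi * psum v 0 (N + m) x) - (\<phi> + 2 * pi * (L x + R' x))\<bar>"
      by (rule abs_cos_diff_le)
    also have "\<dots> = 2 * pi * \<bar>Z x\<bar>" by (simp add: split algebra_simps abs_mult)
    finally show ?thesis by (simp only: phase)
  qed
  then have "\<bar>expectation (\<lambda>x. cos (\<phi> - 2 * pi * real (N + m) * level v) - cos (\<phi> + 2 * pi * (L x + R' x)))\<bar>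
      \<le> expectation (\<lambda>x. 2 * pi * \<bar>Z x\<bar>)"
    unfolding Z_def
    by (intro order_trans[OF integral_abs_bound integral_mono] bounded_rv_integrable
        bounded_rv_intros trig bounded_psum) measurable
  also have "\<dots> \<le> 2 * pi * (\<eta> + 64 * C / (\<eta> * sqrt (real m)))"
    using mult_left_mono[OF smoothed_middle_small[OF N m lrv0 \<eta>], of "2 * pi"] by (simp add: Z_def)
  finally have E1: "\<bar>cos (\<phi> - 2 * pi * real (N + m) * level v) - expectation (\<lambda>x. cos (\<phi> + 2 * pi * (L x + R' x)))\<bar>
      \<le> 2 * pi * (\<eta> + 64 * C / (\<eta> * sqrt (real m)))"
    by (simp add: bounded_rv_integrable bounded_rv_const trig prob_space)
  define T where "T = int ` {N..<N + m}"
  define \<Psi> where "\<Psi> p = (\<Sum>k<m. \<Sum>i<m - k. of_bool (p (int k + int N + int i)) - level v) / real m" for p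
  have \<Psi>: "\<Psi> (\<lambda>t. t \<in> T \<and> V t x \<le> v) = R' x" for x
    unfolding \<Psi>_def R'_def psum_def centred_ind_def
    by (intro arg_cong2[where f = "(/)"] sum.cong refl) (auto simp: T_def image_iff intro!: bexI[of _ "_ + N + _"])
  have T: "finite T" "T \<subseteq> {int m<..}" using N m by (auto simp: T_def)
  have rate: "(\<Sum>t\<in>T. C / (1 + of_int (t - int m)) ^ 4) \<le> C * real m / (1 + real (N - m))"
  proof -
    have "C / (1 + of_int (t - int m)) ^ 4 \<le> C / (1 + real (N - m))" if "t \<in> T" for t
    proof (rule divide_left_mono)
      have "1 + real (N - m) \<le> 1 + of_int (t - int m)" using that N by (auto simp: T_def of_nat_diff)
      also have "\<dots> \<le> (1 + of_int (t - int m)) ^ 4" using that N by (intro self_le_power) (auto simp: T_def)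
      finally show "1 + real (N - m) \<le> (1 + of_int (t - int m)) ^ 4" .
      then show "0 < (1 + real_of_int (t - int m)) ^ 4 * (1 + real (N - m))"
        by (intro mult_pos_pos) (auto intro: less_le_trans[of _ "1 + real (N - m)"])
    qed (use C_pos in auto)
    then have "(\<Sum>t\<in>T. C / (1 + of_int (t - int m)) ^ 4) \<le> (\<Sum>t\<in>T. C / (1 + real (N - m)))"
      by (rule sum_mono)
    also have "\<dots> = C * real m / (1 + real (N - m))"
      by (simp add: T_def card_image)
    finally show ?thesis .
  qed
  have dec: "\<bar>expectation (\<lambda>x. A x * h (2 * pi * R' x)) - expectation A * expectation (\<lambda>x. h (2 * pi * R' x))\<bar>
      \<le> 2 * C * real m / (1 + real (N - m))"
    if "A \<in> borel_measurable (Hist (int m))" "\<And>x. \<bar>A x\<bar> \<le> 1" "\<And>y. \<bar>h y\<bar> \<le> 1"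
    for A and h :: "real \<Rightarrow> real"
    using decoupling[OF that(1,2) T, of "\<lambda>p. h (2 * pi * \<Psi> p)" 1 v] that(3) rate
    unfolding \<Psi> by simp
  note Lm [measurable]
  have d1: "\<bar>expectation (\<lambda>x. cos (\<phi> + 2 * pi * L x) * cos (2 * pi * R' x))
      - expectation (\<lambda>x. cos (\<phi> + 2 * pi * L x)) * expectation (\<lambda>x. cos (2 * pi * R' x))\<bar>
      \<le> 2 * C * real m / (1 + real (N - m))"
    by (rule dec) (auto, measurable)
  have d2: "\<bar>expectation (\<lambda>x. sin (\<phi> + 2 * pi * L x) * sin (2 * pi * R' x))
      - expectation (\<lambda>x. sin (\<phi> + 2 * pi * L x)) * expectation (\<lambda>x. sin (2 * pi * R' x))\<bar>
      \<le> 2 * C * real m / (1 + real (N - m))"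
    by (rule dec) (auto, measurable)
  have "expectation (\<lambda>x. cos (\<phi> + 2 * pi * (L x + R' x))) =
      expectation (\<lambda>x. cos (\<phi> + 2 * pi * L x) * cos (2 * pi * R' x)
        - sin (\<phi> + 2 * pi * L x) * sin (2 * pi * R' x))"
    by (rule Bochner_Integration.integral_cong)
      (auto simp: cos_add[symmetric] algebra_simps)
  also have "\<dots> = expectation (\<lambda>x. cos (\<phi> + 2 * pi * L x) * cos (2 * pi * R' x))
      - expectation (\<lambda>x. sin (\<phi> + 2 * pi * L x) * sin (2 * pi * R' x))"
    by (rule Bochner_Integration.integral_diff)
      (intro bounded_rv_integrable bounded_rv_intros trig; measurable)+
  finally have E2: "expectation (\<lambda>x. cos (\<phi> + 2 * pi * (L x + R' x))) =
      expectation (\<lambda>x. cos (\<phi> + 2 * pi * L x) * cos (2 * pi * R' x))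
      - expectation (\<lambda>x. sin (\<phi> + 2 * pi * L x) * sin (2 * pi * R' x))" .
  have shift: "expectation (\<lambda>x. h (2 * pi * R' x)) = expectation (\<lambda>x. h (2 * pi * R x))"
    if "h \<in> borel_measurable borel" for h :: "real \<Rightarrow> real"
  proof -
    note that [measurable]
    have "(\<lambda>f. h (2 * pi * ((\<Sum>k<m. \<Sum>i<m - k. f (int k + int i)) / real m)))
        \<in> borel_measurable (Pi\<^sub>M UNIV (\<lambda>_. borel))" by measurable
    from expectation_shift[OF this, of v "int N"] show ?thesis
      by (simp add: R'_def R_def psum_def add.commute add.left_commute)
  qed
  show ?thesis
    using E1 d1 d2 unfolding E2 by (simp add: shift)
qed

text \<open>The phase \<open>\<phi>\<close> is chosen so that the first of two consecutive cosines is 1. Both are close to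
the same number, so \<open>cos (2 \<pi> p) = 1\<close> up to an error that can be made arbitrarily small.\<close>

lemma lrv_pos:
  assumes "0 < level v" "level v < 1"
  shows "0 < lrv v"
proof (rule ccontr)
  assume "\<not> 0 < lrv v"
  then have lrv0: "lrv v = 0" using lrv_nonneg[of v] by simp
  define \<kappa> where "\<kappa> = 1 - cos (2 * pi * level v)"
  have "cos (2 * pi * level v) \<noteq> 1"
  proof
    assume "cos (2 * pi * level v) = 1"
    then obtain k :: int where "2 * pi * level v = of_int k * 2 * pi"
      unfolding cos_one_2pi_int by auto
    then have "level v = of_int k" by simp
    then show False using assms by simp
  qed
  then have \<kappa>: "0 < \<kappa>" using cos_le_one[of "2 * pi * level v"] unfolding \<kappa>_def by linarith
  define \<eta> where "\<eta> = \<kappa> / 100"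
  have \<eta>: "0 < \<eta>" using \<kappa> by (simp add: \<eta>_def)
  obtain m0 :: nat where m0: "(64 * C / (\<eta> * \<eta>))\<^sup>2 < real m0" using reals_Archimedean2 by blast
  define m where "m = Suc m0"
  have m: "0 < m" by (simp add: m_def)
  have "64 * C / (\<eta> * \<eta>) \<le> sqrt (real m)"
    using m0 by (intro real_le_rsqrt) (simp add: m_def)
  then have small1: "64 * C / (\<eta> * sqrt (real m)) \<le> \<eta>"
    using \<eta> m by (simp add: field_simps)
  obtain n0 :: nat where n0: "4 * C * real m / \<eta> < real n0" using reals_Archimedean2 by blast
  define N where "N = n0 + 2 * m"
  have small2: "4 * C * real m / (1 + real (K - m)) \<le> \<eta>" if "N \<le> K" for K
  proof -
    have "4 * C * real m \<le> real n0 * \<eta>" using n0 \<eta> by (simp add: field_simps)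
    also have "\<dots> \<le> (1 + real (K - m)) * \<eta>" using that \<eta> by (intro mult_right_mono) (auto simp: N_def)
    finally show ?thesis by (simp add: field_simps)
  qed
  \<comment> \<open>\<open>17 = 8 * 2 + 1\<close>, from \<open>2 * pi < 8\<close> and the two bounds by \<open>\<eta>\<close> above\<close>
  have small: "2 * pi * (\<eta> + 64 * C / (\<eta> * sqrt (real m))) + 4 * C * real m / (1 + real (K - m)) \<le> 17 * \<eta>"
    if "N \<le> K" for K
  proof -
    have "2 * pi * (\<eta> + 64 * C / (\<eta> * sqrt (real m))) \<le> 8 * (\<eta> + \<eta>)"
      using small1 \<eta> C_pos pi_less_4 by (intro mult_mono add_mono) auto
    from add_mono[OF this small2[OF that]] show ?thesis by simp
  qed
  define \<phi> where "\<phi> = 2 * pi * real (N + m) * level v"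
  obtain z where close: "\<And>K. N \<le> K \<Longrightarrow> \<bar>cos (\<phi> - 2 * pi * real (K + m) * level v) - z\<bar> \<le> 17 * \<eta>"
  proof
    fix K assume "N \<le> K"
    then have "2 * m \<le> K" by (simp add: N_def)
    from order_trans[OF phase_asymptotically_constant[OF this m lrv0 \<eta>] small[OF \<open>N \<le> K\<close>]]
    show "\<bar>cos (\<phi> - 2 * pi * real (K + m) * level v) -
      (expectation (\<lambda>x. cos (\<phi> + 2 * pi * ((\<Sum>k<m. psum v 0 k x) / real m)))
         * expectation (\<lambda>x. cos (2 * pi * ((\<Sum>k<m. psum v (int k) (m - k) x) / real m)))
       - expectation (\<lambda>x. sin (\<phi> + 2 * pi * ((\<Sum>k<m. psum v 0 k x) / real m)))
         * expectation (\<lambda>x. sin (2 * pi * ((\<Sum>k<m. psum v (int k) (m - k) x) / real m))))\<bar>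
      \<le> 17 * \<eta>" .
  qed
  have "\<bar>cos (\<phi> - 2 * pi * real (N + m) * level v) - cos (\<phi> - 2 * pi * real (Suc N + m) * level v)\<bar> \<le> 34 * \<eta>"
    using close[of N, OF order_refl] close[of "Suc N", OF le_SucI[OF order_refl]]
    unfolding abs_le_iff by argo
  moreover have "cos (\<phi> - 2 * pi * real (N + m) * level v) = 1" by (simp add: \<phi>_def)
  moreover have "\<phi> - 2 * pi * real (Suc N + m) * level v = - (2 * pi * level v)"
    by (simp add: \<phi>_def algebra_simps)
  ultimately have "\<kappa> \<le> 34 * \<eta>" by (simp add: \<kappa>_def)
  then show False using \<kappa> by (simp add: \<eta>_def)
qed

end

section \<open>Squares of block sums and window increments\<close>

context weakly_dependent
begin

abbreviation block_sum :: "real \<Rightarrow> nat \<Rightarrow> nat \<Rightarrow> 'a \<Rightarrow> real" where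
  "block_sum v l j \<equiv> psum v (1 + int (j * l)) l"

lemma sum_block_sums: "(\<Sum>j<B. block_sum v l j x) = psum v 1 (B * l) x"
proof (induction B)
  case (Suc B)
  have "psum v 1 (Suc B * l) x = psum v 1 (B * l + l) x" by (simp only: mult_Suc add.commute)
  also have "\<dots> = psum v 1 (B * l) x + block_sum v l B x" by (rule psum_add)
  finally show ?case using Suc by simp
qed simp

definition centred_square :: "real \<Rightarrow> nat \<Rightarrow> nat \<Rightarrow> 'a \<Rightarrow> real" where
  "centred_square v l j x = (block_sum v l j x)\<^sup>2 / real l - sum_var v l / real l"

lemma square_le_length:
  assumes "\<bar>y\<bar> \<le> real l" shows "y\<^sup>2 / real l \<le> real l"
proof (cases "l = 0")
  case False
  have "y\<^sup>2 \<le> (real l)\<^sup>2" using assms by (simp add: abs_le_square_iff[symmetric])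
  then show ?thesis using False by (simp add: field_simps power2_eq_square)
qed simp

lemma sum_var_le_length: "sum_var v l / real l \<le> real l"
proof -
  have "expectation (\<lambda>x. (psum v 0 l x)\<^sup>2 / real l) \<le> expectation (\<lambda>x. real l)"
    by (intro integral_mono bounded_rv_integrable bounded_rv_intros bounded_psum
        square_le_length psum_bound)
  then show ?thesis by (simp add: sum_var_def prob_space)
qed

lemma centred_bound:
  assumes "\<bar>y\<bar> \<le> real l"
  shows "\<bar>y\<^sup>2 / real l - sum_var v l / real l\<bar> \<le> real l"
proof -
  have "0 \<le> y\<^sup>2 / real l" "0 \<le> sum_var v l / real l" by (simp_all add: sum_var_nonneg)
  then show ?thesis using square_le_length[OF assms] sum_var_le_length[of v l] by linarith
qed

lemma bounded_centred_square: "bounded_rv M (centred_square v l j)"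
  unfolding centred_square_def by (intro bounded_rv_intros bounded_psum)

lemma expectation_centred_square: "expectation (centred_square v l j) = 0"
  unfolding centred_square_def[abs_def]
  using bounded_psum[of v "1 + int (j * l)" l]
  by (simp add: bounded_rv_integrable bounded_rv_power bounded_rv_divide bounded_rv_const
      psum_var prob_space)

lemma centred_square_second_moment:
  assumes "0 < l"
  shows "expectation (\<lambda>x. (centred_square v l j x)\<^sup>2) \<le> 4 * fourth_const\<^sup>2"
proof -
  define Y where "Y x = (block_sum v l j x)\<^sup>2 / real l" for x
  define m where "m = sum_var v l / real l"
  have bY: "bounded_rv M Y" unfolding Y_def by (intro bounded_rv_intros bounded_psum)
  have EY: "expectation Y = m" by (simp add: Y_def[abs_def] m_def psum_var del: of_nat_mult)
  have "expectation (\<lambda>x. (centred_square v l j x)\<^sup>2) = expectation (\<lambda>x. (Y x)\<^sup>2 - 2 * m * Y x + m\<^sup>2)"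
  proof -
    have cs: "centred_square v l j x = Y x - m" for x by (simp only: centred_square_def Y_def m_def)
    show ?thesis unfolding cs by (simp add: power2_eq_square algebra_simps)
  qed
  also have "\<dots> = expectation (\<lambda>x. (Y x)\<^sup>2) - 2 * m * expectation Y + m\<^sup>2"
    using bY by (simp add: bounded_rv_integrable bounded_rv_power bounded_rv_const bounded_rv_mult
        bounded_rv_diff prob_space)
  also have "\<dots> \<le> expectation (\<lambda>x. (Y x)\<^sup>2)"
    unfolding EY by (simp add: power2_eq_square)
  also have "\<dots> = expectation (\<lambda>x. block_sum v l j x ^ 4) / (real l)\<^sup>2"
    by (simp add: Y_def power_divide flip: power_mult)
  also have "\<dots> \<le> (fourth_const * (1 + real l))\<^sup>2 / (real l)\<^sup>2"
    by (intro divide_right_mono psum_fourth_moment) auto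
  also have "\<dots> \<le> (fourth_const * (2 * real l))\<^sup>2 / (real l)\<^sup>2"
    using assms fourth_const_ge_1 by (intro divide_right_mono power_mono mult_left_mono) auto
  also have "\<dots> = 4 * fourth_const\<^sup>2" using assms by (simp add: power_mult_distrib)
  finally show ?thesis .
qed

text \<open>Blocks with indices \<open>h \<ge> 2\<close> apart are separated by at least \<open>(h - 1) l\<close> time steps. Two of
the four powers are kept for the sum over \<open>h\<close>.\<close>

lemma block_distance_rate:
  assumes l: "0 < l" and h: "2 \<le> h" and t: "real ((h - 1) * l) + 1 \<le> t"
  shows "C / (1 + t) ^ 4 \<le> 81 * C / (real l ^ 4 * (1 + real h)\<^sup>2)"
proof -
  have "(1 + real h) / 3 \<le> real (h - 1)" using h by (simp add: of_nat_diff)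
  then have "real l * (1 + real h) / 3 \<le> real l * real (h - 1)"
    unfolding times_divide_eq_right[symmetric] by (rule mult_left_mono) simp
  also have "\<dots> \<le> 1 + t" using t by (simp add: mult.commute)
  finally have "(real l * (1 + real h) / 3) ^ 4 \<le> (1 + t) ^ 4"
    by (intro power_mono) auto
  moreover have "(real l * (1 + real h) / 3) ^ 4 = real l ^ 4 * (1 + real h) ^ 4 / 81"
    by (simp add: power_divide power_mult_distrib)
  moreover have "real l ^ 4 * (1 + real h)\<^sup>2 \<le> real l ^ 4 * (1 + real h) ^ 4"
    by (intro mult_left_mono power_increasing) auto
  ultimately have le: "real l ^ 4 * (1 + real h)\<^sup>2 / 81 \<le> (1 + t) ^ 4" by argo
  have pos: "0 < real l ^ 4 * (1 + real h)\<^sup>2 / 81" using l by simp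
  have "C / (1 + t) ^ 4 \<le> C / (real l ^ 4 * (1 + real h)\<^sup>2 / 81)"
    using C_pos le pos less_le_trans[OF pos le] by (intro divide_left_mono mult_pos_pos) auto
  then show ?thesis by (simp add: mult.commute)
qed

text \<open>Blocks that coincide or touch are treated by the fourth moment. For the others decoupling costs a factor
\<open>l\<close> for each of the two bounds and one for the number of indicators, which the factor \<open>l^-4\<close> of
the rate more than compensates.\<close>

lemma centred_square_cov:
  assumes l: "0 < l" and ij: "i \<le> j"
  shows "expectation (\<lambda>x. centred_square v l i x * centred_square v l j x)
    \<le> (16 * fourth_const\<^sup>2 + 162 * C) * (1 / (1 + real (j - i))\<^sup>2)"
proof (cases "j - i < 2")
  case True
  let ?X = "centred_square v l"
  have "?X i x * ?X j x \<le> ((?X i x)\<^sup>2 + (?X j x)\<^sup>2) / 2" for x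
    using sum_squares_bound[of "?X i x" "?X j x"] by (simp add: algebra_simps)
  then have "expectation (\<lambda>x. ?X i x * ?X j x) \<le> expectation (\<lambda>x. ((?X i x)\<^sup>2 + (?X j x)\<^sup>2) / 2)"
    by (intro integral_mono bounded_rv_integrable bounded_rv_intros bounded_centred_square)
  also have "\<dots> = (expectation (\<lambda>x. (?X i x)\<^sup>2) + expectation (\<lambda>x. (?X j x)\<^sup>2)) / 2"
    using bounded_centred_square[of v l]
    by (simp add: bounded_rv_integrable bounded_rv_power)
  also have "\<dots> \<le> 4 * fourth_const\<^sup>2"
    using centred_square_second_moment[OF l, of v i] centred_square_second_moment[OF l, of v j] by simp
  also have "\<dots> \<le> (16 * fourth_const\<^sup>2 + 162 * C) * (1 / 4)" using C_pos by simp
  also have "\<dots> \<le> (16 * fourth_const\<^sup>2 + 162 * C) * (1 / (1 + real (j - i))\<^sup>2)"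
  proof (rule mult_left_mono)
    have "(1 + real (j - i))\<^sup>2 \<le> 2\<^sup>2" using True by (intro power_mono) auto
    then show "1 / 4 \<le> 1 / (1 + real (j - i))\<^sup>2" by (simp add: field_simps)
  qed (use C_pos in auto)
  finally show ?thesis .
next
  case False
  define h where "h = j - i"
  have h: "2 \<le> h" using False by (simp add: h_def)
  define s where "s = int ((i + 1) * l)"
  define T where "T = (\<lambda>k. 1 + int (j * l) + int k) ` {..<l}"
  have dist: "real ((h - 1) * l) + 1 \<le> real_of_int (t - s)" if tT: "t \<in> T" for t
  proof -
    obtain k where t: "t = 1 + int (j * l) + int k" using tT unfolding T_def by blast
    have "j = i + 1 + (h - 1)" using h by (simp add: h_def)
    then have "j * l = (i + 1) * l + (h - 1) * l" by (metis add_mult_distrib)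
    then show ?thesis by (simp add: t s_def)
  qed
  have T: "finite T" "T \<subseteq> {s<..}"
  proof -
    have "s < t" if "t \<in> T" for t
    proof -
      have "0 < real_of_int (t - s)"
        by (rule less_le_trans[OF _ dist[OF that]]) (simp add: add_nonneg_pos)
      then show ?thesis by simp
    qed
    then show "T \<subseteq> {s<..}" by auto
  qed (simp add: T_def)
  have A: "centred_square v l i \<in> borel_measurable (Hist s)"
    unfolding centred_square_def
    by (intro borel_measurable_diff borel_measurable_divide borel_measurable_power
        borel_measurable_const psum_Hist) (auto simp: s_def algebra_simps)
  have A_bound: "\<bar>centred_square v l i x\<bar> \<le> real l" for x
    unfolding centred_square_def by (intro centred_bound psum_bound)
  define \<Phi> where "\<Phi> p = (\<Sum>k<l. of_bool (p (1 + int (j * l) + int k)) - level v)\<^sup>2 / real l - sum_var v l / real l" for p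
  have \<Phi>: "\<Phi> (\<lambda>t. t \<in> T \<and> V t x \<le> v) = centred_square v l j x" for x
  proof -
    have "(\<Sum>k<l. of_bool (1 + int (j * l) + int k \<in> T \<and> V (1 + int (j * l) + int k) x \<le> v) - level v)
        = block_sum v l j x"
      unfolding psum_def centred_ind_def by (intro sum.cong refl) (auto simp: T_def)
    then show ?thesis by (simp only: \<Phi>_def centred_square_def)
  qed
  have \<Phi>_bound: "\<bar>\<Phi> p\<bar> \<le> real l" for p
    unfolding \<Phi>_def
  proof (rule centred_bound)
    have "\<bar>\<Sum>k<l. of_bool (p (1 + int (j * l) + int k)) - level v\<bar> \<le> (\<Sum>k<l. 1)"
      using level_nonneg[of v] level_le_1[of v]
      by (intro order_trans[OF sum_abs] sum_mono) auto
    then show "\<bar>\<Sum>k<l. of_bool (p (1 + int (j * l) + int k)) - level v\<bar> \<le> real l" by simp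
  qed
  have "\<bar>expectation (\<lambda>x. centred_square v l i x * centred_square v l j x)\<bar>
      \<le> 2 * real l * real l * (\<Sum>t\<in>T. C / (1 + of_int (t - s)) ^ 4)"
    using decoupling[of "centred_square v l i" s "real l" T \<Phi> "real l" v, OF A A_bound T \<Phi>_bound]
    unfolding \<Phi> expectation_centred_square mult_zero_left diff_zero .
  also have "\<dots> \<le> 2 * real l * real l * (\<Sum>t\<in>T. 81 * C / (real l ^ 4 * (1 + real h)\<^sup>2))"
    by (intro mult_left_mono sum_mono block_distance_rate l h dist) auto
  also have "\<dots> = 162 * C / (real l * (1 + real h)\<^sup>2)"
  proof -
    have "card T = l" by (simp add: T_def card_image inj_on_def)
    moreover define y where "y = (1 + real h)\<^sup>2"
    ultimately show ?thesis using l unfolding y_def[symmetric] by (simp add: numeral_eq_Suc)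
  qed
  also have "\<dots> \<le> 162 * C / (1 * (1 + real h)\<^sup>2)"
    using l C_pos by (intro divide_left_mono mult_right_mono mult_pos_pos) auto
  also have "\<dots> \<le> (16 * fourth_const\<^sup>2 + 162 * C) * (1 / (1 + real h)\<^sup>2)"
    by (simp add: divide_right_mono)
  finally show ?thesis by (simp add: h_def)
qed

lemma mean_square_block_sums:
  assumes l: "0 < l" and B: "0 < B"
  shows "expectation (\<lambda>x. ((\<Sum>j<B. (block_sum v l j x)\<^sup>2) / (real B * real l) - sum_var v l / real l)\<^sup>2)
    \<le> 4 * (16 * fourth_const\<^sup>2 + 162 * C) / real B"
proof -
  let ?K = "16 * fourth_const\<^sup>2 + 162 * C"
  have e: "(\<Sum>j<B. (block_sum v l j x)\<^sup>2) / (real B * real l) - sum_var v l / real l =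
      (\<Sum>j<B. centred_square v l j x) / real B" for x
    using B by (simp add: centred_square_def sum_subtractf sum_divide_distrib[symmetric]
        diff_divide_distrib mult.commute)
  have "expectation (\<lambda>x. (\<Sum>j<B. centred_square v l j x)\<^sup>2) \<le> 2 * real B * (\<Sum>h<B. ?K * (1 / (1 + real h)\<^sup>2))"
    by (rule second_moment_sum) (use C_pos centred_square_cov[OF l] bounded_centred_square in auto)
  also have "\<dots> \<le> 2 * real B * (?K * 2)"
    unfolding sum_distrib_left[symmetric] using C_pos inverse_square_sum[of B]
    by (intro mult_left_mono) auto
  finally have "expectation (\<lambda>x. (\<Sum>j<B. centred_square v l j x)\<^sup>2) / (real B)\<^sup>2 \<le> 2 * real B * (?K * 2) / (real B)\<^sup>2"
    by (rule divide_right_mono) simp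
  also have "\<dots> = 4 * ?K / real B" using B by (simp add: power2_eq_square)
  finally show ?thesis unfolding e by (simp add: power_divide)
qed

text \<open>Window indicators have covariance at most \<open>p\<close>, and also at most the decoupling rate. The minimum of
the two is at most their geometric mean, which is summable over the lag and tends to 0 with \<open>p\<close>.\<close>

lemma increment_second_moment:
  assumes uw: "u \<le> w"
  defines "p \<equiv> level w - level u"
  shows "expectation (\<lambda>x. (psum w a n x - psum u a n x)\<^sup>2) \<le> 4 * sqrt p * (1 + 2 * sqrt C) * real n"
proof -
  define X where "X i x = centred_ind w (a + int i) x - centred_ind u (a + int i) x" for i x
  have p0: "0 \<le> p"
  proof -
    have "level u \<le> level w" unfolding level_def
      using uw by (intro finite_measure_mono) auto
    then show ?thesis by (simp add: p_def)
  qed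
  have p1: "p \<le> 1" using level_le_1[of w] level_nonneg[of u] by (simp add: p_def)
  have bX: "bounded_rv M (X i)" for i
    unfolding X_def by (intro bounded_rv_intros bounded_centred_ind)
  have Xe: "X i x = of_bool (u < V (a + int i) x \<and> V (a + int i) x \<le> w) - p" for i x
    using uw by (auto simp: X_def centred_ind_def p_def)
  have X1: "\<bar>X i x\<bar> \<le> 1" for i x using p0 p1 by (auto simp: Xe)
  have E0: "expectation (X i) = 0" for i
    unfolding X_def[abs_def] by (subst Bochner_Integration.integral_diff)
      (auto intro: bounded_rv_integrable bounded_centred_ind)
  have small: "expectation (\<lambda>x. X i x * X j x) \<le> p" for i j
  proof -
    \<comment> \<open>the window indicators \<open>X i + p\<close> and \<open>X j + p\<close> have a product at most \<open>X i + p\<close>\<close>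
    have "X i x * X j x \<le> (X i x + p) - p * X j x - p * X i x - p\<^sup>2" for x
    proof -
      define b c :: real where "b = X i x + p" and "c = X j x + p"
      have "b * c \<le> b" by (auto simp: b_def c_def Xe)
      then show ?thesis
        by (simp add: b_def c_def power2_eq_square algebra_simps)
    qed
    then have "expectation (\<lambda>x. X i x * X j x) \<le> expectation (\<lambda>x. (X i x + p) - p * X j x - p * X i x - p\<^sup>2)"
      by (intro integral_mono bounded_rv_integrable bounded_rv_intros bX)
    also have "\<dots> = p - p\<^sup>2"
      using bX by (simp add: bounded_rv_integrable bounded_rv_intros E0 prob_space)
    finally show ?thesis using zero_le_power2[of p] by linarith
  qed
  have decay: "expectation (\<lambda>x. X i x * X j x) \<le> 4 * C / (1 + real (j - i)) ^ 4" if ij: "i < j" for i j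
  proof -
    have A: "X i \<in> borel_measurable (Hist (a + int i))"
      unfolding X_def by (intro borel_measurable_diff centred_ind_Hist) auto
    have "expectation (\<lambda>x. X i x * X j x) =
        expectation (\<lambda>x. X i x * centred_ind w (a + int j) x) - expectation (\<lambda>x. X i x * centred_ind u (a + int j) x)"
    proof -
      have "(\<lambda>x. X i x * X j x) = (\<lambda>x. X i x * centred_ind w (a + int j) x - X i x * centred_ind u (a + int j) x)"
        by (simp add: X_def[of j] right_diff_distrib)
      then show ?thesis
        using bX bounded_centred_ind by (simp add: bounded_rv_integrable bounded_rv_mult)
    qed
    also have "\<dots> \<le> 4 * C / (1 + real (j - i)) ^ 4"
      using covariance_bound[OF A X1, of "a + int j" w] covariance_bound[OF A X1, of "a + int j" u] ij
      by (simp add: of_nat_diff)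
    finally show ?thesis .
  qed
  let ?\<rho> = "\<lambda>h. sqrt p * (1 + 2 * sqrt C) * (1 / (1 + real h)\<^sup>2)"
  have "expectation (\<lambda>x. (\<Sum>i<n. X i x)\<^sup>2) \<le> 2 * real n * (\<Sum>h<n. ?\<rho> h)"
  proof (rule second_moment_sum)
    fix i j :: nat assume "i \<le> j"
    show "expectation (\<lambda>x. X i x * X j x) \<le> ?\<rho> (j - i)"
    proof (cases "i = j")
      case True
      have "p \<le> sqrt p" using p0 p1 by (intro real_le_rsqrt) (simp add: power2_eq_square mult_left_le)
      also have "\<dots> \<le> sqrt p * (1 + 2 * sqrt C)" using C_pos p0 by (simp add: algebra_simps)
      finally show ?thesis using small[of i j] True by simp
    next
      case False
      define y where "y = 2 * sqrt C / (1 + real (j - i))\<^sup>2"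
      have y: "0 \<le> y" using C_pos by (simp add: y_def)
      have y2: "4 * C / (1 + real (j - i)) ^ 4 = y\<^sup>2"
        using C_pos by (simp add: y_def power_divide power_mult_distrib flip: power_mult)
      have le: "expectation (\<lambda>x. X i x * X j x) \<le> min (y\<^sup>2) p"
        using decay[of i j] small[of i j] False \<open>i \<le> j\<close> unfolding y2 by simp
      also have "min (y\<^sup>2) p \<le> sqrt p * y"
      proof (cases "y \<le> sqrt p")
        case True
        then have "y * y \<le> sqrt p * y" using y by (intro mult_right_mono)
        then show ?thesis by (simp add: power2_eq_square min.coboundedI1)
      next
        case False
        then have "sqrt p * sqrt p \<le> sqrt p * y" using p0 by (intro mult_left_mono) auto
        then show ?thesis using p0 by (simp add: min.coboundedI2)
      qed
      also have "\<dots> \<le> ?\<rho> (j - i)"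
        unfolding y_def using p0 by (simp add: divide_right_mono mult_left_mono)
      finally show ?thesis .
    qed
  qed (use p0 C_pos bX in auto)
  also have "\<dots> \<le> 2 * real n * (sqrt p * (1 + 2 * sqrt C) * 2)"
    unfolding sum_distrib_left[symmetric] using C_pos inverse_square_sum[of n] p0
    by (intro mult_left_mono) auto
  finally show ?thesis by (simp add: psum_def X_def sum_subtractf algebra_simps)
qed

section \<open>Consistency with a random cutoff\<close>

lemma psum_chebyshev:
  assumes "0 < t"
  shows "measure M {x \<in> space M. t \<le> \<bar>psum v a n x\<bar>} \<le> 4 * (1 + 2 * C) * real n / t\<^sup>2"
proof -
  have "{x \<in> space M. t \<le> \<bar>psum v a n x\<bar>} = {x \<in> space M. t\<^sup>2 \<le> (psum v a n x)\<^sup>2}"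
    using assms by (auto simp: abs_le_square_iff[of t, symmetric])
  also have "measure M \<dots> \<le> expectation (\<lambda>x. (psum v a n x)\<^sup>2) / t\<^sup>2"
    using assms by (intro markov_bounded bounded_rv_intros bounded_psum) auto
  also have "\<dots> \<le> 4 * (1 + 2 * C) * real n / t\<^sup>2"
    by (intro divide_right_mono psum_second_moment) auto
  finally show ?thesis .
qed

text \<open>Upper bound for the empirical variance, per unit of block length, of the indicators that
lie between the levels \<open>u\<close> and \<open>w\<close>: noise of the window counts plus their squared mean.\<close>

definition window_noise :: "real \<Rightarrow> real \<Rightarrow> nat \<Rightarrow> nat \<Rightarrow> 'a \<Rightarrow> real" where
  "window_noise u w B l x = 2 * (\<Sum>j<B. (block_sum w l j x - block_sum u l j x)\<^sup>2) / (real B * real l)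
     + 2 * real l * (level w - level u)\<^sup>2"

text \<open>The count conditions place the cutoff between \<open>u\<close> and \<open>w\<close>. Moving the level from \<open>q\<close> to the cutoff
then changes a block count by at most the number of scores of that block in the window.\<close>

lemma estimator_pointwise:
  fixes n l :: nat and \<alpha> u w q :: real and x :: 'a
  defines "B \<equiv> n div l" and "k \<equiv> cutoff_rank \<alpha> n"
  assumes l: "0 < l" and B: "0 < B" and k: "1 \<le> k" "k \<le> n" and uw: "u \<le> q" "q \<le> w"
    and below: "(\<Sum>i<n. of_bool (V (1 + int i) x \<le> u)) < real k"
    and above: "real k \<le> (\<Sum>i<n. of_bool (V (1 + int i) x \<le> w))"
  defines "U \<equiv> emp_var B (\<lambda>j. block_sum q l j x) / real l" and "E \<equiv> window_noise u w B l x"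
  shows "\<bar>block_variance_estimator V \<alpha> n l x - U\<bar> \<le> 2 * sqrt (U * E) + E"
proof -
  define xs where "xs = map (\<lambda>t. V (int t) x) [1..<n + 1]"
  define qh where "qh = order_stat k xs"
  have len: "length xs = n" by (simp add: xs_def)
  have cnt: "real (length (filter (\<lambda>y. y \<le> v) xs)) = (\<Sum>i<n. of_bool (V (1 + int i) x \<le> v))" for v
    unfolding xs_def length_filter_upt by simp
  have cutoff: "conformal_cutoff V \<alpha> n x = ereal qh"
    using k by (simp add: conformal_cutoff_def k_def[symmetric] qh_def xs_def)
  have qh_iff: "qh \<le> v \<longleftrightarrow> real k \<le> (\<Sum>i<n. of_bool (V (1 + int i) x \<le> v))" for v
    using order_stat_le_iff[of k xs v] k unfolding qh_def len cnt[symmetric] by simp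
  have qh: "u < qh" "qh \<le> w" using qh_iff[of u] qh_iff[of w] below above by auto
  define p where "p = level w - level u"
  define W where "W = (\<lambda>j. block_sum q l j x)"
  define N where "N j = block_sum w l j x - block_sum u l j x" for j
  define d where "d j = (\<Sum>i<l. of_bool (V (1 + int (j * l) + int i) x \<le> qh)
      - of_bool (V (1 + int (j * l) + int i) x \<le> q) :: real)" for j
  have a: "(\<Sum>i<l. of_bool (V (1 + int (j * l) + int i) x \<le> qh)) = (W j + d j) + real l * level q" for j
    by (simp add: W_def d_def psum_def centred_ind_def sum_subtractf)
  have est: "block_variance_estimator V \<alpha> n l x = emp_var B (\<lambda>j. W j + d j) / real l"
    unfolding block_variance_estimator_emp_var cutoff ereal_less_eq a emp_var_shift B_def ..
  have d_le: "(d j)\<^sup>2 \<le> 2 * (N j)\<^sup>2 + 2 * (real l * p)\<^sup>2" for j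
  proof -
    have "\<bar>d j\<bar> \<le> (\<Sum>i<l. of_bool (V (1 + int (j * l) + int i) x \<le> w)
      - of_bool (V (1 + int (j * l) + int i) x \<le> u))"
      unfolding d_def using qh uw by (intro order_trans[OF sum_abs] sum_mono) auto
    also have "\<dots> = N j + real l * p"
      by (simp add: N_def psum_def centred_ind_def sum_subtractf p_def algebra_simps)
    finally have "(d j)\<^sup>2 \<le> (N j + real l * p)\<^sup>2" by (metis abs_ge_zero power2_abs power_mono)
    also have "\<dots> \<le> 2 * (N j)\<^sup>2 + 2 * (real l * p)\<^sup>2"
      using sum_squares_bound[of "N j" "real l * p"] by (simp add: power2_sum)
    finally show ?thesis .
  qed
  define \<Delta> where "\<Delta> = emp_var B d / real l"
  have "\<Delta> \<le> (\<Sum>j<B. (d j)\<^sup>2) / real B / real l"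
    unfolding \<Delta>_def emp_var_alt by (intro divide_right_mono) auto
  also have "\<dots> \<le> (\<Sum>j<B. 2 * (N j)\<^sup>2 + 2 * (real l * p)\<^sup>2) / real B / real l"
    by (intro divide_right_mono sum_mono d_le) auto
  also have "\<dots> = E"
  proof -
    have "E = 2 * (\<Sum>j<B. (N j)\<^sup>2) / (real B * real l) + 2 * real l * p\<^sup>2"
      unfolding E_def window_noise_def N_def p_def ..
    then show ?thesis
      using l B by (simp add: sum.distrib sum_distrib_left[symmetric] add_divide_distrib power2_eq_square)
  qed
  finally have \<Delta>E: "\<Delta> \<le> E" .
  have U0: "0 \<le> U" by (simp add: U_def emp_var_nonneg)
  have \<Delta>0: "0 \<le> \<Delta>" by (simp add: \<Delta>_def emp_var_nonneg)
  have "\<bar>block_variance_estimator V \<alpha> n l x - U\<bar> = \<bar>emp_var B (\<lambda>j. W j + d j) - emp_var B W\<bar> / real l"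
    unfolding est U_def W_def by (simp add: diff_divide_distrib[symmetric])
  also have "\<dots> \<le> (2 * sqrt (emp_var B W * emp_var B d) + emp_var B d) / real l"
    by (intro divide_right_mono emp_var_add_le) auto
  also have "\<dots> = 2 * sqrt (U * \<Delta>) + \<Delta>"
  proof -
    have "U * \<Delta> = emp_var B W * emp_var B d / (real l)\<^sup>2"
      by (simp add: U_def \<Delta>_def W_def power2_eq_square)
    then have "sqrt (U * \<Delta>) = sqrt (emp_var B W * emp_var B d) / real l"
      by (simp add: real_sqrt_divide)
    then show ?thesis by (simp add: \<Delta>_def add_divide_distrib)
  qed
  also have "\<dots> \<le> 2 * sqrt (U * E) + E"
    using \<Delta>E U0 by (intro add_mono mult_left_mono real_sqrt_le_mono) auto
  finally show ?thesis .
qed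

lemma expectation_window_noise:
  assumes l: "0 < l" and B: "0 < B" and uw: "u \<le> w"
  shows "expectation (window_noise u w B l) \<le>
    8 * sqrt (level w - level u) * (1 + 2 * sqrt C) + 2 * real l * (level w - level u)\<^sup>2"
proof -
  let ?N = "\<lambda>j x. (block_sum w l j x - block_sum u l j x)\<^sup>2"
  let ?c = "4 * sqrt (level w - level u) * (1 + 2 * sqrt C)"
  have b: "bounded_rv M (?N j)" for j by (intro bounded_rv_intros bounded_psum)
  have "expectation (window_noise u w B l) =
      2 * (\<Sum>j<B. expectation (?N j)) / (real B * real l) + 2 * real l * (level w - level u)\<^sup>2"
    unfolding window_noise_def[abs_def] using b
    by (simp add: bounded_rv_integrable bounded_rv_sum bounded_rv_const bounded_rv_mult bounded_rv_divide
        prob_space Bochner_Integration.integral_sum del: of_nat_mult)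
  also have "2 * (\<Sum>j<B. expectation (?N j)) / (real B * real l) \<le> 2 * (\<Sum>j<B. ?c * real l) / (real B * real l)"
    by (intro divide_right_mono mult_left_mono sum_mono increment_second_moment uw) auto
  also have "2 * (\<Sum>j<B. ?c * real l) / (real B * real l) = 2 * ?c" using l B by simp
  finally show ?thesis by simp
qed

lemma bounded_window_noise: "bounded_rv M (window_noise u w B l)"
  unfolding window_noise_def by (intro bounded_rv_intros bounded_psum)

text \<open>Outside of five exceptional events, each controlled by Markov's inequality, the mean square of
the block sums and the overall mean are near their expectations, the window noise is small, and
the counts at \<open>q - r\<close> and \<open>q + r\<close> enclose the rank of the cutoff.\<close>

lemma estimator_deviation:
  fixes n l :: nat and \<alpha> q r c d :: real
  defines "B \<equiv> n div l"
  assumes l: "0 < l" and B: "0 < B" and \<alpha>: "0 < \<alpha>" "\<alpha> < 1" and n\<alpha>: "2 \<le> real n * \<alpha>"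
    and r: "0 < r" and c: "0 < c" and ncr: "4 \<le> real n * (c * r)" and d: "0 < d"
    and low: "level (q - r) \<le> 1 - \<alpha> - c * r" and up: "1 - \<alpha> + c * r \<le> level (q + r)"
    and mean: "\<bar>sum_var q l / real l - lrv q\<bar> \<le> d"
  defines "p \<equiv> level (q + r) - level (q - r)"
  shows "\<exists>S \<in> sets M.
     {x \<in> space M. \<bar>block_variance_estimator V \<alpha> n l x - lrv q\<bar> > 4 * d + 2 * sqrt ((lrv q + 3 * d) * d)} \<subseteq> S \<and>
     measure M S \<le> 4 * (16 * fourth_const\<^sup>2 + 162 * C) / real B / d\<^sup>2 + 4 * (1 + 2 * C) / real B / d
       + (8 * sqrt p * (1 + 2 * sqrt C) + 2 * real l * p\<^sup>2) / d
       + 20 * (1 + 2 * C) * real n / (real n * (c * r))\<^sup>2"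
proof -
  define k where "k = cutoff_rank \<alpha> n"
  have k_lo: "(real n + 1) * (1 - \<alpha>) \<le> real k" and k_hi: "real k \<le> (real n + 1) * (1 - \<alpha>) + 1"
  proof -
    have pos: "0 < (real n + 1) * (1 - \<alpha>)" using \<alpha> by simp
    then have "real k = of_int \<lceil>(real n + 1) * (1 - \<alpha>)\<rceil>" by (simp add: k_def cutoff_rank_def)
    then show "(real n + 1) * (1 - \<alpha>) \<le> real k" "real k \<le> (real n + 1) * (1 - \<alpha>) + 1" by linarith+
  qed
  have k1: "1 \<le> k" 
  proof -
    have "0 < real k" using k_lo \<alpha> by (intro less_le_trans[OF _ k_lo]) simp
    then show ?thesis by simp
  qed
  have kn: "k \<le> n"
  proof -
    have "(real n + 1) * (1 - \<alpha>) + 1 = real n + 2 - real n * \<alpha> - \<alpha>" by (simp add: algebra_simps)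
    then have "real k \<le> real n" using k_hi n\<alpha> \<alpha> by linarith
    then show ?thesis by simp
  qed
  define mean_sq where "mean_sq x = (\<Sum>j<B. (block_sum q l j x)\<^sup>2) / (real B * real l)" for x
  define m where "m = sum_var q l / real l"
  define S1 where "S1 = {x \<in> space M. d\<^sup>2 \<le> (mean_sq x - m)\<^sup>2}"
  define S2 where "S2 = {x \<in> space M. d \<le> (psum q 1 (B * l) x)\<^sup>2 / ((real B)\<^sup>2 * real l)}"
  define S3 where "S3 = {x \<in> space M. d \<le> window_noise (q - r) (q + r) B l x}"
  define S4 where "S4 = {x \<in> space M. real n * (c * r) \<le> \<bar>psum (q - r) 1 n x\<bar>}"
  define S5 where "S5 = {x \<in> space M. real n * (c * r) / 2 \<le> \<bar>psum (q + r) 1 n x\<bar>}"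
  have bm: "bounded_rv M mean_sq" unfolding mean_sq_def by (intro bounded_rv_intros bounded_psum)
  note [measurable] = bounded_rv_measurable[OF bm] bounded_rv_measurable[OF bounded_psum]
    bounded_rv_measurable[OF bounded_window_noise]
  have sets: "S1 \<in> sets M" "S2 \<in> sets M" "S3 \<in> sets M" "S4 \<in> sets M" "S5 \<in> sets M"
    unfolding S1_def S2_def S3_def S4_def S5_def by measurable
  have P1: "measure M S1 \<le> 4 * (16 * fourth_const\<^sup>2 + 162 * C) / real B / d\<^sup>2"
  proof -
    have "measure M S1 \<le> expectation (\<lambda>x. (mean_sq x - m)\<^sup>2) / d\<^sup>2"
      unfolding S1_def using d by (intro markov_bounded bounded_rv_intros bm) auto
    also have "\<dots> \<le> 4 * (16 * fourth_const\<^sup>2 + 162 * C) / real B / d\<^sup>2"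
      unfolding mean_sq_def m_def by (intro divide_right_mono mean_square_block_sums l B) auto
    finally show ?thesis .
  qed
  have P2: "measure M S2 \<le> 4 * (1 + 2 * C) / real B / d"
  proof -
    have "measure M S2 \<le> expectation (\<lambda>x. (psum q 1 (B * l) x)\<^sup>2 / ((real B)\<^sup>2 * real l)) / d"
      unfolding S2_def using d by (intro markov_bounded bounded_rv_intros bounded_psum) auto
    also have "\<dots> = expectation (\<lambda>x. (psum q 1 (B * l) x)\<^sup>2) / ((real B)\<^sup>2 * real l) / d" by simp
    also have "\<dots> \<le> (4 * (1 + 2 * C) * real (B * l) / ((real B)\<^sup>2 * real l)) / d"
      by (intro divide_right_mono psum_second_moment) (use d in auto)
    also have "\<dots> = 4 * (1 + 2 * C) / real B / d" using l B by (simp add: power2_eq_square)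
    finally show ?thesis .
  qed
  have P3: "measure M S3 \<le> (8 * sqrt p * (1 + 2 * sqrt C) + 2 * real l * p\<^sup>2) / d"
  proof -
    have "measure M S3 \<le> expectation (window_noise (q - r) (q + r) B l) / d"
      unfolding S3_def using d
      by (intro markov_bounded bounded_window_noise) (auto simp: window_noise_def sum_nonneg)
    also have "\<dots> \<le> (8 * sqrt p * (1 + 2 * sqrt C) + 2 * real l * p\<^sup>2) / d"
      unfolding p_def using d r by (intro divide_right_mono expectation_window_noise l B) auto
    finally show ?thesis .
  qed
  have ncr0: "0 < real n * (c * r)" using ncr by linarith
  have P4: "measure M S4 \<le> 4 * (1 + 2 * C) * real n / (real n * (c * r))\<^sup>2"
    unfolding S4_def using ncr0 by (rule psum_chebyshev)
  have P5: "measure M S5 \<le> 16 * (1 + 2 * C) * real n / (real n * (c * r))\<^sup>2"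
  proof -
    have "measure M S5 \<le> 4 * (1 + 2 * C) * real n / (real n * (c * r) / 2)\<^sup>2"
      unfolding S5_def using ncr0 by (intro psum_chebyshev) simp
    also have "\<dots> = 16 * (1 + 2 * C) * real n / (real n * (c * r))\<^sup>2" by (simp add: power_divide)
    finally show ?thesis .
  qed
  let ?S = "S1 \<union> (S2 \<union> (S3 \<union> (S4 \<union> S5)))"
  have "measure M ?S \<le> measure M S1 + (measure M S2 + (measure M S3 + (measure M S4 + measure M S5)))"
    using sets by (intro order_trans[OF measure_Un_le] add_left_mono measure_Un_le) auto
  moreover have "4 * (1 + 2 * C) * real n / (real n * (c * r))\<^sup>2 + 16 * (1 + 2 * C) * real n / (real n * (c * r))\<^sup>2
      = 20 * (1 + 2 * C) * real n / (real n * (c * r))\<^sup>2"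
    unfolding add_divide_distrib[symmetric] by (simp add: algebra_simps)
  ultimately have P: "measure M ?S \<le> 4 * (16 * fourth_const\<^sup>2 + 162 * C) / real B / d\<^sup>2 + 4 * (1 + 2 * C) / real B / d
       + (8 * sqrt p * (1 + 2 * sqrt C) + 2 * real l * p\<^sup>2) / d
       + 20 * (1 + 2 * C) * real n / (real n * (c * r))\<^sup>2"
    using P1 P2 P3 P4 P5 by linarith
  have "\<bar>block_variance_estimator V \<alpha> n l x - lrv q\<bar> \<le> 4 * d + 2 * sqrt ((lrv q + 3 * d) * d)"
    if x: "x \<in> space M" "x \<notin> ?S" for x
  proof -
    define U where "U = emp_var B (\<lambda>j. block_sum q l j x) / real l"
    define E where "E = window_noise (q - r) (q + r) B l x"
    have n1: "\<bar>mean_sq x - m\<bar> < d"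
    proof -
      have "(mean_sq x - m)\<^sup>2 < d\<^sup>2" using x by (auto simp: S1_def)
      then show ?thesis using d power_less_imp_less_base[of "\<bar>mean_sq x - m\<bar>" 2 d] by simp
    qed
    have n2: "(psum q 1 (B * l) x)\<^sup>2 / ((real B)\<^sup>2 * real l) < d" using x by (auto simp: S2_def)
    have n3: "E < d" using x by (auto simp: S3_def E_def)
    have n4: "\<bar>psum (q - r) 1 n x\<bar> < real n * (c * r)" using x by (auto simp: S4_def)
    have n5: "\<bar>psum (q + r) 1 n x\<bar> < real n * (c * r) / 2" using x by (auto simp: S5_def)
    have count: "(\<Sum>i<n. of_bool (V (1 + int i) x \<le> v)) = psum v 1 n x + real n * level v" for v
      by (simp add: psum_def centred_ind_def sum_subtractf)
    have below: "(\<Sum>i<n. of_bool (V (1 + int i) x \<le> q - r)) < real k"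
    proof -
      have "real n * level (q - r) \<le> real n * (1 - \<alpha> - c * r)" using low by (intro mult_left_mono) auto
      also have "\<dots> = (real n + 1) * (1 - \<alpha>) - real n * (c * r) - (1 - \<alpha>)" by (simp add: algebra_simps)
      finally show ?thesis using n4 k_lo \<alpha> unfolding count by linarith
    qed
    have above: "real k \<le> (\<Sum>i<n. of_bool (V (1 + int i) x \<le> q + r))"
    proof -
      have "real n * (1 - \<alpha> + c * r) \<le> real n * level (q + r)" using up by (intro mult_left_mono) auto
      moreover have "real n * (1 - \<alpha> + c * r) = (real n + 1) * (1 - \<alpha>) + real n * (c * r) - (1 - \<alpha>)"
        by (simp add: algebra_simps)
      ultimately show ?thesis using n5 k_hi \<alpha> ncr unfolding count by linarith
    qed
    have U_eq: "U = mean_sq x - (psum q 1 (B * l) x)\<^sup>2 / ((real B)\<^sup>2 * real l)"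
      unfolding U_def emp_var_alt mean_sq_def sum_block_sums
      by (simp add: diff_divide_distrib power_divide)
    have Ud: "\<bar>U - lrv q\<bar> \<le> 3 * d"
    proof -
      have "0 \<le> (psum q 1 (B * l) x)\<^sup>2 / ((real B)\<^sup>2 * real l)" by simp
      then show ?thesis using n1 n2 mean unfolding U_eq m_def[symmetric] by linarith
    qed
    have U0: "0 \<le> U" by (simp add: U_def emp_var_nonneg)
    have E0: "0 \<le> E" by (simp add: E_def window_noise_def sum_nonneg)
    have "U * E \<le> (lrv q + 3 * d) * d"
      using Ud U0 E0 n3 by (intro mult_mono) auto
    then have "sqrt (U * E) \<le> sqrt ((lrv q + 3 * d) * d)" by simp
    moreover have "\<bar>block_variance_estimator V \<alpha> n l x - U\<bar> \<le> 2 * sqrt (U * E) + E"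
      unfolding U_def E_def B_def
      by (rule estimator_pointwise) (use l B k1 kn r below above in \<open>auto simp: B_def k_def\<close>)
    ultimately show ?thesis using Ud n3 by linarith
  qed
  then have "{x \<in> space M. \<bar>block_variance_estimator V \<alpha> n l x - lrv q\<bar> > 4 * d + 2 * sqrt ((lrv q + 3 * d) * d)} \<subseteq> ?S"
    using linorder_not_less by blast
  then show ?thesis using P sets by (intro bexI[of _ ?S]) auto
qed

text \<open>All error terms of \<open>estimator_deviation\<close> are expressed in \<open>s n = sqrt (ell n / n)\<close>. The window radius
\<open>r = sqrt (s n / ell n)\<close> equals \<open>(n * ell n) powr (-1/4)\<close>, so that \<open>n * r\<^sup>2 = 1 / s n\<close> and \<open>ell n * r\<^sup>2 = s n\<close>.\<close>

theorem estimator_consistent: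
  fixes ell :: "nat \<Rightarrow> nat"
  assumes \<alpha>: "0 < \<alpha>" "\<alpha> < 1" and e: "0 < e" and c: "0 < c"
    and low: "\<And>r. 0 \<le> r \<Longrightarrow> r \<le> e \<Longrightarrow> level (q - r) \<le> 1 - \<alpha> - c * r"
    and up: "\<And>r. 0 \<le> r \<Longrightarrow> r \<le> e \<Longrightarrow> 1 - \<alpha> + c * r \<le> level (q + r)"
    and lip: "\<And>r. 0 \<le> r \<Longrightarrow> r \<le> e \<Longrightarrow> level (q + r) - level (q - r) \<le> K * r"
    and ell_top: "filterlim ell at_top sequentially"
    and ell_small: "(\<lambda>n. real (ell n) / real n) \<longlonglongrightarrow> 0"
  shows "tendsto_in_prob M (\<lambda>n. block_variance_estimator V \<alpha> n (ell n)) (lrv q)"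
  unfolding tendsto_in_prob_def
proof (intro allI impI)
  fix D :: real assume D: "0 < D"
  have "((\<lambda>d. 4 * d + 2 * sqrt ((lrv q + 3 * d) * d)) \<longlongrightarrow> 4 * 0 + 2 * sqrt ((lrv q + 3 * 0) * 0)) (at_right 0)"
    by (intro tendsto_intros)
  then have "\<forall>\<^sub>F d in at_right 0. 4 * d + 2 * sqrt ((lrv q + 3 * d) * d) < D"
    by (rule order_tendstoD) (use D in simp)
  then obtain d where d: "0 < d" and dD: "4 * d + 2 * sqrt ((lrv q + 3 * d) * d) < D"
    unfolding eventually_at_right_field using dense by (metis (no_types, lifting))
  define s where "s n = sqrt (real (ell n) / real n)" for n
  \<comment> \<open>upper bound for the exceptional probability as a function of \<open>y = s n\<close>\<close>
  define \<beta> where "\<beta> y = 4 * (16 * fourth_const\<^sup>2 + 162 * C) * (2 * y\<^sup>2) / d\<^sup>2 + 4 * (1 + 2 * C) * (2 * y\<^sup>2) / d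
       + (8 * sqrt (K * sqrt y) * (1 + 2 * sqrt C) + 2 * (K\<^sup>2 * y)) / d
       + 20 * (1 + 2 * C) * y / c\<^sup>2" for y
  have s_lim: "s \<longlonglongrightarrow> 0"
    unfolding s_def using tendsto_real_sqrt[OF ell_small] by simp
  have "(\<lambda>n. \<beta> (s n)) \<longlonglongrightarrow> \<beta> 0"
    unfolding \<beta>_def using d c by (intro tendsto_intros s_lim) auto
  then have \<beta>_lim: "(\<lambda>n. \<beta> (s n)) \<longlonglongrightarrow> 0" by (simp add: \<beta>_def)
  have bound: "\<forall>\<^sub>F n in sequentially.
      measure M {x \<in> space M. D < \<bar>block_variance_estimator V \<alpha> n (ell n) x - lrv q\<bar>} \<le> \<beta> (s n)"
  proof -
    have "\<forall>\<^sub>F n in sequentially. 0 < ell n"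
      by (rule eventually_mono[OF ell_top[unfolded filterlim_at_top, rule_format, of 1]]) simp
    moreover have "\<forall>\<^sub>F n in sequentially. \<bar>sum_var q (ell n) / real (ell n) - lrv q\<bar> < d"
      using tendstoD[OF lrv_limit[OF ell_top] d] by (simp add: dist_real_def)
    moreover have "\<forall>\<^sub>F n in sequentially. s n < 1 / 2" "\<forall>\<^sub>F n in sequentially. s n < e\<^sup>2"
        "\<forall>\<^sub>F n in sequentially. s n < c / 4"
      by (rule order_tendstoD(2)[OF s_lim], use e c in simp)+
    moreover have "\<forall>\<^sub>F n in sequentially. 2 / \<alpha> \<le> real n"
      by (rule filterlim_real_sequentially[unfolded filterlim_at_top, rule_format])
    moreover have "\<forall>\<^sub>F n in sequentially. 0 < n" by (rule eventually_gt_at_top)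
    ultimately show ?thesis
    proof eventually_elim
      case (elim n)
      define l where "l = ell n"
      define y where "y = s n"
      define B where "B = n div l"
      define r where "r = sqrt (y / real l)"
      have l: "0 < l" and n: "0 < n" using elim by (simp_all add: l_def)
      have y: "0 < y" using l n by (simp add: y_def s_def l_def)
      have y2: "y\<^sup>2 = real l / real n" by (simp add: y_def s_def l_def)
      have y_half: "y < 1 / 2" and ye: "y < e\<^sup>2" and yc: "y < c / 4" using elim by (simp_all add: y_def)
      have ny: "real n = real l / y\<^sup>2" using n l y2 by simp
      have rr: "r\<^sup>2 = y / real l" using y by (simp add: r_def)
      have r: "0 < r" using y l by (simp add: r_def)
      have r_le: "r \<le> sqrt y" unfolding r_def using y l by (intro real_sqrt_le_mono) (simp add: field_simps)
      have r1: "r \<le> 1"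
      proof -
        have "sqrt y \<le> 1" using y_half by simp
        then show ?thesis using r_le by linarith
      qed
      have re: "r \<le> e"
      proof -
        have "sqrt y \<le> e" using ye e by (intro real_le_lsqrt) auto
        then show ?thesis using r_le by linarith
      qed
      have nr2: "real n * r\<^sup>2 = 1 / y"
        unfolding rr ny using l y by (simp add: power2_eq_square)
      have ncr: "4 \<le> real n * (c * r)"
      proof -
        have "4 \<le> c * (1 / y)" using yc y by (simp add: field_simps)
        also have "\<dots> = c * (real n * r * r)" unfolding nr2[symmetric] by (simp add: power2_eq_square)
        also have "\<dots> \<le> c * (real n * r * 1)" using r1 r c by (intro mult_left_mono) auto
        finally show ?thesis by (simp add: mult_ac)
      qed
      have B_inv: "0 < B \<and> 1 / real B \<le> 2 * y\<^sup>2"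
      proof -
        have "y\<^sup>2 \<le> (1 / 2)\<^sup>2" using y y_half by (intro power_mono) auto
        then have "y\<^sup>2 * real n \<le> (1 / 2)\<^sup>2 * real n" by (rule mult_right_mono) simp
        then have ln: "4 * real l \<le> real n" using n unfolding y2 by (simp add: power2_eq_square)
        have "real n < real l * (real B + 1)"
        proof -
          have "n < l * (B + 1)" unfolding B_def using l by (simp add: dividend_less_times_div)
          then show ?thesis by (metis of_nat_1 of_nat_add of_nat_less_iff of_nat_mult)
        qed
        moreover have "real l \<le> real n / 2" using ln by simp
        ultimately have "real n / 2 \<le> real l * real B" by (simp add: algebra_simps)
        moreover have B0: "0 < B" unfolding B_def using l ln by (simp add: div_greater_zero_iff)
        ultimately show ?thesis using n by (simp add: y2 field_simps)
      qed
      define p where "p = level (q + r) - level (q - r)"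
      have p0: "0 \<le> p"
      proof -
        have "1 - \<alpha> + c * r \<le> level (q + r)" "level (q - r) \<le> 1 - \<alpha> - c * r" "0 \<le> c * r"
          using low[of r] up[of r] r re c by auto
        then show ?thesis unfolding p_def by linarith
      qed
      have pK: "p \<le> K * r" using lip[of r] r re by (simp add: p_def)
      then have K0: "0 \<le> K" using p0 r by (metis linorder_not_less mult_neg_pos order_trans)
      have sp: "sqrt p \<le> sqrt (K * sqrt y)"
        using pK r_le K0 by (intro real_sqrt_le_mono order_trans[OF pK] mult_left_mono) auto
      have lp: "real l * p\<^sup>2 \<le> K\<^sup>2 * y"
      proof -
        have "p\<^sup>2 \<le> (K * r)\<^sup>2" using p0 pK by (intro power_mono) auto
        then have "real l * p\<^sup>2 \<le> real l * (K\<^sup>2 * (y / real l))"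
          by (intro mult_left_mono) (auto simp: power_mult_distrib rr)
        then show ?thesis using l by simp
      qed
      have n\<alpha>: "2 \<le> real n * \<alpha>" using elim \<alpha> by (simp add: field_simps)
      have "\<bar>sum_var q l / real l - lrv q\<bar> \<le> d" using elim by (simp add: l_def)
      from estimator_deviation[OF l _ \<alpha> n\<alpha> r c ncr d low[of r] up[of r] this] B_inv r re
      obtain S where S: "S \<in> sets M"
        "{x \<in> space M. \<bar>block_variance_estimator V \<alpha> n l x - lrv q\<bar> > 4 * d + 2 * sqrt ((lrv q + 3 * d) * d)} \<subseteq> S"
        and PS: "measure M S \<le> 4 * (16 * fourth_const\<^sup>2 + 162 * C) / real B / d\<^sup>2 + 4 * (1 + 2 * C) / real B / d
         + (8 * sqrt p * (1 + 2 * sqrt C) + 2 * real l * p\<^sup>2) / d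
         + 20 * (1 + 2 * C) * real n / (real n * (c * r))\<^sup>2"
        unfolding B_def p_def by auto
      have "measure M {x \<in> space M. D < \<bar>block_variance_estimator V \<alpha> n l x - lrv q\<bar>} \<le> measure M S"
        using S dD by (intro finite_measure_mono) auto
      also note PS
      also have "4 * (16 * fourth_const\<^sup>2 + 162 * C) / real B / d\<^sup>2 \<le> 4 * (16 * fourth_const\<^sup>2 + 162 * C) * (2 * y\<^sup>2) / d\<^sup>2"
        using mult_left_mono[OF conjunct2[OF B_inv], of "4 * (16 * fourth_const\<^sup>2 + 162 * C)"] C_pos
        by (intro divide_right_mono) auto
      also have "4 * (1 + 2 * C) / real B / d \<le> 4 * (1 + 2 * C) * (2 * y\<^sup>2) / d"
        using mult_left_mono[OF conjunct2[OF B_inv], of "4 * (1 + 2 * C)"] C_pos d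
        by (intro divide_right_mono) auto
      also have "(8 * sqrt p * (1 + 2 * sqrt C) + 2 * real l * p\<^sup>2) / d
          \<le> (8 * sqrt (K * sqrt y) * (1 + 2 * sqrt C) + 2 * (K\<^sup>2 * y)) / d"
        using sp lp d C_pos by (intro divide_right_mono add_mono mult_right_mono) auto
      also have "20 * (1 + 2 * C) * real n / (real n * (c * r))\<^sup>2 = 20 * (1 + 2 * C) * y / c\<^sup>2"
      proof -
        have "(real n * (c * r))\<^sup>2 = c\<^sup>2 * real n * (real n * r\<^sup>2)" by (simp add: power2_eq_square)
        then show ?thesis unfolding nr2 using n y c by simp
      qed
      finally show ?case unfolding \<beta>_def y_def[symmetric] l_def[symmetric] by simp
    qed
  qed
  show "(\<lambda>n. measure M {x \<in> space M. D < \<bar>block_variance_estimator V \<alpha> n (ell n) x - lrv q\<bar>}) \<longlonglongrightarrow> 0"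
    by (rule tendsto_sandwich[OF always_eventually bound tendsto_const \<beta>_lim]) simp
qed

end

section \<open>Quantiles and decay of the dependence coefficients\<close>

text \<open>The infimum is attained because the distribution function is continuous, and continuity also
excludes a jump over \<open>p\<close>.\<close>

lemma cdf_quantile_eq:
  assumes M: "real_distribution M" and cont: "continuous_on UNIV (cdf M)" and p: "0 < p" "p < 1"
  shows "cdf M (quantile (cdf M) p) = p"
proof -
  interpret real_distribution M by (rule M)
  let ?S = "{v. p \<le> cdf M v}"
  have "\<forall>\<^sub>F v in at_top. p < cdf M v" using cdf_lim_at_top_prob by (rule order_tendstoD) (rule p)
  then obtain b where b: "p < cdf M b" by (auto simp: eventually_at_top_linorder)
  have "\<forall>\<^sub>F v in at_bot. cdf M v < p" using cdf_lim_at_bot by (rule order_tendstoD) (rule p)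
  then obtain a where a: "cdf M a < p" by (auto simp: eventually_at_bot_linorder)
  have low: "a \<le> v" if "v \<in> ?S" for v
    using that a cdf_nondecreasing[of v a] by (cases "a \<le> v") auto
  have bdd: "bdd_below ?S" using low by (auto simp: bdd_below_def)
  have cont_q: "isCont (cdf M) x" for x using cont by (simp add: continuous_on_eq_continuous_at)
  have "closed ?S" by (intro closed_Collect_le continuous_on_const cont)
  then have "Inf ?S \<in> ?S" using b bdd by (intro closed_contains_Inf) (auto intro!: exI[of _ b])
  then have ge: "p \<le> cdf M (Inf ?S)" by simp
  have "cdf M (Inf ?S) \<le> p"
  proof (rule ccontr)
    assume "\<not> cdf M (Inf ?S) \<le> p"
    then have "\<forall>\<^sub>F v in at (Inf ?S). p < cdf M v"
      using cont_q[of "Inf ?S"] by (intro order_tendstoD(1)[of "cdf M"]) (auto simp: isCont_def)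
    then have "\<forall>\<^sub>F v in at_left (Inf ?S). p < cdf M v"
      by (rule filter_leD[OF at_le, rotated]) simp
    then obtain v where "v < Inf ?S" "p < cdf M v"
      unfolding eventually_at_left_field using dense by (metis (no_types, lifting))
    then show False using cInf_lower[of v ?S] bdd by auto
  qed
  with ge show ?thesis by (simp add: quantile_def)
qed

lemma density_increment_bounds:
  assumes dens: "has_density_between F f l u" and ab: "l \<le> a" "a \<le> b" "b \<le> u"
    and f: "\<And>v. l \<le> v \<Longrightarrow> v \<le> u \<Longrightarrow> c \<le> f v \<and> f v \<le> K"
  shows "c * (b - a) \<le> F b - F a" "F b - F a \<le> K * (b - a)"
proof -
  have int: "set_integrable lborel {a..b} f" and eq: "F b - F a = (LBINT x:{a..b}. f x)"
    using dens ab by (auto simp: has_density_between_def)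
  have const: "set_integrable lborel {a..b} (\<lambda>_. y)" "(LBINT x:{a..b}. y) = y * (b - a)" for y :: real
    using ab by (simp_all add: set_integrable_def set_integral_const)
  have "(LBINT x:{a..b}. c) \<le> (LBINT x:{a..b}. f x)"
    by (rule set_integral_mono[OF const(1) int]) (use f ab in auto)
  then show "c * (b - a) \<le> F b - F a" by (simp add: eq const)
  have "(LBINT x:{a..b}. f x) \<le> (LBINT x:{a..b}. K)"
    by (rule set_integral_mono[OF int const(1)]) (use f ab in auto)
  then show "F b - F a \<le> K * (b - a)" by (simp add: eq const)
qed

text \<open>A decreasing summable sequence is \<open>O(1/h)\<close>. Applied to the square roots of the tails \<open>T h\<close> of \<open>\<theta>\<close>
this gives \<open>T h = O(h^-2)\<close>, and the tail of the squares is at most \<open>(T h)\<^sup>2\<close>.\<close>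

lemma quartic_tail:
  fixes \<theta> :: "nat \<Rightarrow> real"
  assumes nonneg: "\<And>k. 0 \<le> \<theta> k" and sum: "summable \<theta>"
    and tails: "summable (\<lambda>k. sqrt (\<Sum>j. \<theta> (j + Suc k)))"
  obtains C where "0 < C" "\<And>h. 1 \<le> h \<Longrightarrow> (\<Sum>j. (\<theta> (j + h))\<^sup>2) \<le> C / (1 + real h) ^ 4"
    "summable (\<lambda>j. (\<theta> j)\<^sup>2)"
proof -
  define T where "T h = (\<Sum>j. \<theta> (j + h))" for h
  have s: "summable (\<lambda>j. \<theta> (j + h))" for h by (rule summable_ignore_initial_segment[OF sum])
  have T0: "0 \<le> T h" for h unfolding T_def by (rule suminf_nonneg[OF s nonneg])
  have le: "\<theta> (j + h) \<le> T h" for j h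
    unfolding T_def using sum_le_suminf[OF s, of "{j}" h] nonneg by auto
  have sq_le: "(\<theta> (j + h))\<^sup>2 \<le> T h * \<theta> (j + h)" for j h
    unfolding power2_eq_square by (intro mult_right_mono le nonneg)
  have sq_sum: "summable (\<lambda>j. (\<theta> (j + h))\<^sup>2)" for h
    by (rule summable_comparison_test'[OF summable_mult[OF s[of h], of "T h"], of 0]) (use sq_le in auto)
  have dec: "T (Suc h) \<le> T h" for h
    using suminf_split_head[OF s[of h]] nonneg[of h] by (simp add: T_def)
  have mono: "T h \<le> T k" if "k \<le> h" for h k
    using that dec by (rule lift_Suc_antimono_le[of T, rotated])
  define A where "A = (\<Sum>k. sqrt (T (Suc k)))"
  have tails': "summable (\<lambda>k. sqrt (T (Suc k)))" using tails by (simp add: T_def)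
  have sqrt_le: "(1 + real n) * sqrt (T (Suc n)) \<le> A" for n
  proof -
    have "(1 + real n) * sqrt (T (Suc n)) = (\<Sum>k<Suc n. sqrt (T (Suc n)))" by simp
    also have "\<dots> \<le> (\<Sum>k<Suc n. sqrt (T (Suc k)))"
      by (intro sum_mono real_sqrt_le_mono mono) auto
    also have "\<dots> \<le> A"
      unfolding A_def by (rule sum_le_suminf[OF tails']) (auto simp: T0)
    finally show ?thesis .
  qed
  show thesis
  proof
    show "0 < 16 * A ^ 4 + 1" by (rule add_nonneg_pos) auto
    show "summable (\<lambda>j. (\<theta> j)\<^sup>2)" using sq_sum[of 0] by simp
    fix h :: nat assume "1 \<le> h"
    then obtain n where h: "h = Suc n" by (cases h) auto
    have "(\<Sum>j. (\<theta> (j + h))\<^sup>2) \<le> (\<Sum>j. T h * \<theta> (j + h))"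
      by (intro suminf_le sq_le sq_sum summable_mult s)
    also have "\<dots> = T h * T h" unfolding T_def by (rule suminf_mult[OF s])
    also have "\<dots> = sqrt (T h) ^ 4"
      using T0[of h] by (simp add: numeral_eq_Suc)
    also have "\<dots> \<le> (A / (1 + real n)) ^ 4"
      using sqrt_le[of n] T0[of h] by (intro power_mono) (simp_all add: h field_simps)
    also have "\<dots> \<le> (2 * A / (1 + real h)) ^ 4"
    proof (intro power_mono)
      have "0 \<le> A" using sqrt_le[of 0] T0[of 1] by (metis One_nat_def add_0_right mult_1 of_nat_0 order_trans real_sqrt_ge_zero)
      moreover have "A / (1 + real n) = 2 * A / (2 * (1 + real n))" by (simp add: field_simps)
      ultimately show "A / (1 + real n) \<le> 2 * A / (1 + real h)"
        unfolding \<open>A / (1 + real n) = 2 * A / (2 * (1 + real n))\<close> by (intro divide_left_mono) (auto simp: h)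
      show "0 \<le> A / (1 + real n)" using \<open>0 \<le> A\<close> by simp
    qed
    also have "\<dots> = 16 * A ^ 4 / (1 + real h) ^ 4" by (simp add: power_divide power_mult_distrib)
    also have "\<dots> \<le> (16 * A ^ 4 + 1) / (1 + real h) ^ 4" by (intro divide_right_mono) auto
    finally show "(\<Sum>j. (\<theta> (j + h))\<^sup>2) \<le> (16 * A ^ 4 + 1) / (1 + real h) ^ 4" .
  qed
qed

lemma (in causal_process) weakly_dependent_iid:
  assumes C: "0 < C" and tail: "\<And>h. 1 \<le> h \<Longrightarrow> (\<Sum>j. b (j + h)) \<le> C / (1 + real h) ^ 4"
  shows "weakly_dependent iid history V C"
proof (intro weakly_dependent.intro weakly_dependent_axioms.intro prob_space_iid C
    subalgebra_history V_history shift_invariant)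
  fix A :: "(int \<Rightarrow> 'e) \<Rightarrow> real" and s a T and \<Phi> :: "(int \<Rightarrow> bool) \<Rightarrow> real" and c v
  assume A: "A \<in> borel_measurable (history s)" "\<And>x. \<bar>A x\<bar> \<le> a"
    and T: "finite T" "T \<subseteq> {s<..}" and \<Phi>: "\<And>p. \<bar>\<Phi> p\<bar> \<le> c"
  have "0 \<le> a" "0 \<le> c" using A(2)[of undefined] \<Phi>[of undefined] by linarith+
  then have "2 * a * c * (\<Sum>t\<in>T. \<Sum>j. b (j + nat (t - s))) \<le> 2 * a * c * (\<Sum>t\<in>T. C / (1 + of_int (t - s)) ^ 4)"
  proof (intro mult_left_mono sum_mono)
    fix t assume "t \<in> T"
    then have "s < t" using T by auto
    then show "(\<Sum>j. b (j + nat (t - s))) \<le> C / (1 + of_int (t - s)) ^ 4"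
      using tail[of "nat (t - s)"] by simp
  qed auto
  with decoupling[where \<Phi> = \<Phi> and v = v, OF A T \<Phi>]
  show "\<bar>(\<integral>x. A x * \<Phi> (\<lambda>t. t \<in> T \<and> V t x \<le> v) \<partial>iid)
          - (\<integral>x. A x \<partial>iid) * (\<integral>x. \<Phi> (\<lambda>t. t \<in> T \<and> V t x \<le> v) \<partial>iid)\<bar>
        \<le> 2 * a * c * (\<Sum>t\<in>T. C / (1 + of_int (t - s)) ^ 4)" by linarith
qed

text \<open>By stationarity negative lags repeat the positive ones, and absolute convergence allows the sum over
the integers to be split accordingly.\<close>

lemma (in weakly_dependent) long_run_variance_lrv: "long_run_variance M V v = lrv v"
proof -
  define g where "g h = covariance M (\<lambda>x. of_bool (V 0 x \<le> v)) (\<lambda>x. of_bool (V h x \<le> v))" for h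
  have g: "g h = expectation (\<lambda>x. centred_ind v 0 x * centred_ind v h x)" for h
    by (simp add: g_def covariance_def expectation_of_bool centred_ind_def)
  have g_pos: "g (int n) = autocov v n" for n by (simp add: g autocov_def)
  have g_neg: "g (- int (Suc n)) = autocov v (Suc n)" for n
    using expectation_centred_ind_prod_shift[of v "- int (Suc n)" "Suc n"]
    by (simp add: g autocov_def mult.commute)
  have s1: "autocov v sums (autocov v 0 + (\<Sum>h. autocov v (Suc h)))"
    using summable_sums[OF autocov_tail(1)[of v]] unfolding sums_Suc_iff by (simp add: add.commute)
  have abs1: "summable (\<lambda>n. norm (autocov v n))"
    using autocov_tail(3)[of v] by (subst summable_Suc_iff[symmetric]) simp
  have "(autocov v has_sum (autocov v 0 + (\<Sum>h. autocov v (Suc h)))) UNIV"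
    by (rule norm_summable_imp_has_sum[OF abs1 s1])
  then have h1: "(g has_sum (autocov v 0 + (\<Sum>h. autocov v (Suc h)))) (range int)"
    by (subst has_sum_reindex) (simp_all add: o_def g_pos)
  have "((\<lambda>h. autocov v (Suc h)) has_sum (\<Sum>h. autocov v (Suc h))) UNIV"
    using autocov_tail(1,3)[of v] by (intro norm_summable_imp_has_sum) (simp_all add: summable_sums)
  then have h2: "(g has_sum (\<Sum>h. autocov v (Suc h))) (range (\<lambda>n. - int (Suc n)))"
    using g_neg by (subst has_sum_reindex) (auto simp: o_def inj_on_def)
  have disj: "range int \<inter> range (\<lambda>n. - int (Suc n)) = {}" by auto
  have "range int \<union> range (\<lambda>n. - int (Suc n)) = UNIV"
  proof -
    have "h \<in> range int \<union> range (\<lambda>n. - int (Suc n))" for h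
      by (cases h rule: int_cases) auto
    then show ?thesis by auto
  qed
  then have "(g has_sum lrv v) UNIV"
    using has_sum_Un_disjoint[OF h1 h2 disj] by (simp add: lrv_def add.commute)
  then show ?thesis
    unfolding long_run_variance_def g_def[symmetric] by (rule infsumI)
qed

text \<open>The order statistic is compared with a number by counting, which reduces its measurability to that
of the indicators.\<close>

lemma block_variance_estimator_measurable:
  assumes V [measurable]: "\<And>t. V t \<in> borel_measurable M" and \<alpha>: "\<alpha> < 1"
  shows "block_variance_estimator V \<alpha> n l \<in> borel_measurable M"
proof -
  define k where "k = cutoff_rank \<alpha> n"
  have k1: "1 \<le> k"
  proof -
    have "0 < (real n + 1) * (1 - \<alpha>)" using \<alpha> by simp
    then show ?thesis by (simp add: k_def cutoff_rank_def less_eq_Suc_le[symmetric])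
  qed
  have "conformal_cutoff V \<alpha> n \<in> borel_measurable M"
  proof (cases "k \<le> n")
    case True
    have "(\<lambda>x. order_stat k (map (\<lambda>t. V (int t) x) [1..<n + 1])) \<in> borel_measurable M"
    proof (rule borel_measurable_iff_le[THEN iffD2, rule_format])
      fix a
      have "order_stat k (map (\<lambda>t. V (int t) x) [1..<n + 1]) \<le> a \<longleftrightarrow>
          real k \<le> real (length (filter (\<lambda>y. y \<le> a) (map (\<lambda>t. V (int t) x) [1..<n + 1])))" for x
        unfolding of_nat_le_iff by (rule order_stat_le_iff[OF k1]) (use True in simp)
      then have "{x \<in> space M. order_stat k (map (\<lambda>t. V (int t) x) [1..<n + 1]) \<le> a} =
          {x \<in> space M. real k \<le> (\<Sum>i<n. of_bool (V (int (Suc i)) x \<le> a))}"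
        unfolding length_filter_upt by simp
      also have "\<dots> \<in> sets M" by measurable
      finally show "{x \<in> space M. order_stat k (map (\<lambda>t. V (int t) x) [1..<n + 1]) \<le> a} \<in> sets M" .
    qed
    then show ?thesis using True by (simp add: conformal_cutoff_def[abs_def] k_def[symmetric])
  qed (simp add: conformal_cutoff_def[abs_def] k_def[symmetric])
  note this [measurable]
  show ?thesis
    unfolding block_variance_estimator_emp_var[abs_def] emp_var_def by measurable
qed

section \<open>The block variance estimator\<close>

theorem proposition4:
  fixes M :: "'w measure"
    and \<epsilon> :: "int \<Rightarrow> 'w \<Rightarrow> 'e::euclidean_space" and \<epsilon>0' :: "'w \<Rightarrow> 'e"
    and X :: "int \<Rightarrow> 'w \<Rightarrow> real ^ 'd" and Y :: "int \<Rightarrow> 'w \<Rightarrow> real"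
    and G :: "(nat \<Rightarrow> 'e) \<Rightarrow> (real ^ 'd) \<times> real"
    and \<mu> :: "real ^ 'd \<Rightarrow> real"
    and V Vstar :: "int \<Rightarrow> 'w \<Rightarrow> real" and H :: "(nat \<Rightarrow> 'e) \<Rightarrow> real"
    and F f :: "real \<Rightarrow> real" and \<alpha> q e c\<^sub>f C\<^sub>f :: real
    and \<theta> :: "nat \<Rightarrow> real" and ell :: "nat \<Rightarrow> nat"
  assumes M: "prob_space M"
    and innov_indep: "prob_space.indep_vars M (\<lambda>_. borel) \<epsilon> UNIV"
    and innov_ident: "\<And>t. distr M borel (\<epsilon> t) = distr M borel (\<epsilon> 0)"
    and copy_indep: "prob_space.indep_vars M (\<lambda>_. borel) (case_option \<epsilon>0' \<epsilon>) UNIV"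
    and copy_ident: "distr M borel \<epsilon>0' = distr M borel (\<epsilon> 0)"
    and G_meas: "G \<in> Pi\<^sub>M UNIV (\<lambda>_. borel) \<rightarrow>\<^sub>M borel"
    and Z_causal: "\<And>t \<omega>. \<omega> \<in> space M \<Longrightarrow> (X t \<omega>, Y t \<omega>) = G (innov_past \<epsilon> t \<omega>)"
    and \<mu>_meas: "\<mu> \<in> borel_measurable borel"
    and V_def: "V = (\<lambda>t \<omega>. \<bar>Y t \<omega> - \<mu> (X t \<omega>)\<bar>)"
    and H_meas: "H \<in> borel_measurable (Pi\<^sub>M UNIV (\<lambda>_. borel))"
    and V_causal: "\<And>t \<omega>. \<omega> \<in> space M \<Longrightarrow> V t \<omega> = H (innov_past \<epsilon> t \<omega>)"
    and Vstar_def: "Vstar = (\<lambda>t \<omega>. H (innov_past (\<epsilon>(0 := \<epsilon>0')) t \<omega>))"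
    and \<theta>_def: "\<theta> = indicator_dependence M V Vstar"
    and \<alpha>: "0 < \<alpha>" "\<alpha> < 1"
    and F_def: "F = cdf (distr M borel (V 0))"
    and q_def: "q = quantile F (1 - \<alpha>)"
    and F_cont: "continuous_on UNIV F"
    and \<theta>_summable: "summable \<theta>"
    and window: "e > 0"
    and f_density: "has_density_between F f (q - e) (q + e)"
    and f_const: "0 < c\<^sub>f" "c\<^sub>f \<le> C\<^sub>f"
    and f_bounds: "\<And>v. \<bar>v - q\<bar> \<le> e \<Longrightarrow> c\<^sub>f \<le> f v \<and> f v \<le> C\<^sub>f"
    and f_cont: "isCont f q"
    and no_ties: "\<And>s t. s \<noteq> t \<Longrightarrow> measure M {\<omega> \<in> space M. V s \<omega> = V t \<omega>} = 0"
    and \<theta>_tails: "summable (\<lambda>k. sqrt (\<Sum>j. \<theta> (j + Suc k)))"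
    and ell_top: "filterlim ell at_top sequentially"
    and ell_small: "(\<lambda>n. real (ell n) / real n) \<longlonglongrightarrow> 0"
  shows "tendsto_in_prob M (\<lambda>n. block_variance_estimator V \<alpha> n (ell n)) (long_run_variance M V q)
    \<and> long_run_variance M V q > 0"
proof -
  interpret M: prob_space M by (rule M)
  define \<nu> where "\<nu> = distr M borel (\<epsilon> 0)"
  have \<epsilon>_meas [measurable]: "\<epsilon> t \<in> borel_measurable M" for t
    using innov_indep by (auto simp: M.indep_vars_def)
  have sets_\<nu> [measurable_cong]: "sets \<nu> = sets borel" by (simp add: \<nu>_def)
  have sets_iid: "sets (Pi\<^sub>M UNIV (\<lambda>_. \<nu>)) = sets (Pi\<^sub>M UNIV (\<lambda>_. borel :: 'e measure))"
    by (intro sets_PiM_cong refl sets_\<nu>)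
  interpret innovation_law \<nu>
    by (intro innovation_law.intro innovation_law_axioms.intro)
      (auto simp: \<nu>_def intro!: M.prob_space_distr)
  define path where "path \<omega> = (\<lambda>i. \<epsilon> i \<omega>)" for \<omega>
  \<comment> \<open>the innovations together with the copy of the innovation at time 0\<close>
  define path' where "path' \<omega> = (\<lambda>c. case_option \<epsilon>0' \<epsilon> c \<omega>)" for \<omega>
  have co_meas: "case_option \<epsilon>0' \<epsilon> c \<in> borel_measurable M" for c
    using copy_indep by (auto simp: M.indep_vars_def)
  have path_meas [measurable]: "path \<in> measurable M (iid :: (int \<Rightarrow> 'e) measure)"
    unfolding path_def measurable_cong_sets[OF refl sets_iid]
    by (rule measurable_PiM_single') auto
  have path'_meas [measurable]: "path' \<in> measurable M (iid :: (int option \<Rightarrow> 'e) measure)"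
    unfolding path'_def measurable_cong_sets[OF refl sets_iid]
    by (rule measurable_PiM_single') (auto intro: co_meas)
  have path_law: "distr M iid path = iid"
  proof -
    have "distr M iid path = distr M (Pi\<^sub>M UNIV (\<lambda>_. borel)) path"
      by (rule distr_cong[OF refl sets_iid refl])
    also have "\<dots> = (\<Pi>\<^sub>M i\<in>UNIV. distr M borel (\<epsilon> i))"
      using innov_indep unfolding path_def[abs_def]
      by (subst (asm) M.indep_vars_iff_distr_eq_PiM') (auto simp: restrict_UNIV)
    also have "(\<lambda>i. distr M borel (\<epsilon> i)) = (\<lambda>i. \<nu>)"
      unfolding \<nu>_def by (rule ext) (rule innov_ident)
    finally show ?thesis .
  qed
  have path'_law: "distr M iid path' = iid"
  proof -
    have "distr M iid path' = distr M (Pi\<^sub>M UNIV (\<lambda>_. borel)) path'"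
      by (rule distr_cong[OF refl sets_iid refl])
    also have "\<dots> = (\<Pi>\<^sub>M c\<in>UNIV. distr M borel (case_option \<epsilon>0' \<epsilon> c))"
      using copy_indep unfolding path'_def[abs_def]
      by (subst (asm) M.indep_vars_iff_distr_eq_PiM') (auto simp: restrict_UNIV co_meas)
    also have "(\<lambda>c. distr M borel (case_option \<epsilon>0' \<epsilon> c)) = (\<lambda>i. \<nu>)"
      unfolding \<nu>_def using innov_ident copy_ident by (auto split: option.split)
    finally show ?thesis .
  qed
  have H_iid: "H \<in> borel_measurable iid"
    using H_meas unfolding measurable_cong_sets[OF sets_iid refl] .

  have diff_le: "L2norm M (\<lambda>\<omega>. of_bool (V (int k) \<omega> \<le> v) - of_bool (Vstar (int k) \<omega> \<le> v)) \<le> \<theta> k"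
    and diff_nonneg: "0 \<le> L2norm M (\<lambda>\<omega>. of_bool (V (int k) \<omega> \<le> v) - of_bool (Vstar (int k) \<omega> \<le> v))" for k v
  proof -
    let ?n = "\<lambda>v. L2norm M (\<lambda>\<omega>. of_bool (V (int k) \<omega> \<le> v) - of_bool (Vstar (int k) \<omega> \<le> v))"
    have "?n v \<le> 1" for v
    proof -
      have "(LINT \<omega>|M. \<bar>of_bool (V (int k) \<omega> \<le> v) - of_bool (Vstar (int k) \<omega> \<le> v)\<bar>\<^sup>2) \<le> (LINT \<omega>|M. (1::real))"
        by (rule integral_mono') auto
      then show ?thesis by (simp add: L2norm_def M.prob_space)
    qed
    then have "bdd_above (range ?n)" by (auto simp: bdd_above_def)
    then show "?n v \<le> \<theta> k"
      unfolding \<theta>_def indicator_dependence_def by (intro cSUP_upper) auto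
    show "0 \<le> ?n v" by (simp add: L2norm_def)
  qed
  have \<theta>_nonneg: "0 \<le> \<theta> k" for k using order_trans[OF diff_nonneg diff_le] .
  obtain C where C: "0 < C" and tail: "\<And>h. 1 \<le> h \<Longrightarrow> (\<Sum>j. (\<theta> (j + h))\<^sup>2) \<le> C / (1 + real h) ^ 4"
    and sq_sum: "summable (\<lambda>j. (\<theta> j)\<^sup>2)"
    using quartic_tail[OF \<theta>_nonneg \<theta>_summable \<theta>_tails] by blast
  \<comment> \<open>the difference of two indicators has modulus 0 or 1, so its second moment is the probability of a change\<close>
  interpret causal_process \<nu> H "\<lambda>k. (\<theta> k)\<^sup>2"
  proof (intro causal_process.intro causal_process_axioms.intro innovation_law_axioms H_iid sq_sum)
    fix k and v :: real
    let ?u = "\<lambda>y :: int option \<Rightarrow> 'e. H (\<lambda>i. y (Some (int k - int i)))"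
    let ?w = "\<lambda>y :: int option \<Rightarrow> 'e. H (\<lambda>i. y (if int k - int i = 0 then None else Some (int k - int i)))"
    have m: "?u \<in> borel_measurable iid" "?w \<in> borel_measurable iid"
      by (rule measurable_compose[OF measurable_reindex H_iid])+
    have "{y \<in> space iid. (?u y \<le> v) \<noteq> (?w y \<le> v)} \<in> sets iid" using m by measurable
    then have D: "{y. (?u y \<le> v) \<noteq> (?w y \<le> v)} \<in> sets iid" by simp
    have u: "?u (path' \<omega>) = V (int k) \<omega>" if "\<omega> \<in> space M" for \<omega>
      using V_causal[OF that] by (simp add: path'_def innov_past_def)
    have w: "?w (path' \<omega>) = Vstar (int k) \<omega>" for \<omega>
      unfolding Vstar_def innov_past_def path'_def by (intro arg_cong[where f = H] ext) auto
    have "measure iid {y. (?u y \<le> v) \<noteq> (?w y \<le> v)} = measure (distr M iid path') {y. (?u y \<le> v) \<noteq> (?w y \<le> v)}"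
      by (simp only: path'_law)
    also have "\<dots> = measure M (path' -` {y. (?u y \<le> v) \<noteq> (?w y \<le> v)} \<inter> space M)"
      by (rule measure_distr[OF path'_meas D])
    also have "path' -` {y. (?u y \<le> v) \<noteq> (?w y \<le> v)} \<inter> space M =
        {\<omega> \<in> space M. (V (int k) \<omega> \<le> v) \<noteq> (Vstar (int k) \<omega> \<le> v)}"
      by (auto simp only: vimage_def mem_Collect_eq Int_iff u w)
    also have "measure M \<dots> = (LINT \<omega>|M. indicator {\<omega> \<in> space M. (V (int k) \<omega> \<le> v) \<noteq> (Vstar (int k) \<omega> \<le> v)} \<omega>)"
      by (auto intro!: arg_cong[where f = "measure M"])
    also have "\<dots> = (LINT \<omega>|M. \<bar>of_bool (V (int k) \<omega> \<le> v) - of_bool (Vstar (int k) \<omega> \<le> v)\<bar>\<^sup>2)"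
      by (rule Bochner_Integration.integral_cong) (auto simp: indicator_def)
    also have "\<dots> = (L2norm M (\<lambda>\<omega>. of_bool (V (int k) \<omega> \<le> v) - of_bool (Vstar (int k) \<omega> \<le> v)))\<^sup>2"
      by (simp add: L2norm_def)
    also have "\<dots> \<le> (\<theta> k)\<^sup>2" by (intro power_mono diff_le diff_nonneg)
    finally show "measure iid {y. (?u y \<le> v) \<noteq> (?w y \<le> v)} \<le> (\<theta> k)\<^sup>2" .
  qed
  let ?V = "causal_process.V H"
  have wd: "weakly_dependent iid history ?V C"
    by (rule weakly_dependent_iid[OF C tail])
  interpret W: weakly_dependent iid history ?V C by (rule wd)
  have V_path: "V t \<omega> = ?V t (path \<omega>)" if "\<omega> \<in> space M" for t \<omega>
    using V_causal[OF that] by (simp add: V_def path_def innov_past_def)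
  have V_meas: "V t \<in> borel_measurable M" for t
    using measurable_compose[OF path_meas W.V_measurable[of t]]
    by (subst measurable_cong[OF V_path]) auto

  have F_level: "F v = W.level v" for v
  proof -
    have "F v = measure M {\<omega> \<in> space M. V 0 \<omega> \<le> v}"
      unfolding F_def cdf_def by (subst measure_distr) (auto simp: V_meas vimage_def Int_def conj_commute)
    also have "{\<omega> \<in> space M. V 0 \<omega> \<le> v} = path -` {x. ?V 0 x \<le> v} \<inter> space M"
      by (auto simp: V_path)
    also have "measure M \<dots> = measure (distr M iid path) {x. ?V 0 x \<le> v}"
      by (rule measure_distr[symmetric, OF path_meas V_event])
    finally show ?thesis by (simp add: path_law W.level_def)
  qed
  have rd: "real_distribution (distr M borel (V 0))"
    by (rule M.real_distribution_distr) (rule V_meas)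
  have Fq: "F q = 1 - \<alpha>"
    using cdf_quantile_eq[OF rd _ , of "1 - \<alpha>"] F_cont \<alpha> by (simp add: F_def q_def)
  have dens: "c\<^sub>f * (b - a) \<le> F b - F a" "F b - F a \<le> C\<^sub>f * (b - a)"
    if "q - e \<le> a" "a \<le> b" "b \<le> q + e" for a b
    using density_increment_bounds[OF f_density that, of c\<^sub>f C\<^sub>f] f_bounds by (auto simp: abs_le_iff)
  have pos: "0 < W.lrv q"
    by (rule W.lrv_pos) (use Fq \<alpha> in \<open>simp_all add: F_level[symmetric]\<close>)
  have consistent: "tendsto_in_prob iid (\<lambda>n. block_variance_estimator ?V \<alpha> n (ell n)) (W.lrv q)"
  proof (rule W.estimator_consistent[OF \<alpha> window f_const(1) _ _ _ ell_top ell_small])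
    fix r assume r: "0 \<le> r" "r \<le> e"
    show "W.level (q - r) \<le> 1 - \<alpha> - c\<^sub>f * r"
      using dens(1)[of "q - r" q] r by (simp add: F_level[symmetric] Fq)
    show "1 - \<alpha> + c\<^sub>f * r \<le> W.level (q + r)"
      using dens(1)[of q "q + r"] r by (simp add: F_level[symmetric] Fq)
    show "W.level (q + r) - W.level (q - r) \<le> (2 * C\<^sub>f) * r"
      using dens(2)[of "q - r" "q + r"] r by (simp add: F_level[symmetric] algebra_simps)
  qed

  \<comment> \<open>estimator and covariances depend on the sample point through the path of innovations only, so both
    transfer from the product space\<close>
  have est: "block_variance_estimator V \<alpha> n l \<omega> = block_variance_estimator ?V \<alpha> n l (path \<omega>)"
    if "\<omega> \<in> space M" for n l \<omega>
    unfolding block_variance_estimator_emp_var conformal_cutoff_def by (simp add: V_path[OF that])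
  have est_law: "measure M {\<omega> \<in> space M. d < \<bar>block_variance_estimator V \<alpha> n l \<omega> - c\<bar>} =
      measure iid {x \<in> space iid. d < \<bar>block_variance_estimator ?V \<alpha> n l x - c\<bar>}" for n l d c
  proof -
    let ?D = "{x \<in> space iid. d < \<bar>block_variance_estimator ?V \<alpha> n l x - c\<bar>}"
    have [measurable]: "block_variance_estimator ?V \<alpha> n l \<in> borel_measurable iid"
      by (rule block_variance_estimator_measurable) (use \<alpha> in auto)
    have D: "?D \<in> sets iid" by measurable
    have "measure iid ?D = measure (distr M iid path) ?D" by (simp only: path_law)
    also have "\<dots> = measure M (path -` ?D \<inter> space M)" by (rule measure_distr[OF path_meas D])
    also have "path -` ?D \<inter> space M = {\<omega> \<in> space M. d < \<bar>block_variance_estimator V \<alpha> n l \<omega> - c\<bar>}"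
      by (auto simp: est)
    finally show ?thesis by simp
  qed
  have integral_path: "(LINT \<omega>|M. g (path \<omega>)) = (LINT x|iid. g x)"
    if "g \<in> borel_measurable iid" for g :: "(int \<Rightarrow> 'e) \<Rightarrow> real"
    using integral_distr[OF path_meas that] by (simp add: path_law)
  have "covariance M (\<lambda>\<omega>. of_bool (V 0 \<omega> \<le> q)) (\<lambda>\<omega>. of_bool (V h \<omega> \<le> q)) =
      covariance iid (\<lambda>x. of_bool (?V 0 x \<le> q)) (\<lambda>x. of_bool (?V h x \<le> q))" for h
  proof -
    have e: "(LINT \<omega>|M. of_bool (V t \<omega> \<le> q)) = (LINT x|iid. (of_bool (?V t x \<le> q) :: real))" for t
      by (subst integral_path[symmetric]) (auto intro!: Bochner_Integration.integral_cong simp: V_path)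
    show ?thesis
      unfolding covariance_def e
      by (subst integral_path[symmetric]) (auto intro!: Bochner_Integration.integral_cong simp: V_path)
  qed
  then have "long_run_variance M V q = W.lrv q"
    unfolding W.long_run_variance_lrv[symmetric] long_run_variance_def by simp
  with pos consistent show ?thesis
    unfolding tendsto_in_prob_def est_law by simp
qed

end
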